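(* Let $n=4r+3$, $m=2r+1$, let $\Gamma$ be an $n$-dimensional Bieberbach group with translation lattice $\Lambda$ and holonomy group $F\subset\mathrm{SO}(n)$, let $\varepsilon$ be a spin structure on $M_\Gamma=\Gamma\backslash\mathbb R^n$, and let $\rho:\Gamma\to\mathrm U(V)$ be a finite dimensional unitary representation with $\rho|_\Lambda=\mathrm{Id}$. Then the $\eta$-series of $D_\rho$ on $(M_\Gamma,\varepsilon)$ is given, for $\mathrm{Re}(s)>n$, by $$\eta_{(\Gamma,\rho,\varepsilon)}(s)=\frac{(2i)^m}{|F|(2\pi)^s}\sum_{\substack{\gamma=BL_b\in\Lambda\backslash\Gamma\\ B\in F_1}}\chi_\rho(\gamma)\Big(\prod_{j=1}^m\sin t_j(x_\gamma)\Big)\sum_{\mu\in\frac1{2\pi}\mathcal A}\frac{e_{\mu,\gamma,\sigma}(\delta_\varepsilon)}{|\mu|^s},$$ where $\frac{1}{2\pi}\mathcal A$ denotes the set of $\mu>0$ with $d^+_{\rho,\mu}(\Gamma,\varepsilon)\neq d^-_{\rho,\mu}(\Gamma,\varepsilon)$, $x_\gamma=x(t_1(x_\gamma),\dots,t_m(x_\gamma))$, and $$e_{\mu,\gamma,\sigma}(\delta_\varepsilon)=\sum_{u\in\Lambda^*_{\varepsilon,\mu},\ Bu=u}\sigma(u,x_\gamma)\,e^{-2\pi i\,u\cdot b}.$$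
   Context: Bieberbach groups. $L_b$ is translation by $b\in\mathbb R^n$, and $BL_b$ ($B\in\mathrm O(n)$) is the isometry $x\mapsto B(x+b)$. A Bieberbach group is a discrete, cocompact, torsion-free subgroup $\Gamma$ of the isometry group of $\mathbb R^n$. $\Lambda=\{\lambda:L_\lambda\in\Gamma\}$ is its translation lattice (identified with the group of translations), $r(BL_b)=B$, and $F=r(\Gamma)\simeq\Lambda\backslash\Gamma$ is the (finite) holonomy group; $F\subset\mathrm{SO}(n)$. $n_B=\dim\ker(B-\mathrm{Id})$ and $F_1=\{B\in F:n_B=1\}$. Spin groups and representations. $Cl(n)$ is the Clifford algebra with $vw+wv=-2\langle v,w\rangle$, $\{e_i\}$ the canonical basis, $\mathrm{Spin}(n)=\{v_1\cdots v_l:\|v_j\|=1,\ l\text{ even}\}$, $\mu(g)(x)=gxg^{-1}$ the double cover $\mu:\mathrm{Spin}(n)\to\mathrm{SO}(n)$; $\mathrm{Spin}(n-1)\subset\mathrm{Spin}(n)$ is the subgroup fixing $e_n$. For $n=2m+1$ the maximal torus of $\mathrm{Spin}(n-1)$ is $T=\{x(t_1,\dots,t_m)=\prod_{j=1}^m(\cos t_j+\sin t_j\,e_{2j-1}e_{2j})\}$. $(L,\mathrm S)$ is an irreducible complex representation of $Cl(n)\otimes\mathbb C$, of dimension $2^m$, restricted to $\mathrm{Spin}(n)$; with $\mathrm S_{n-1}^\pm$ the subspace of $\mathrm S$ on which $e_1\cdots e_{2m}$ acts by $\pm i^m$, the module is the one in which $L(e_n)$ acts by $\mp i$ on $\mathrm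 S_{n-1}^\pm$. Spin structures and Dirac operator. Spin structures on $M_\Gamma$ correspond to homomorphisms $\varepsilon:\Gamma\to\mathrm{Spin}(n)$ with $\mu\circ\varepsilon=r$; $\delta_\varepsilon(\lambda)=\varepsilon(L_\lambda)\in\{\pm1\}$ for $\lambda\in\Lambda$. For $\mu\ge0$, $\Lambda^*_{\varepsilon,\mu}=\{u\in\mathbb R^n:\|u\|=\mu,\ \delta_\varepsilon(\lambda)=e^{2\pi i\,u\cdot\lambda}\ \forall\lambda\in\Lambda\}$. $\chi_\rho$ is the character of $\rho$. $D_\rho$ acts on smooth $f:\mathbb R^n\to \mathrm S\otimes V$ satisfying $f(\gamma x)=(L(\varepsilon(\gamma))\otimes\rho(\gamma))f(x)$ for all $\gamma\in\Gamma$, by $D_\rho f=\sum_i(L(e_i)\otimes\mathrm{Id})\,\partial f/\partial x_i$. $d^\pm_{\rho,\mu}(\Gamma,\varepsilon)$ is the multiplicity (possibly $0$) of the eigenvalue $\pm2\pi\mu$, $\mu>0$. The $\eta$-series is $\eta_{(\Gamma,\rho,\varepsilon)}(s)=\sum_{\lambda\neq0}\mathrm{sgn}(\lambda)|\lambda|^{-s}$, summed over nonzero eigenvalues of $D_\rho$ with multiplicity; it converges absolutely for $\mathrm{Re}(s)>n$. The element $x_\gamma$ and the sign $\sigma$. For $\gamma=BL_b\in\Gamma$, $x_\gamma$ is a fixed element of the maximal torus $T$ of $\mathrm{Spin}(n-1)$ conjugate in $\mathrm{Spin}(n)$ to $\varepsilon(\gamma)$. For $u\ne0$ with $Bu=u$,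 choose $h_u\in\mathrm{Spin}(n)$ with $h_uuh_u^{-1}=\|u\|e_n$; put $\sigma(u,x_\gamma)=1$ if $h_u\varepsilon(\gamma)h_u^{-1}$ is conjugate to $x_\gamma$ in $\mathrm{Spin}(n-1)$ and $\sigma(u,x_\gamma)=-1$ otherwise. *)

theory Defs
  imports "HOL-Analysis.Analysis" "HOL-Algebra.Coset" "HOL-Library.Function_Algebras"
begin

section \<open>The real Clifford algebra of Euclidean space\<close>

text \<open>
  \<open>Cl(n)\<close> with \<open>n = CARD('n)\<close> is the real vector space with basis the ordered products
  \<open>e\<^sub>A = \<Prod>\<^sub>i\<^sub>\<in>\<^sub>A e\<^sub>i\<close> (increasing indices), \<open>A\<close> ranging over the subsets of the index type.
  An element is the function of its coefficients.  Sorting the product \<open>e\<^sub>A e\<^sub>B\<close> costs one sign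
  for each pair \<open>(a, b) \<in> A \<times> B\<close> with \<open>b < a\<close> (anticommutation) and one for each common index
  (\<open>e\<^sub>i\<^sup>2 = -1\<close>).
\<close>

typedef 'n clifford = "UNIV :: ('n set \<Rightarrow> real) set"
  morphisms ccoeff Clifford by simp

setup_lifting type_definition_clifford

lemma clifford_eqI: "(\<And>A. ccoeff x A = ccoeff y A) \<Longrightarrow> x = y"
  by (simp add: ccoeff_inject[symmetric] ext)

definition csign :: "'n::{finite,linorder} set \<Rightarrow> 'n set \<Rightarrow> real" where
  "csign A B = (-1) ^ card {(a, b). a \<in> A \<and> b \<in> B \<and> b \<le> a}"

lemma csign_prod:
  "csign A B = (\<Prod>a\<in>A. \<Prod>b\<in>B. if b \<le> a then - 1 else (1::real))"
proof -
  have "(\<Prod>a\<in>A. \<Prod>b\<in>B. if b \<le> a then - 1 else (1::real))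
      = (\<Prod>p\<in>A \<times> B. if snd p \<le> fst p then - 1 else 1)"
    by (simp add: prod.cartesian_product case_prod_beta)
  also have "\<dots> = (\<Prod>p\<in>(A \<times> B) \<inter> {p. snd p \<le> fst p}. - 1)"
    by (subst prod.inter_restrict) (auto intro!: prod.cong)
  also have "\<dots> = csign A B"
    by (auto simp: csign_def intro!: arg_cong[where f = "\<lambda>S. (-1) ^ card S"])
  finally show ?thesis by simp
qed

lemma prod_sym_diff:
  fixes g :: "'a::finite \<Rightarrow> real"
  assumes "\<And>a. g a * g a = 1"
  shows "prod g (sym_diff A B) = prod g A * prod g B"
proof -
  have 1: "prod g (sym_diff A B) = prod g (A - B) * prod g (B - A)"
    by (rule prod.union_disjoint) auto
  have 2: "prod g A = prod g (A - B) * prod g (A \<inter> B)"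
    by (subst prod.union_disjoint[symmetric]) (auto intro!: prod.cong)
  have 3: "prod g B = prod g (B - A) * prod g (A \<inter> B)"
    by (subst prod.union_disjoint[symmetric]) (auto intro!: prod.cong)
  have 4: "prod g (A \<inter> B) * prod g (A \<inter> B) = 1"
    by (simp add: prod.distrib[symmetric] assms)
  show ?thesis
    unfolding 1 2 3 using 4 by (simp add: mult.assoc mult.left_commute)
qed

lemma csign_square: "csign A B * csign A B = 1"
  by (simp add: csign_def flip: power_add mult_2)

lemma csign_sym_diff_left: "csign (sym_diff A B) C = csign A C * csign B C"
  unfolding csign_prod
  by (rule prod_sym_diff) (simp flip: prod.distrib, rule prod.neutral, simp)

lemma csign_sym_diff_right: "csign A (sym_diff B C) = csign A B * csign A C"
  unfolding csign_prod prod.distrib[symmetric]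
  by (intro prod.cong refl prod_sym_diff) auto

instantiation clifford :: ("{finite,linorder}") real_algebra_1
begin

lift_definition zero_clifford :: "'a clifford" is "\<lambda>_. 0" .
lift_definition one_clifford :: "'a clifford" is "\<lambda>A. if A = {} then 1 else 0" .
lift_definition plus_clifford :: "'a clifford \<Rightarrow> 'a clifford \<Rightarrow> 'a clifford"
  is "\<lambda>x y A. x A + y A" .
lift_definition minus_clifford :: "'a clifford \<Rightarrow> 'a clifford \<Rightarrow> 'a clifford"
  is "\<lambda>x y A. x A - y A" .
lift_definition uminus_clifford :: "'a clifford \<Rightarrow> 'a clifford" is "\<lambda>x A. - x A" .
lift_definition scaleR_clifford :: "real \<Rightarrow> 'a clifford \<Rightarrow> 'a clifford"
  is "\<lambda>c x A. c * x A" .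
lift_definition times_clifford :: "'a clifford \<Rightarrow> 'a clifford \<Rightarrow> 'a clifford"
  is "\<lambda>x y C. \<Sum>(A, B) | sym_diff A B = C. csign A B * x A * y B" .

lemma ccoeff_times_sum:
  "ccoeff (x * y) C = (\<Sum>A\<in>UNIV. csign A (sym_diff A C) * ccoeff x A * ccoeff y (sym_diff A C))"
  for x :: "'a clifford"
proof -
  have e: "sym_diff A (sym_diff A B) = B" for A B :: "'a set" by blast
  have "ccoeff (x * y) C = (\<Sum>(A, B) | sym_diff A B = C. csign A B * ccoeff x A * ccoeff y B)"
    by transfer simp
  also have "\<dots> = (\<Sum>A\<in>UNIV. csign A (sym_diff A C) * ccoeff x A * ccoeff y (sym_diff A C))"
    by (rule sum.reindex_bij_witness[where i = "\<lambda>A. (A, sym_diff A C)" and j = fst]) (auto simp only: e fst_conv case_prod_conv mem_Collect_eq UNIV_I)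
  finally show ?thesis .
qed

lemma ccoeff_simps [simp]:
  "ccoeff (0 :: 'a clifford) A = 0"
  "ccoeff (1 :: 'a clifford) A = (if A = {} then 1 else 0)"
  "ccoeff (x + y :: 'a clifford) A = ccoeff x A + ccoeff y A"
  "ccoeff (x - y :: 'a clifford) A = ccoeff x A - ccoeff y A"
  "ccoeff (- x :: 'a clifford) A = - ccoeff x A"
  "ccoeff (c *\<^sub>R x :: 'a clifford) A = c * ccoeff x A"
  by (transfer; simp)+

instance
proof
  fix x y z :: "'a clifford" and a b :: real
  show "x * y * z = x * (y * z)"
  proof (rule clifford_eqI)
    fix D
    let ?k = "\<lambda>A C. ccoeff x A * ccoeff y (sym_diff A C) * ccoeff z (sym_diff C D)"
    have sgn: "csign C (sym_diff C D) * csign A (sym_diff A C)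
        = csign A (sym_diff A D) * csign (sym_diff A C) (sym_diff C D)" for A C :: "'a set"
    proof -
      have "sym_diff A D = sym_diff (sym_diff A C) (sym_diff C D)" by blast
      then have "csign A (sym_diff A D) = csign A (sym_diff A C) * csign A (sym_diff C D)"
        by (simp only: csign_sym_diff_right)
      then show ?thesis
        using csign_square[of A "sym_diff C D"]
        by (simp only: csign_sym_diff_left[of A C]) (simp add: ac_simps)
    qed
    have "ccoeff (x * y * z) D
        = (\<Sum>C\<in>UNIV. \<Sum>A\<in>UNIV. csign C (sym_diff C D) * csign A (sym_diff A C) * ?k A C)"
      unfolding ccoeff_times_sum[of "x * y"] ccoeff_times_sum[of x] sum_distrib_left sum_distrib_right
      by (simp only: ac_simps)
    also have "\<dots> = (\<Sum>A\<in>UNIV. \<Sum>C\<in>UNIV. csign C (sym_diff C D) * csign A (sym_diff A C) * ?k A C)"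
      by (rule sum.swap)
    also have "\<dots> = (\<Sum>A\<in>UNIV. \<Sum>C\<in>UNIV.
        csign A (sym_diff A D) * csign (sym_diff A C) (sym_diff C D) * ?k A C)"
      by (simp only: sgn)
    also have "\<dots> = (\<Sum>A\<in>UNIV. \<Sum>B\<in>UNIV. csign A (sym_diff A D) * csign B (sym_diff B (sym_diff A D))
        * (ccoeff x A * ccoeff y B * ccoeff z (sym_diff B (sym_diff A D))))"
    proof (rule sum.cong[OF refl])
      fix A
      have e: "sym_diff A (sym_diff A B) = B" "sym_diff (sym_diff A B) (sym_diff A D) = sym_diff B D"
        for B by blast+
      show "(\<Sum>C\<in>UNIV. csign A (sym_diff A D) * csign (sym_diff A C) (sym_diff C D) * ?k A C)
          = (\<Sum>B\<in>UNIV. csign A (sym_diff A D) * csign B (sym_diff B (sym_diff A D))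
        * (ccoeff x A * ccoeff y B * ccoeff z (sym_diff B (sym_diff A D))))"
        by (rule sum.reindex_bij_witness[where i = "sym_diff A" and j = "sym_diff A"])
          (simp_all only: e UNIV_I)
    qed
    also have "\<dots> = ccoeff (x * (y * z)) D"
      unfolding ccoeff_times_sum[of x] ccoeff_times_sum[of y] sum_distrib_left sum_distrib_right
      by (simp only: ac_simps)
    finally show "ccoeff (x * y * z) D = ccoeff (x * (y * z)) D" .
  qed
  show "(x + y) * z = x * z + y * z" "x * (y + z) = x * y + x * z"
    by (rule clifford_eqI, simp add: ccoeff_times_sum ring_distribs sum.distrib)+
  have "csign {} C = 1" "csign C {} = 1" for C :: "'a set"
    by (simp_all add: csign_prod)
  then show "1 * x = x" "x * 1 = x"
  proof -
    have d: "sym_diff A C = {} \<longleftrightarrow> A = C" for A C :: "'a set" by blast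
    have c: "csign A (sym_diff A C) * ccoeff x A * ccoeff 1 (sym_diff A C)
        = (if A = C then ccoeff x C else 0)" for A C
      unfolding ccoeff_simps d by (auto simp: \<open>\<And>C. csign C {} = 1\<close>)
    show "1 * x = x"
      by (rule clifford_eqI, subst ccoeff_times_sum)
        (simp add: if_distrib[of "\<lambda>u. u * _"] if_distrib[of "\<lambda>u. _ * u"] \<open>\<And>C. csign {} C = 1\<close> cong: if_cong)
    show "x * 1 = x"
      by (rule clifford_eqI, subst ccoeff_times_sum) (simp only: c, simp)
  qed
  have "ccoeff (0 :: 'a clifford) {} \<noteq> ccoeff (1 :: 'a clifford) {}" by simp
  then show "(0 :: 'a clifford) \<noteq> 1" by metis
  show "a *\<^sub>R x * y = a *\<^sub>R (x * y)" "x * a *\<^sub>R y = a *\<^sub>R (x * y)"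
    by (rule clifford_eqI, simp add: ccoeff_times_sum sum_distrib_left ac_simps)+
qed (auto intro!: clifford_eqI simp: algebra_simps)

end

definition cvec :: "real ^ 'n::{finite,linorder} \<Rightarrow> 'n::{finite,linorder} clifford" where
  "cvec v = Clifford (\<lambda>A. if is_singleton A then v $ the_elem A else 0)"

definition cgen :: "'n \<Rightarrow> 'n::{finite,linorder} clifford" where
  "cgen i = cvec (axis i 1)"

lemma ccoeff_cvec: "ccoeff (cvec v) A = (if is_singleton A then v $ the_elem A else 0)"
  by (simp add: cvec_def Clifford_inverse)

lemma linear_cvec: "linear cvec"
  by (rule linearI) (auto intro!: clifford_eqI simp: ccoeff_cvec)

lemma cvec_eq_sum: "cvec v = (\<Sum>i\<in>UNIV. (v $ i) *\<^sub>R cgen i)"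
proof -
  have "cvec v = cvec (\<Sum>i\<in>UNIV. (v $ i) *\<^sub>R axis i 1)"
    by (metis (no_types, lifting) basis_expansion scalar_mult_eq_scaleR sum.cong)
  then show ?thesis
    by (simp add: linear_sum[OF linear_cvec] linear_scale[OF linear_cvec] cgen_def)
qed

lemma ccoeff_cgen: "ccoeff (cgen i) A = (if A = {i} then 1 else 0)"
  by (auto simp: cgen_def ccoeff_cvec axis_def is_singleton_def)

lemma ccoeff_cgen_times:
  "ccoeff (cgen i * cgen j) C = (if C = sym_diff {i} {j} then csign {i} {j} else 0)"
proof -
  have "ccoeff (cgen i * cgen j) C
      = (\<Sum>A\<in>UNIV. if A = {i} then csign A (sym_diff A C) * ccoeff (cgen j) (sym_diff A C) else 0)"
    unfolding ccoeff_times_sum by (rule sum.cong) (auto simp: ccoeff_cgen)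
  also have "\<dots> = csign {i} (sym_diff {i} C) * ccoeff (cgen j) (sym_diff {i} C)"
    by simp
  also have "\<dots> = (if C = sym_diff {i} {j} then csign {i} {j} else 0)"
  proof -
    have "sym_diff {i} C = {j} \<longleftrightarrow> C = sym_diff {i} {j}" by blast
    then show ?thesis unfolding ccoeff_cgen by auto
  qed
  finally show ?thesis .
qed

lemma cgen_anticommute: "cgen i * cgen j + cgen j * cgen i = (if i = j then - 2 *\<^sub>R 1 else 0)"
proof (rule clifford_eqI)
  fix C
  have s: "csign {a} {b} = (if b \<le> a then -1 else 1)" for a b :: 'a
    by (simp add: csign_prod)
  show "ccoeff (cgen i * cgen j + cgen j * cgen i) C = ccoeff (if i = j then - 2 *\<^sub>R 1 else 0) C"
    unfolding ccoeff_simps(3) ccoeff_cgen_times s by (auto simp del: insert_Diff_if)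
qed

text \<open>The defining relation \<open>v w + w v = -2 \<langle>v, w\<rangle>\<close>.\<close>

lemma cvec_anticommute: "cvec v * cvec w + cvec w * cvec v = of_real (- 2 * (v \<bullet> w))"
proof -
  have "cvec v * cvec w = (\<Sum>i\<in>UNIV. \<Sum>j\<in>UNIV. (v $ i * w $ j) *\<^sub>R (cgen i * cgen j))"
    by (simp add: cvec_eq_sum[of v] cvec_eq_sum[of w] sum_product mult.commute)
  moreover have "cvec w * cvec v = (\<Sum>i\<in>UNIV. \<Sum>j\<in>UNIV. (v $ i * w $ j) *\<^sub>R (cgen j * cgen i))"
    by (subst sum.swap) (simp add: cvec_eq_sum[of v] cvec_eq_sum[of w] sum_product mult.commute)
  ultimately have "cvec v * cvec w + cvec w * cvec v
      = (\<Sum>i\<in>UNIV. \<Sum>j\<in>UNIV. (v $ i * w $ j) *\<^sub>R (cgen i * cgen j + cgen j * cgen i))"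
    by (simp add: sum.distrib[symmetric] scaleR_add_right)
  also have "\<dots> = (\<Sum>i\<in>UNIV. \<Sum>j\<in>UNIV. if i = j then (v $ i * w $ j) *\<^sub>R (- 2 *\<^sub>R 1) else 0)"
    unfolding cgen_anticommute by (intro sum.cong) auto
  also have "\<dots> = of_real (- 2 * (v \<bullet> w))"
    by (simp add: inner_vec_def of_real_def scaleR_sum_left sum_distrib_left sum_negf ac_simps)
  finally show ?thesis .
qed

text \<open>The canonical basis \<open>e\<^sub>1, \<dots>, e\<^sub>n\<close>, numbered from 1 along the order of the index type.\<close>

definition ebasis :: "nat \<Rightarrow> real ^ 'n::{finite,linorder}" where
  "ebasis j = axis (sorted_list_of_set UNIV ! (j - 1)) 1"

section \<open>The spin group\<close>

definition Spin :: "'n::{finite,linorder} clifford monoid" where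
  "Spin = \<lparr>carrier = {prod_list (map cvec vs) | vs. even (length vs) \<and> (\<forall>v\<in>set vs. norm v = 1)},
           mult = (*), one = 1\<rparr>"

lemma cvec_square: "cvec v * cvec v = - of_real ((norm v)\<^sup>2)"
proof -
  have "2 *\<^sub>R (cvec v * cvec v) = 2 *\<^sub>R (- of_real ((norm v)\<^sup>2))"
    using cvec_anticommute[of v v]
    by (simp add: scaleR_2 dot_square_norm of_real_def flip: scaleR_left.add)
  then show ?thesis by (rule scaleR_left_imp_eq[rotated]) simp
qed

lemma prod_list_cvec_inverse:
  assumes "\<forall>v\<in>set vs. norm v = 1"
  shows "prod_list (map cvec (rev (map uminus vs))) * prod_list (map cvec vs) = 1"
  using assms
proof (induction vs)
  case (Cons v vs)
  have "cvec (- v) * (cvec v * y) = y" for y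
    using Cons.prems cvec_square[of v] linear_neg[OF linear_cvec, of v]
    by (simp flip: mult.assoc)
  then show ?case
    using Cons by (simp add: mult.assoc)
qed simp

lemma group_Spin: "group Spin"
proof (rule groupI)
  fix x y :: "'a clifford"
  assume "x \<in> carrier Spin" "y \<in> carrier Spin"
  then obtain vs ws where "x = prod_list (map cvec vs)" "even (length vs)" "\<forall>v\<in>set vs. norm v = 1"
    "y = prod_list (map cvec ws)" "even (length ws)" "\<forall>v\<in>set ws. norm v = 1"
    by (auto simp: Spin_def)
  then show "x \<otimes>\<^bsub>Spin\<^esub> y \<in> carrier Spin"
    by (auto simp: Spin_def intro!: exI[of _ "vs @ ws"])
next
  show "\<one>\<^bsub>Spin\<^esub> \<in> carrier (Spin :: 'a clifford monoid)"
    by (auto simp: Spin_def intro!: exI[of _ "[]"])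
next
  fix x :: "'a clifford"
  assume "x \<in> carrier Spin"
  then obtain vs where vs: "x = prod_list (map cvec vs)" "even (length vs)" "\<forall>v\<in>set vs. norm v = 1"
    by (auto simp: Spin_def)
  then have "prod_list (map cvec (rev (map uminus vs))) \<in> carrier Spin"
    unfolding Spin_def by (auto intro!: exI[of _ "rev (map uminus vs)"])
  moreover have "prod_list (map cvec (rev (map uminus vs))) \<otimes>\<^bsub>Spin\<^esub> x = \<one>\<^bsub>Spin\<^esub>"
    using prod_list_cvec_inverse[OF vs(3)] vs(1) by (simp add: Spin_def)
  ultimately show "\<exists>y\<in>carrier Spin. y \<otimes>\<^bsub>Spin\<^esub> x = \<one>\<^bsub>Spin\<^esub>" by blast
qed (auto simp: Spin_def mult.assoc)

definition spin_mu :: "'n::{finite,linorder} clifford \<Rightarrow> 'n clifford \<Rightarrow> 'n clifford" where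
  "spin_mu g x = g * x * inv\<^bsub>Spin\<^esub> g"

definition Spin_pred :: "'n::{finite,linorder} clifford set" where
  "Spin_pred = {g \<in> carrier Spin. spin_mu g (cvec (ebasis CARD('n))) = cvec (ebasis CARD('n))}"

definition torus_elem :: "nat \<Rightarrow> (nat \<Rightarrow> real) \<Rightarrow> 'n::{finite,linorder} clifford" where
  "torus_elem m t = prod_list (map (\<lambda>j.
     of_real (cos (t j)) + sin (t j) *\<^sub>R (cvec (ebasis (2 * j - 1)) * cvec (ebasis (2 * j)))) [1..<m+1])"

definition spin_torus :: "nat \<Rightarrow> 'n::{finite,linorder} clifford set" where
  "spin_torus m = range (torus_elem m)"

section \<open>The spin module\<close>

text \<open>
  A complex representation of \<open>Cl(n) \<otimes> \<complex>\<close> is given by its restriction to \<open>Cl(n)\<close>, a unital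
  real-linear algebra homomorphism into the complex endomorphisms; the invariant complex
  subspaces are the same.
\<close>

definition clifford_rep :: "('n::{finite,linorder} clifford \<Rightarrow> complex ^ 's ^ 's) \<Rightarrow> bool" where
  "clifford_rep L \<longleftrightarrow> linear L \<and> L 1 = mat 1 \<and> (\<forall>x y. L (x * y) = L x ** L y)"

definition irreducible_clifford_rep :: "('n::{finite,linorder} clifford \<Rightarrow> complex ^ 's ^ 's) \<Rightarrow> bool" where
  "irreducible_clifford_rep L \<longleftrightarrow> clifford_rep L \<and>
     (\<forall>W. vec.subspace W \<and> (\<forall>x. \<forall>w\<in>W. L x *v w \<in> W) \<longrightarrow> W = {0} \<or> W = UNIV)"

text \<open>\<open>half_spin L m (\<plusminus>1)\<close> is the subspace on which \<open>e\<^sub>1 \<cdots> e\<^sub>2\<^sub>m\<close> acts by \<open>\<plusminus> \<i>\<^sup>m\<close>.\<close>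

definition half_spin :: "('n::{finite,linorder} clifford \<Rightarrow> complex ^ 's ^ 's) \<Rightarrow> nat \<Rightarrow> complex \<Rightarrow> (complex ^ 's) set" where
  "half_spin L m c = {w. L (prod_list (map (\<lambda>j. cvec (ebasis j)) [1..<2*m+1])) *v w = (c * \<i> ^ m) *s w}"

definition spin_module :: "nat \<Rightarrow> ('n::{finite,linorder} clifford \<Rightarrow> complex ^ 's ^ 's) \<Rightarrow> bool" where
  "spin_module m L \<longleftrightarrow> irreducible_clifford_rep L \<and> CARD('s) = 2 ^ m \<and>
     (\<forall>w \<in> half_spin L m 1. L (cvec (ebasis CARD('n))) *v w = (- \<i>) *s w) \<and>
     (\<forall>w \<in> half_spin L m (-1). L (cvec (ebasis CARD('n))) *v w = \<i> *s w)"

section \<open>Bieberbach groups\<close>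

text \<open>The pair \<open>(B, b)\<close> stands for the isometry \<open>B L\<^sub>b\<close>, that is \<open>x \<mapsto> B (x + b)\<close>; every isometry
  has exactly one such form.\<close>

type_synonym 'n isom = "(real ^ 'n ^ 'n) \<times> (real ^ 'n)"

definition iso_act :: "'n::finite isom \<Rightarrow> real ^ 'n \<Rightarrow> real ^ 'n" where
  "iso_act g x = fst g *v (x + snd g)"

definition Isom :: "'n::finite isom monoid" where
  "Isom = \<lparr>carrier = {(B, b). orthogonal_matrix B},
           mult = (\<lambda>(B, b) (C, c). (B ** C, c + transpose C *v b)),
           one = (mat 1, 0)\<rparr>"

lemma iso_act_mult:
  assumes "h \<in> carrier Isom"
  shows "iso_act (g \<otimes>\<^bsub>Isom\<^esub> h) x = iso_act g (iso_act h x)"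
proof -
  obtain B b C c where [simp]: "g = (B, b)" "h = (C, c)" by fastforce
  have "C ** transpose C = mat 1"
    using assms by (simp add: Isom_def orthogonal_matrix_def)
  then have "C *v (transpose C *v b) = b"
    by (simp add: matrix_vector_mul_assoc del: transpose_matrix_vector)
  then show ?thesis
    by (simp add: iso_act_def Isom_def matrix_vector_right_distrib add_ac
        del: transpose_matrix_vector flip: matrix_vector_mul_assoc)
qed

lemma group_Isom: "group (Isom :: 'n::finite isom monoid)"
proof (rule groupI)
  fix g :: "'n isom"
  assume "g \<in> carrier Isom"
  then obtain B b where g: "g = (B, b)" "orthogonal_matrix B"
    by (auto simp: Isom_def)
  then have "(transpose B, - (B *v b)) \<in> carrier Isom"
    "(transpose B, - (B *v b)) \<otimes>\<^bsub>Isom\<^esub> g = \<one>\<^bsub>Isom\<^esub>"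
    by (auto simp: Isom_def orthogonal_matrix_def matrix_vector_mul_assoc
        linear_neg[OF matrix_vector_mul_linear] simp del: transpose_matrix_vector)
  then show "\<exists>h \<in> carrier Isom. h \<otimes>\<^bsub>Isom\<^esub> g = \<one>\<^bsub>Isom\<^esub>" by blast
qed (auto simp: Isom_def orthogonal_matrix_mul orthogonal_matrix_id matrix_mul_assoc
    matrix_transpose_mul matrix_vector_right_distrib matrix_vector_mul_assoc add_ac
    simp del: transpose_matrix_vector)

lemma subgroup_actD:
  assumes "subgroup \<Gamma> Isom"
  shows "iso_act (mat 1, 0) x = x" "(mat 1, 0) \<in> \<Gamma>"
    and "g \<in> \<Gamma> \<Longrightarrow> h \<in> \<Gamma> \<Longrightarrow> g \<otimes>\<^bsub>Isom\<^esub> h \<in> \<Gamma> \<and> iso_act (g \<otimes>\<^bsub>Isom\<^esub> h) x = iso_act g (iso_act h x)"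
    and "g \<in> \<Gamma> \<Longrightarrow> \<exists>h\<in>\<Gamma>. iso_act h (iso_act g x) = x"
proof -
  interpret group "Isom :: 'n::finite isom monoid" by (rule group_Isom)
  interpret subgroup \<Gamma> Isom by fact
  show 1: "iso_act (mat 1, 0) x = x" by (simp add: iso_act_def)
  show "(mat 1, 0) \<in> \<Gamma>" using one_closed by (simp add: Isom_def)
  show "g \<otimes>\<^bsub>Isom\<^esub> h \<in> \<Gamma> \<and> iso_act (g \<otimes>\<^bsub>Isom\<^esub> h) x = iso_act g (iso_act h x)"
    if "g \<in> \<Gamma>" "h \<in> \<Gamma>" using that by (auto intro: iso_act_mult mem_carrier m_closed)
  show "\<exists>h\<in>\<Gamma>. iso_act h (iso_act g x) = x" if g: "g \<in> \<Gamma>"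
  proof
    show "inv\<^bsub>Isom\<^esub> g \<in> \<Gamma>" using g by (rule m_inv_closed)
    have "iso_act (inv\<^bsub>Isom\<^esub> g) (iso_act g x) = iso_act (inv\<^bsub>Isom\<^esub> g \<otimes>\<^bsub>Isom\<^esub> g) x"
      using iso_act_mult[OF mem_carrier[OF g]] by simp
    also have "inv\<^bsub>Isom\<^esub> g \<otimes>\<^bsub>Isom\<^esub> g = (mat 1, 0)"
      using g by (simp add: l_inv mem_carrier) (simp add: Isom_def)
    finally show "iso_act (inv\<^bsub>Isom\<^esub> g) (iso_act g x) = x" using 1 by simp
  qed
qed

lemma orbit_inter:
  assumes "subgroup \<Gamma> Isom" "z \<in> (\<lambda>g. iso_act g x) ` \<Gamma>" "z \<in> (\<lambda>g. iso_act g y) ` \<Gamma>"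
  shows "(\<lambda>g. iso_act g x) ` \<Gamma> = (\<lambda>g. iso_act g y) ` \<Gamma>"
proof -
  have orb: "(\<lambda>g. iso_act g w) ` \<Gamma> = (\<lambda>g. iso_act g z) ` \<Gamma>"
    if zw: "z \<in> (\<lambda>g. iso_act g w) ` \<Gamma>" for w
  proof -
    obtain g where g: "g \<in> \<Gamma>" "z = iso_act g w" using zw by blast
    obtain h where h: "h \<in> \<Gamma>" "iso_act h z = w"
      using subgroup_actD(4)[OF assms(1) g(1), of w] g(2) by blast
    have "iso_act k w \<in> (\<lambda>g. iso_act g z) ` \<Gamma>" if "k \<in> \<Gamma>" for k
      using subgroup_actD(3)[OF assms(1) that h(1), of z] h(2) by (auto intro: rev_image_eqI)
    moreover have "iso_act k z \<in> (\<lambda>g. iso_act g w) ` \<Gamma>" if "k \<in> \<Gamma>" for k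
      using subgroup_actD(3)[OF assms(1) that g(1), of w] g(2) by (auto intro: rev_image_eqI)
    ultimately show ?thesis by blast
  qed
  show ?thesis using orb[OF assms(2)] orb[OF assms(3)] by simp
qed

text \<open>The quotient topology on the space of orbits.\<close>

definition orbit_space :: "'n::finite isom set \<Rightarrow> (real ^ 'n) set topology" where
  "orbit_space \<Gamma> = topology (\<lambda>\<U>. \<U> \<subseteq> range (\<lambda>x. (\<lambda>g. iso_act g x) ` \<Gamma>) \<and> open (\<Union>\<U>))"

lemma openin_orbit_space:
  assumes "subgroup \<Gamma> Isom"
  shows "openin (orbit_space \<Gamma>) \<U> \<longleftrightarrow> \<U> \<subseteq> range (\<lambda>x. (\<lambda>g. iso_act g x) ` \<Gamma>) \<and> open (\<Union>\<U>)"
proof -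
  let ?X = "range (\<lambda>x. (\<lambda>g. iso_act g x) ` \<Gamma>)"
  have "istopology (\<lambda>\<U>. \<U> \<subseteq> ?X \<and> open (\<Union>\<U>))"
    unfolding istopology_def
  proof (intro conjI allI impI)
    fix S T assume S: "S \<subseteq> ?X \<and> open (\<Union>S)" and T: "T \<subseteq> ?X \<and> open (\<Union>T)"
    have "\<Union>S \<inter> \<Union>T \<subseteq> \<Union>(S \<inter> T)"
    proof
      fix z assume "z \<in> \<Union>S \<inter> \<Union>T"
      then obtain P Q where PQ: "P \<in> S" "Q \<in> T" "z \<in> P" "z \<in> Q" by blast
      then have "P = Q" using S T orbit_inter[OF assms] by blast
      then show "z \<in> \<Union>(S \<inter> T)" using PQ by blast
    qed
    then have "\<Union>(S \<inter> T) = \<Union>S \<inter> \<Union>T" by blast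
    then show "open (\<Union>(S \<inter> T))" using S T by auto
    show "S \<inter> T \<subseteq> ?X" using S by blast
  next
    fix K assume K: "\<forall>S\<in>K. S \<subseteq> ?X \<and> open (\<Union>S)"
    then show "\<Union>K \<subseteq> ?X" by blast
    have "\<Union>(\<Union>K) = (\<Union>S\<in>K. \<Union>S)" by blast
    then show "open (\<Union>(\<Union>K))" using K by (auto intro: open_UN)
  qed
  then show ?thesis by (simp add: orbit_space_def topology_inverse')
qed

definition bieberbach_group :: "'n::finite isom set \<Rightarrow> bool" where
  "bieberbach_group \<Gamma> \<longleftrightarrow> subgroup \<Gamma> Isom \<and> discrete \<Gamma> \<and> compact_space (orbit_space \<Gamma>) \<and>
     (\<forall>g\<in>\<Gamma>. \<forall>k::nat. g \<noteq> \<one>\<^bsub>Isom\<^esub> \<and> k > 0 \<longrightarrow> g [^]\<^bsub>Isom\<^esub> k \<noteq> \<one>\<^bsub>Isom\<^esub>)"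

abbreviation group_of :: "'n::finite isom set \<Rightarrow> 'n isom monoid" where
  "group_of \<Gamma> \<equiv> Isom\<lparr>carrier := \<Gamma>\<rparr>"

definition translation :: "real ^ 'n \<Rightarrow> 'n::finite isom" where
  "translation b = (mat 1, b)"

definition trans_lattice :: "'n::finite isom set \<Rightarrow> (real ^ 'n) set" where
  "trans_lattice \<Gamma> = {l. translation l \<in> \<Gamma>}"

definition holonomy :: "'n::finite isom set \<Rightarrow> (real ^ 'n ^ 'n) set" where
  "holonomy \<Gamma> = fst ` \<Gamma>"

definition fixed_dim :: "real ^ 'n ^ 'n \<Rightarrow> nat" where
  "fixed_dim B = dim {x. (B - mat 1) *v x = 0}"

definition holonomy1 :: "'n::finite isom set \<Rightarrow> (real ^ 'n ^ 'n) set" where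
  "holonomy1 \<Gamma> = {B \<in> holonomy \<Gamma>. fixed_dim B = 1}"

definition transversal :: "'n::finite isom set \<Rightarrow> 'n isom set \<Rightarrow> bool" where
  "transversal \<Gamma> R \<longleftrightarrow> R \<subseteq> \<Gamma> \<and>
     (\<forall>C \<in> rcosets\<^bsub>group_of \<Gamma>\<^esub> (translation ` trans_lattice \<Gamma>). \<exists>!g. g \<in> R \<inter> C)"

section \<open>Spin structures\<close>

definition spin_structure :: "'n::{finite,linorder} isom set \<Rightarrow> ('n isom \<Rightarrow> 'n clifford) \<Rightarrow> bool" where
  "spin_structure \<Gamma> \<epsilon> \<longleftrightarrow> \<epsilon> \<in> hom (group_of \<Gamma>) Spin \<and>
     (\<forall>g\<in>\<Gamma>. \<forall>x. spin_mu (\<epsilon> g) (cvec x) = cvec (fst g *v x))"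

definition spin_char :: "('n::{finite,linorder} isom \<Rightarrow> 'n clifford) \<Rightarrow> real ^ 'n::{finite,linorder} \<Rightarrow> real" where
  "spin_char \<epsilon> l = (THE c. of_real c = \<epsilon> (translation l))"

definition dual_shell ::
    "'n::{finite,linorder} isom set \<Rightarrow> ('n isom \<Rightarrow> 'n clifford) \<Rightarrow> real \<Rightarrow> (real ^ 'n::{finite,linorder}) set" where
  "dual_shell \<Gamma> \<epsilon> \<mu> = {u. norm u = \<mu> \<and>
     (\<forall>l \<in> trans_lattice \<Gamma>. complex_of_real (spin_char \<epsilon> l) = exp (2 * pi * \<i> * of_real (u \<bullet> l)))}"

section \<open>Twisted Dirac operators\<close>

definition unitary_group :: "(complex ^ 'v ^ 'v) monoid" where
  "unitary_group = \<lparr>carrier = {A. map_matrix cnj (transpose A) ** A = mat 1}, mult = (**), one = mat 1\<rparr>"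

text \<open>\<open>S \<otimes> V\<close> is \<open>complex ^ ('s \<times> 'v)\<close>.\<close>

definition kron :: "complex ^ 's ^ 's \<Rightarrow> complex ^ 'v ^ 'v \<Rightarrow> complex ^ ('s::finite \<times> 'v::finite) ^ ('s::finite \<times> 'v::finite)" where
  "kron A B = (\<chi> p q. A $ fst p $ fst q * B $ snd p $ snd q)"

definition partial_deriv ::
    "'n \<Rightarrow> (real ^ 'n \<Rightarrow> 'b::real_normed_vector) \<Rightarrow> real ^ 'n \<Rightarrow> 'b" where
  "partial_deriv i f x = vector_derivative (\<lambda>t. f (x + t *\<^sub>R axis i 1)) (at 0)"

primrec C_k :: "nat \<Rightarrow> (real ^ 'n \<Rightarrow> 'b::real_normed_vector) \<Rightarrow> bool" where
  "C_k 0 f \<longleftrightarrow> continuous_on UNIV f"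
| "C_k (Suc k) f \<longleftrightarrow> (\<forall>x. f differentiable at x) \<and> (\<forall>i. C_k k (partial_deriv i f))"

definition smooth :: "(real ^ 'n \<Rightarrow> 'b::real_normed_vector) \<Rightarrow> bool" where
  "smooth f \<longleftrightarrow> (\<forall>k. C_k k f)"

definition twisted_spinors ::
    "('n::{finite,linorder} clifford \<Rightarrow> complex ^ 's ^ 's) \<Rightarrow> 'n isom set \<Rightarrow> ('n isom \<Rightarrow> 'n clifford) \<Rightarrow>
     ('n isom \<Rightarrow> complex ^ 'v ^ 'v) \<Rightarrow> (real ^ 'n::{finite,linorder} \<Rightarrow> complex ^ ('s::finite \<times> 'v::finite)) set" where
  "twisted_spinors L \<Gamma> \<epsilon> \<rho> =
     {f. smooth f \<and> (\<forall>g\<in>\<Gamma>. \<forall>x. f (iso_act g x) = kron (L (\<epsilon> g)) (\<rho> g) *v f x)}"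

definition dirac ::
    "('n::{finite,linorder} clifford \<Rightarrow> complex ^ 's ^ 's) \<Rightarrow>
     (real ^ 'n::{finite,linorder} \<Rightarrow> complex ^ ('s::finite \<times> 'v::finite)) \<Rightarrow> real ^ 'n::{finite,linorder} \<Rightarrow> complex ^ ('s::finite \<times> 'v::finite)" where
  "dirac L f x = (\<Sum>i\<in>UNIV. kron (L (cvec (axis i 1))) (mat 1) *v partial_deriv i f x)"

text \<open>Eigenvalues are taken real from the start, since the Dirac operator is symmetric.\<close>

definition dirac_eigenspace ::
    "('n::{finite,linorder} clifford \<Rightarrow> complex ^ 's ^ 's) \<Rightarrow> 'n isom set \<Rightarrow> ('n isom \<Rightarrow> 'n clifford) \<Rightarrow>
     ('n isom \<Rightarrow> complex ^ 'v ^ 'v) \<Rightarrow> real \<Rightarrow> (real ^ 'n::{finite,linorder} \<Rightarrow> complex ^ ('s::finite \<times> 'v::finite)) set" where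
  "dirac_eigenspace L \<Gamma> \<epsilon> \<rho> \<nu> =
     {f \<in> twisted_spinors L \<Gamma> \<epsilon> \<rho>. \<forall>x. dirac L f x = complex_of_real \<nu> *s f x}"

definition fun_scale :: "complex \<Rightarrow> ('a \<Rightarrow> complex ^ 'k) \<Rightarrow> 'a \<Rightarrow> complex ^ 'k" where
  "fun_scale c f = (\<lambda>x. c *s f x)"

lemma vector_space_fun_scale: "vector_space fun_scale"
  by unfold_locales
    (auto simp: fun_scale_def fun_eq_iff plus_fun_def vec.scale_left_distrib vec.scale_right_distrib)

text \<open>
  Complex dimension of the eigenspace.  \<open>vector_space.dim\<close> is 0 on infinite-dimensional spaces, a
  case that does not arise: the Dirac operator is elliptic on a compact manifold.
\<close>

definition dirac_mult ::
    "('n::{finite,linorder} clifford \<Rightarrow> complex ^ 's ^ 's) \<Rightarrow> 'n isom set \<Rightarrow> ('n isom \<Rightarrow> 'n clifford) \<Rightarrow>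
     ('n isom \<Rightarrow> complex ^ 'v ^ 'v) \<Rightarrow> real \<Rightarrow> nat" where
  "dirac_mult L \<Gamma> \<epsilon> \<rho> \<nu> = vector_space.dim fun_scale (dirac_eigenspace L \<Gamma> \<epsilon> \<rho> \<nu>)"

definition dirac_spectrum ::
    "('n::{finite,linorder} clifford \<Rightarrow> complex ^ 's ^ 's) \<Rightarrow> 'n isom set \<Rightarrow> ('n isom \<Rightarrow> 'n clifford) \<Rightarrow>
     ('n isom \<Rightarrow> complex ^ 'v ^ 'v) \<Rightarrow> real set" where
  "dirac_spectrum L \<Gamma> \<epsilon> \<rho> = {\<nu>. \<exists>f \<in> dirac_eigenspace L \<Gamma> \<epsilon> \<rho> \<nu>. f \<noteq> (\<lambda>_. 0)}"

definition eta_term ::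
    "('n::{finite,linorder} clifford \<Rightarrow> complex ^ 's ^ 's) \<Rightarrow> 'n isom set \<Rightarrow> ('n isom \<Rightarrow> 'n clifford) \<Rightarrow>
     ('n isom \<Rightarrow> complex ^ 'v ^ 'v) \<Rightarrow> complex \<Rightarrow> real \<Rightarrow> complex" where
  "eta_term L \<Gamma> \<epsilon> \<rho> s \<nu> =
     of_nat (dirac_mult L \<Gamma> \<epsilon> \<rho> \<nu>) * (of_real (sgn \<nu>) * complex_of_real \<bar>\<nu>\<bar> powr (- s))"

definition eta_series ::
    "('n::{finite,linorder} clifford \<Rightarrow> complex ^ 's ^ 's) \<Rightarrow> 'n isom set \<Rightarrow> ('n isom \<Rightarrow> 'n clifford) \<Rightarrow>
     ('n isom \<Rightarrow> complex ^ 'v ^ 'v) \<Rightarrow> complex \<Rightarrow> complex" where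
  "eta_series L \<Gamma> \<epsilon> \<rho> s = (\<Sum>\<^sub>\<infinity>\<nu> \<in> dirac_spectrum L \<Gamma> \<epsilon> \<rho> - {0}. eta_term L \<Gamma> \<epsilon> \<rho> s \<nu>)"

text \<open>This is the set written \<open>(1 / 2 \<pi>) \<A>\<close>.\<close>

definition asym_set ::
    "('n::{finite,linorder} clifford \<Rightarrow> complex ^ 's ^ 's) \<Rightarrow> 'n isom set \<Rightarrow> ('n isom \<Rightarrow> 'n clifford) \<Rightarrow>
     ('n isom \<Rightarrow> complex ^ 'v ^ 'v) \<Rightarrow> real set" where
  "asym_set L \<Gamma> \<epsilon> \<rho> =
     {\<mu>. \<mu> > 0 \<and> dirac_mult L \<Gamma> \<epsilon> \<rho> (2 * pi * \<mu>) \<noteq> dirac_mult L \<Gamma> \<epsilon> \<rho> (- (2 * pi * \<mu>))}"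

section \<open>The sign and the exponential sums\<close>

text \<open>In the next two definitions \<open>xg\<close> is the chosen torus element for \<open>g\<close> and \<open>h\<close> the choice of the
  elements \<open>h\<^sub>u\<close>.\<close>

definition spin_sign ::
    "('n::{finite,linorder} isom \<Rightarrow> 'n clifford) \<Rightarrow> (real ^ 'n::{finite,linorder} \<Rightarrow> 'n clifford) \<Rightarrow> 'n isom \<Rightarrow>
     'n clifford \<Rightarrow> real ^ 'n::{finite,linorder} \<Rightarrow> complex" where
  "spin_sign \<epsilon> h g xg u =
     (if \<exists>k \<in> Spin_pred. spin_mu k (spin_mu (h u) (\<epsilon> g)) = xg then 1 else - 1)"

definition exp_sum ::
    "'n::{finite,linorder} isom set \<Rightarrow> ('n isom \<Rightarrow> 'n clifford) \<Rightarrow> (real ^ 'n::{finite,linorder} \<Rightarrow> 'n clifford) \<Rightarrow>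
     'n isom \<Rightarrow> 'n clifford \<Rightarrow> real \<Rightarrow> complex" where
  "exp_sum \<Gamma> \<epsilon> h g xg \<mu> =
     (\<Sum>u | u \<in> dual_shell \<Gamma> \<epsilon> \<mu> \<and> fst g *v u = u.
        spin_sign \<epsilon> h g xg u * exp (- 2 * pi * \<i> * of_real (u \<bullet> snd g)))"

end

theory Submission
  imports Defs
begin

text \<open>
  By Bieberbach's first theorem the translation lattice has full rank and the holonomy group is
  finite, and the character \<open>\<delta>\<close> of the spin structure is trivial on a sublattice of full rank.  Hence
  spinors are Fourier series over the dual lattice, and an eigenspinor for \<open>\<plusminus> 2 \<pi> \<mu>\<close> is a finite sum
  of plane waves \<open>exp (2 \<pi> \<i> u \<bullet> x) w\<close> with \<open>|u| = \<mu>\<close>, \<open>u \<in> \<Lambda>\<^sup>*\<close> and \<open>\<i> u w = \<plusminus> \<mu> w\<close>.  Averaging over the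
  holonomy group projects these sums onto the equivariant ones, so the multiplicities are traces of
  projections.  In the difference of the multiplicities of \<open>2 \<pi> \<mu>\<close> and \<open>- 2 \<pi> \<mu>\<close> only the terms
  \<open>\<i> tr L(\<epsilon>(\<gamma>) u) / \<mu>\<close> with \<open>B u = u\<close> survive.  If a unit vector \<open>v \<bottom> u\<close> is fixed by \<open>B\<close>, then \<open>v\<close>
  anticommutes with \<open>\<epsilon>(\<gamma>) u\<close> and the trace vanishes; otherwise conjugation into the torus reduces it
  to \<open>\<sigma> tr L(x e\<^sub>n)\<close>: an element conjugating into the torus can be corrected to fix \<open>e\<^sub>n\<close> unless it
  sends \<open>e\<^sub>n\<close> to \<open>- e\<^sub>n\<close>.
\<close>

section \<open>Fourier series on a flat torus\<close>

text \<open>Multiplicities are values of \<open>vector_space.dim\<close>, which is 0 on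
  infinite-dimensional spaces, so finiteness of the eigenspaces must come out of the argument
  itself. One finite frame supplies everything: the averaged plane waves span the eigenspace, in
  general with relations, and summing the coordinate functionals on the frame vectors gives the
  dimension as a trace. The size of the frame bounds the multiplicity by the number of dual lattice
  points of a given length, and this yields convergence for \<open>Re s > n\<close>. Fourier series
  are never summed. An eigenspinor has coefficients on one finite shell only, so uniqueness of
  Fourier coefficients is enough. The representatives in \<open>R\<close> need not form a group.
  Averaging over them is sound on functions with translation character \<open>\<delta>\<close>,
  where the summand depends only on the rotational part. Behind the full rank of the lattice are two
  facts: compactness of the orthogonal group gives elements that are nearly translations in any
  prescribed direction, and a descent by commutators, a variant of Buser's argument, shows that a
  rotational part close to the identity is the identity.\<close>

lemma invertible_matrix_inv:
  assumes "invertible A"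
  shows "A ** matrix_inv A = mat 1" and "matrix_inv A ** A = mat 1"
  using someI_ex[OF assms[unfolded invertible_def]] by (auto simp: matrix_inv_def)

text \<open>The columns of \<open>A\<close> are the periods. Pulling the period cell back to the
  unit cube keeps the determinant out, so constants have themselves as mean.\<close>

definition periodic_mean :: "real ^ 'n ^ 'n \<Rightarrow> (real ^ 'n \<Rightarrow> 'b::banach) \<Rightarrow> 'b" where
  "periodic_mean A f = integral (cbox 0 1) (\<lambda>y. f (A *v y))"

lemma integral_translate_cbox:
  fixes g :: "'a::euclidean_space \<Rightarrow> 'b::banach"
  assumes "continuous_on UNIV g"
  shows "integral (cbox a b) (\<lambda>y. g (y + c)) = integral (cbox (a + c) (b + c)) g"
proof -
  have "(g has_integral integral (cbox (a + c) (b + c)) g) (cbox (a + c) (b + c))"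
    by (intro integrable_integral integrable_continuous continuous_on_subset[OF assms]) simp
  from has_integral_affinity[OF this, of 1 c]
  have "((\<lambda>y. g (y + c)) has_integral integral (cbox (a + c) (b + c)) g) ((\<lambda>y. y - c) ` cbox (a + c) (b + c))"
    by simp
  also have "(\<lambda>y. y - c) ` cbox (a + c) (b + c) = cbox a b"
    using cbox_translation[of "- c" "a + c" "b + c"] by (simp add: image_def)
  finally show ?thesis by (rule integral_unique)
qed

lemma mem_cbox_axis:
  "y \<in> cbox (a *\<^sub>R axis i 1) (1 + b *\<^sub>R axis i 1 :: real ^ 'n) \<longleftrightarrow>
     a \<le> y $ i \<and> y $ i \<le> 1 + b \<and> (\<forall>j. j \<noteq> i \<longrightarrow> 0 \<le> y $ j \<and> y $ j \<le> 1)"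
  by (auto simp: mem_box_cart axis_def split: if_splits)

text \<open>The shifted cube sticks out beyond 1 by a slab of thickness \<open>s\<close>;
  periodicity moves this slab back to the gap between 0 and \<open>s\<close>.\<close>

lemma integral_cube_shift_unit:
  fixes g :: "real ^ 'n \<Rightarrow> 'b::banach"
  assumes cont: "continuous_on UNIV g" and per: "\<And>y. g (y + axis i 1) = g y"
    and s: "0 \<le> s" "s \<le> 1"
  shows "integral (cbox 0 1) (\<lambda>y. g (y + s *\<^sub>R axis i 1)) = integral (cbox 0 1) g"
proof -
  let ?e = "axis i 1 :: real ^ 'n"
  have int: "g integrable_on cbox a b" for a b
    by (rule integrable_continuous) (rule continuous_on_subset[OF cont], simp)
  have B: "?e \<in> Basis" by (simp add: axis_in_Basis_iff)
  have "integral (cbox 0 1) (\<lambda>y. g (y + s *\<^sub>R ?e)) = integral (cbox (s *\<^sub>R ?e) (1 + s *\<^sub>R ?e)) g"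
    using integral_translate_cbox[OF cont, of 0 1] by simp
  also have "\<dots> = integral (cbox (s *\<^sub>R ?e) (1 + s *\<^sub>R ?e) \<inter> {x. x \<bullet> ?e \<le> 1}) g
      + integral (cbox (s *\<^sub>R ?e) (1 + s *\<^sub>R ?e) \<inter> {x. x \<bullet> ?e \<ge> 1}) g"
    by (rule integral_split[OF int B])
  also have "cbox (s *\<^sub>R ?e) (1 + s *\<^sub>R ?e) \<inter> {x. x \<bullet> ?e \<le> 1} = cbox (s *\<^sub>R ?e) 1"
    using s mem_cbox_axis[of _ s i s] mem_cbox_axis[of _ s i 0] by (auto simp: inner_axis)
  also have "cbox (s *\<^sub>R ?e) (1 + s *\<^sub>R ?e) \<inter> {x. x \<bullet> ?e \<ge> 1} = cbox ?e (1 + s *\<^sub>R ?e)"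
    using s mem_cbox_axis[of _ s i s] mem_cbox_axis[of _ 1 i s] by (auto simp: inner_axis)
  also have "integral (cbox ?e (1 + s *\<^sub>R ?e)) g = integral (cbox 0 (1 + (s - 1) *\<^sub>R ?e)) g"
    using integral_translate_cbox[OF cont, of 0 "1 + (s - 1) *\<^sub>R ?e" ?e] by (simp add: per algebra_simps)
  also have "cbox 0 (1 + (s - 1) *\<^sub>R ?e) = cbox 0 1 \<inter> {x. x \<bullet> ?e \<le> s}"
    using s mem_cbox_axis[of _ 0 i "s - 1"] mem_cbox_axis[of _ 0 i 0] by (auto simp: inner_axis)
  also have "cbox (s *\<^sub>R ?e) 1 = cbox 0 1 \<inter> {x. x \<bullet> ?e \<ge> s}"
    using s mem_cbox_axis[of _ s i 0] mem_cbox_axis[of _ 0 i 0] by (auto simp: inner_axis)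
  also have "integral (cbox 0 1 \<inter> {x. x \<bullet> ?e \<ge> s}) g + integral (cbox 0 1 \<inter> {x. x \<bullet> ?e \<le> s}) g
      = integral (cbox 0 1) g"
    using integral_split[OF int B, of 0 1 s] by (simp add: add.commute)
  finally show ?thesis .
qed

lemma periodic_int_multiple:
  fixes g :: "'a::real_vector \<Rightarrow> 'b"
  assumes per: "\<And>y. g (y + e) = g y"
  shows "g (y + of_int k *\<^sub>R e) = g y"
proof (induction k arbitrary: y rule: int_induct[where k = 0])
  case (step1 i)
  then show ?case using per[of "y + of_int i *\<^sub>R e"] by (simp add: algebra_simps)
next
  case (step2 i)
  then show ?case using per[of "y + of_int (i - 1) *\<^sub>R e"] by (simp add: algebra_simps)
qed simp

lemma integral_cube_shift:
  fixes g :: "real ^ 'n \<Rightarrow> 'b::banach"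
  assumes "continuous_on UNIV g" and "\<And>i y. g (y + axis i 1) = g y"
  shows "integral (cbox 0 1) (\<lambda>y. g (y + t)) = integral (cbox 0 1) g"
proof -
  have "integral (cbox 0 1) (\<lambda>y. g (y + (\<Sum>i\<in>S. (t $ i) *\<^sub>R axis i 1))) = integral (cbox 0 1) g"
    if "finite S" for S
    using that assms
  proof (induction S arbitrary: g rule: finite_induct)
    case (insert i S)
    let ?g = "\<lambda>y. g (y + (t $ i) *\<^sub>R axis i 1)"
    have cont: "continuous_on UNIV ?g"
      by (intro continuous_on_compose2[OF insert.prems(1)] continuous_intros) auto
    have per: "?g (y + axis j 1) = ?g y" for j y
      using insert.prems(2)[of "y + (t $ i) *\<^sub>R axis i 1" j] by (simp add: algebra_simps)
    have "integral (cbox 0 1) (\<lambda>y. g (y + (\<Sum>i\<in>insert i S. (t $ i) *\<^sub>R axis i 1)))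
      = integral (cbox 0 1) (\<lambda>y. ?g (y + (\<Sum>i\<in>S. (t $ i) *\<^sub>R axis i 1)))"
      using insert.hyps by (simp add: algebra_simps)
    also have "\<dots> = integral (cbox 0 1) ?g"
      using insert.IH[OF cont per] .
    \<comment> \<open>The integral part of the shift is absorbed by periodicity; the fractional part
      lies in the range of the one-step lemma.\<close>
    also have "?g = (\<lambda>y. g (y + frac (t $ i) *\<^sub>R axis i 1))"
    proof
      fix y
      have "?g y = g (y + frac (t $ i) *\<^sub>R axis i 1 + of_int \<lfloor>t $ i\<rfloor> *\<^sub>R axis i 1)"
        by (simp add: frac_def algebra_simps)
      also have "\<dots> = g (y + frac (t $ i) *\<^sub>R axis i 1)"
        by (rule periodic_int_multiple) (rule insert.prems(2))
      finally show "?g y = g (y + frac (t $ i) *\<^sub>R axis i 1)" .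
    qed
    also have "integral (cbox 0 1) \<dots> = integral (cbox 0 1) g"
      by (rule integral_cube_shift_unit[OF insert.prems]) (auto simp: frac_lt_1 less_imp_le)
    finally show ?case .
  qed simp
  from this[of UNIV] have "integral (cbox 0 1) (\<lambda>y. g (y + (\<Sum>i\<in>UNIV. (t $ i) *\<^sub>R axis i 1)))
    = integral (cbox 0 1) g" by simp
  then show ?thesis using basis_expansion[of t] by (simp add: scalar_mult_eq_scaleR)
qed

text \<open>Laplace's method: as \<open>k\<close> grows, the weight \<open>Q ^ k\<close>
  concentrates at its strict maximum \<open>c\<close>. If \<open>F c\<close> were nonzero, the part
  of the integral near \<open>c\<close> would be at least of order \<open>p ^ k\<close>, the rest at
  most of order \<open>q ^ k\<close> with \<open>q < p\<close>, and the two could not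
  cancel.\<close>

lemma concentration_point:
  fixes F :: "'a::euclidean_space \<Rightarrow> complex" and Q :: "'a \<Rightarrow> real"
  assumes c: "c \<in> box a b"
    and F: "continuous_on (cbox a b) F" and Q: "continuous_on (cbox a b) Q"
    and Q0: "\<And>y. y \<in> cbox a b \<Longrightarrow> 0 \<le> Q y"
    and Q1: "\<And>y. y \<in> cbox a b \<Longrightarrow> y \<noteq> c \<Longrightarrow> Q y < Q c"
    and zero: "\<And>k. integral (cbox a b) (\<lambda>y. F y * of_real (Q y) ^ k) = 0"
  shows "F c = 0"
proof (rule ccontr)
  assume nz: "F c \<noteq> 0"
  define K where "K = cbox a b"
  \<comment> \<open>Normalised to 1 at \<open>c\<close>, so that it stays above 1/2 nearby.\<close>
  define g where "g y = Re (F y / F c)" for y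
  have cK: "c \<in> K" "c \<in> interior K" using c box_subset_cbox by (auto simp: K_def interior_cbox)
  have gc: "continuous_on K g" unfolding g_def K_def
    using nz by (intro continuous_intros F) auto
  have Qc: "continuous_on K Q" using Q by (simp add: K_def)
  have g1: "g c = 1" using nz by (simp add: g_def)
  have compK: "compact K" by (simp add: K_def)
  obtain C where C: "\<And>y. y \<in> K \<Longrightarrow> norm (g y) \<le> C" "C > 0"
    using compact_imp_bounded[OF compact_continuous_image[OF gc compK]]
    unfolding bounded_pos by auto
  obtain d where d: "d > 0" "\<And>y. y \<in> K \<Longrightarrow> dist y c < d \<Longrightarrow> g y > 1/2"
  proof -
    have "\<exists>d>0. \<forall>y\<in>K. dist y c < d \<longrightarrow> dist (g y) (g c) < 1/2"
      using gc cK(1) unfolding continuous_on_iff by (metis half_gt_zero_iff zero_less_one)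
    then obtain d where "d > 0" "\<forall>y\<in>K. dist y c < d \<longrightarrow> dist (g y) (g c) < 1/2" by blast
    then have "\<bar>g y - 1\<bar> < 1/2" if "y \<in> K" "dist y c < d" for y
      using that by (auto simp: g1 dist_real_def)
    then have "1/2 < g y" if "y \<in> K" "dist y c < d" for y
      using that by (smt (verit) field_sum_of_halves)
    with \<open>d > 0\<close> show ?thesis by (rule that)
  qed
  obtain q where q: "0 \<le> q" "q < Q c" "\<And>y. y \<in> K \<Longrightarrow> dist y c \<ge> d \<Longrightarrow> Q y \<le> q"
  proof (cases "K - ball c d = {}")
    \<comment> \<open>The ball swallows the whole cell, so nothing has to be bounded; only
      \<open>Q c > 0\<close> is needed, and a second point of the cell provides it.\<close>
    case True
    have "K \<noteq> {c}" using c unfolding K_def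
      by (metis K_def cK(2) empty_interior_finite finite.emptyI finite.insertI empty_iff)
    then obtain y where "y \<in> K" "y \<noteq> c" using cK by blast
    then have "0 < Q c" using Q0[of y] Q1[of y] by (simp add: K_def)
    then show ?thesis using True by (intro that[of 0]) (auto simp: dist_commute)
  next
    case False
    have "compact (K - ball c d)" using compK by (rule compact_diff) simp
    then obtain z where z: "z \<in> K - ball c d" "\<And>y. y \<in> K - ball c d \<Longrightarrow> Q y \<le> Q z"
      using continuous_attains_sup[of "K - ball c d" Q] False Qc continuous_on_subset by blast
    then have "z \<noteq> c" using d(1) by auto
    with z show ?thesis
      using Q0[of z] Q1[of z] d(1) by (intro that[of "Q z"]) (auto simp: K_def dist_commute)
  qed
  \<comment> \<open>Any value strictly between \<open>q\<close> and \<open>Q c\<close> serves: above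
    \<open>p\<close> near the peak, below \<open>q\<close> away from it.\<close>
  define p where "p = (q + Q c) / 2"
  have p: "q < p" "p < Q c" "p > 0" using q by (auto simp: p_def)
  obtain e where e: "e > 0" "\<And>y. y \<in> K \<Longrightarrow> dist y c < e \<Longrightarrow> Q y > p"
  proof -
    have "\<exists>d>0. \<forall>y\<in>K. dist y c < d \<longrightarrow> dist (Q y) (Q c) < Q c - p"
      using Qc cK(1) p unfolding continuous_on_iff by (meson diff_gt_0_iff_gt)
    then obtain e where "e > 0" "\<forall>y\<in>K. dist y c < e \<longrightarrow> dist (Q y) (Q c) < Q c - p" by blast
    then show ?thesis by (intro that[of e]) (auto simp: dist_real_def)
  qed
  obtain u v where V: "c \<in> box u v" "cbox u v \<subseteq> interior K \<inter> ball c (min d e)"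
  proof -
    have "open (interior K \<inter> ball c (min d e))" "c \<in> interior K \<inter> ball c (min d e)"
      using cK d e by auto
    then show ?thesis using that by (metis open_contains_cbox)
  qed
  have VK: "cbox u v \<subseteq> K" using V interior_subset by blast
  define w where "w = measure lborel (cbox u v)"
  have w: "w > 0" using V(1) by (auto simp: w_def content_pos_lt_eq mem_box)
  define W where "W = measure lborel K"
  have ineq: "1/2 * p ^ k * w \<le> C * q ^ k * W" for k
  proof -
    have Fint: "(\<lambda>y. F y * of_real (Q y) ^ k) integrable_on K"
      unfolding K_def by (intro integrable_continuous continuous_intros F Q)
    have "((\<lambda>y. F y * of_real (Q y) ^ k) has_integral 0) K"
      using zero[of k] Fint by (simp add: K_def has_integral_iff)
    then have "((\<lambda>y. Re (F y * of_real (Q y) ^ k * (1 / F c))) has_integral Re (0 * (1 / F c))) K"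
      by (intro has_integral_Re has_integral_mult_left)
    moreover have "Re (F y * of_real (Q y) ^ k * (1 / F c)) = g y * Q y ^ k" for y
    proof -
      have "F y * of_real (Q y) ^ k * (1 / F c) = F y / F c * of_real (Q y ^ k)" by simp
      then show ?thesis unfolding g_def by (metis Re_complex_of_real times_complex.simps(1) Im_complex_of_real mult_zero_right diff_zero)
    qed
    ultimately have A: "((\<lambda>y. g y * Q y ^ k) has_integral 0) K" by simp
    have "((\<lambda>y. 1/2 * p ^ k :: real) has_integral (measure lborel (cbox u v) *\<^sub>R (1/2 * p ^ k))) (cbox u v)"
      by (rule has_integral_const)
    then have B1: "((\<lambda>y. if y \<in> cbox u v then 1/2 * p ^ k else 0) has_integral (w * (1/2 * p ^ k))) K"
      by (simp only: has_integral_restrict[OF VK] w_def real_scaleR_def)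
    have B2: "((\<lambda>y. C * q ^ k) has_integral (W * (C * q ^ k))) K"
      using has_integral_const[of "C * q ^ k" a b] by (simp add: W_def K_def)
    have "w * (1/2 * p ^ k) - W * (C * q ^ k) \<le> 0"
    proof (rule has_integral_le[OF has_integral_diff[OF B1 B2] A])
      fix y assume y: "y \<in> K"
      have Qy: "0 \<le> Q y" using Q0 y by (simp add: K_def)
      have Cq: "0 \<le> C * q ^ k" using C q by simp
      consider "y \<in> cbox u v" | "y \<notin> cbox u v" "dist y c < d" | "y \<notin> cbox u v" "dist y c \<ge> d" by linarith
      then show "(if y \<in> cbox u v then 1/2 * p ^ k else 0) - C * q ^ k \<le> g y * Q y ^ k"
      proof cases
        case 1
        then have "dist y c < d" "dist y c < e" using V(2) by (auto simp: dist_commute)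
        then have "1/2 \<le> g y" "p \<le> Q y" using d e y by (auto simp: less_imp_le)
        then have "1/2 * p ^ k \<le> g y * Q y ^ k"
          using p by (intro mult_mono power_mono) auto
        then show ?thesis using 1 Cq by simp
      next
        case 2
        then have "0 \<le> g y * Q y ^ k" using d(2)[OF y] Qy by simp
        then show ?thesis using 2 Cq by simp
      next
        case 3
        have "\<bar>g y * Q y ^ k\<bar> \<le> C * q ^ k"
          unfolding abs_mult using C(1)[OF y] q(3)[OF y 3(2)] Qy C(2) by (intro mult_mono) (auto simp: power_abs intro!: power_mono)
        then show ?thesis using 3 by auto
      qed
    qed
    then show ?thesis by (simp add: algebra_simps)
  qed
  \<comment> \<open>Dividing the inequality by \<open>p ^ k\<close> bounds the positive volume
    \<open>w / 2\<close> by a null sequence.\<close>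
  have "(\<lambda>k. (q / p) ^ k * (C * W)) \<longlonglongrightarrow> 0 * (C * W)"
    using p q by (intro tendsto_mult LIMSEQ_realpow_zero) auto
  then have "\<forall>\<^sub>F k in sequentially. (q / p) ^ k * (C * W) < w / 2"
    using w by (intro order_tendstoD(2)) auto
  then obtain k where "(q / p) ^ k * (C * W) < w / 2"
    by (meson eventually_happens' sequentially_bot)
  then have "q ^ k * (C * W) < w / 2 * p ^ k"
    using p by (simp add: power_divide field_simps)
  then show False using ineq[of k] by (simp add: algebra_simps)
qed


section \<open>Plane waves and Fourier coefficients\<close>

definition plane_wave :: "real ^ 'n \<Rightarrow> real ^ 'n \<Rightarrow> complex" where
  "plane_wave u x = exp (2 * pi * \<i> * of_real (u \<bullet> x))"

definition lattice_periodic :: "real ^ 'n ^ 'n \<Rightarrow> (real ^ 'n \<Rightarrow> 'b) \<Rightarrow> bool" where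
  "lattice_periodic A f \<longleftrightarrow> (\<forall>i x. f (x + column i A) = f x)"

definition dual_lattice :: "real ^ 'n ^ 'n \<Rightarrow> (real ^ 'n) set" where
  "dual_lattice A = {u. \<forall>i. u \<bullet> column i A \<in> \<int>}"

definition fourier_coeff :: "real ^ 'n ^ 'n \<Rightarrow> (real ^ 'n \<Rightarrow> complex) \<Rightarrow> real ^ 'n \<Rightarrow> complex" where
  "fourier_coeff A f u = periodic_mean A (\<lambda>x. f x * plane_wave (- u) x)"

lemma plane_wave_add_right: "plane_wave u (x + y) = plane_wave u x * plane_wave u y"
  by (simp add: plane_wave_def inner_add_right ring_distribs exp_add)

lemma plane_wave_add_left: "plane_wave (u + v) x = plane_wave u x * plane_wave v x"
  by (simp add: plane_wave_def inner_add_left ring_distribs exp_add)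

lemma plane_wave_zero [simp]: "plane_wave 0 x = 1" "plane_wave u 0 = 1"
  by (simp_all add: plane_wave_def)

lemma norm_plane_wave [simp]: "norm (plane_wave u x) = 1"
  by (simp add: plane_wave_def)

lemma plane_wave_inverse: "plane_wave u x * plane_wave (- u) x = 1"
  by (simp flip: plane_wave_add_left)

lemma continuous_on_plane_wave [continuous_intros]:
  "continuous_on S f \<Longrightarrow> continuous_on S (\<lambda>x. plane_wave u (f x))"
  unfolding plane_wave_def by (intro continuous_intros)

lemma plane_wave_eq_1_iff: "plane_wave u x = 1 \<longleftrightarrow> u \<bullet> x \<in> \<int>"
proof -
  have "plane_wave u x = 1 \<longleftrightarrow> (\<exists>k::int. 2 * pi * (u \<bullet> x) = of_int (2 * k) * pi)"
    by (simp add: plane_wave_def exp_eq_1)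
  also have "\<dots> \<longleftrightarrow> (\<exists>k::int. u \<bullet> x = of_int k)"
    by (intro ex_cong1) (auto simp: field_simps)
  finally show ?thesis by (auto simp: Ints_def)
qed

lemma lattice_periodic_plane_wave: "lattice_periodic A (plane_wave u) \<longleftrightarrow> u \<in> dual_lattice A"
proof -
  have "plane_wave u x \<noteq> 0" for x
    using norm_plane_wave[of u x] by (metis norm_zero zero_neq_one)
  then show ?thesis
    by (simp add: lattice_periodic_def dual_lattice_def plane_wave_add_right plane_wave_eq_1_iff)
qed

lemma dual_lattice_minus: "- u \<in> dual_lattice A \<longleftrightarrow> u \<in> dual_lattice A"
  by (simp add: dual_lattice_def)

lemma dual_lattice_add: "u \<in> dual_lattice A \<Longrightarrow> v \<in> dual_lattice A \<Longrightarrow> u + v \<in> dual_lattice A"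
  by (simp add: dual_lattice_def inner_add_left)

lemma continuous_mean_integrand:
  "continuous_on UNIV f \<Longrightarrow> continuous_on S (\<lambda>y. f (A *v y))" for A :: "real ^ 'n ^ 'n"
  by (rule continuous_on_compose2[of UNIV f]) (auto intro: linear_continuous_on)

lemma mean_integrable:
  fixes f :: "real ^ 'n \<Rightarrow> 'b::banach" and A :: "real ^ 'n ^ 'n"
  assumes "continuous_on UNIV f"
  shows "(\<lambda>y. f (A *v y)) integrable_on cbox a b"
  using integrable_continuous[OF continuous_mean_integrand[OF assms], of A a b] .

lemma periodic_mean_const [simp]: "periodic_mean A (\<lambda>x. c) = c"
proof -
  have "integral (cbox 0 (1 :: real ^ 'n)) (\<lambda>y. c) = measure lborel (cbox 0 (1 :: real ^ 'n)) *\<^sub>R c"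
    by simp
  also have "measure lborel (cbox 0 (1 :: real ^ 'n)) = 1"
    by (subst content_cbox_cart) (auto simp: interval_eq_empty_cart)
  finally show ?thesis by (simp add: periodic_mean_def)
qed

lemma periodic_mean_add:
  assumes "continuous_on UNIV f" "continuous_on UNIV g"
  shows "periodic_mean A (\<lambda>x. f x + g x) = periodic_mean A f + periodic_mean A g"
  unfolding periodic_mean_def by (intro integral_add mean_integrable assms)

lemma periodic_mean_mult:
  fixes f :: "real ^ 'n \<Rightarrow> complex"
  shows "periodic_mean A (\<lambda>x. c * f x) = c * periodic_mean A f"
  unfolding periodic_mean_def by (rule integral_mult_right)

lemma periodic_mean_sum:
  assumes "finite I" "\<And>i. i \<in> I \<Longrightarrow> continuous_on UNIV (f i)"
  shows "periodic_mean A (\<lambda>x. \<Sum>i\<in>I. f i x) = (\<Sum>i\<in>I. periodic_mean A (f i))"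
  unfolding periodic_mean_def by (intro integral_sum mean_integrable assms)

lemma periodic_mean_translate:
  fixes f :: "real ^ 'n \<Rightarrow> 'b::banach"
  assumes A: "invertible A" and f: "continuous_on UNIV f" "lattice_periodic A f"
  shows "periodic_mean A (\<lambda>x. f (x + t)) = periodic_mean A f"
proof -
  have "A *v (matrix_inv A *v t) = t"
    using A by (simp add: matrix_vector_mul_assoc invertible_matrix_inv)
  then have "periodic_mean A (\<lambda>x. f (x + t)) = integral (cbox 0 1) (\<lambda>y. f (A *v (y + matrix_inv A *v t)))"
    by (simp add: periodic_mean_def matrix_vector_right_distrib)
  also have "\<dots> = integral (cbox 0 1) (\<lambda>y. f (A *v y))"
    using f(2) by (intro integral_cube_shift continuous_mean_integrand[OF f(1)])
      (simp add: matrix_vector_right_distrib matrix_vector_mult_basis lattice_periodic_def)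
  finally show ?thesis by (simp add: periodic_mean_def)
qed

text \<open>The mean of \<open>f (x + t v)\<close> does not depend on \<open>t\<close>;
  differentiating under the integral sign leaves the mean of \<open>f'\<close>. This is integration
  by parts on the torus, without boundary terms.\<close>

lemma periodic_mean_directional_derivative:
  fixes f f' :: "real ^ 'n \<Rightarrow> complex"
  assumes A: "invertible A" and f: "continuous_on UNIV f" "lattice_periodic A f"
    and f': "continuous_on UNIV f'"
    and deriv: "\<And>x. ((\<lambda>t. f (x + t *\<^sub>R v)) has_vector_derivative f' x) (at 0)"
  shows "periodic_mean A f' = 0"
proof -
  have d: "((\<lambda>t. f (x + t *\<^sub>R v)) has_vector_derivative f' (x + t *\<^sub>R v)) (at t)" for x t
  proof -
    have "((\<lambda>r. f ((x + t *\<^sub>R v) + (r - t) *\<^sub>R v)) has_vector_derivative (1::real) *\<^sub>R f' (x + t *\<^sub>R v)) (at t)"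
      by (rule vector_diff_chain_at[where g = "\<lambda>r. f ((x + t *\<^sub>R v) + r *\<^sub>R v)" and f = "\<lambda>r. r - t", unfolded o_def])
        (auto intro!: derivative_eq_intros deriv)
    then show ?thesis by (simp add: algebra_simps)
  qed
  have "((\<lambda>t. integral (cbox 0 1) (\<lambda>y. f (A *v y + t *\<^sub>R v))) has_vector_derivative
      integral (cbox 0 1) (\<lambda>y. f' (A *v y + 0 *\<^sub>R v))) (at 0 within UNIV)"
  proof (rule leibniz_rule_vector_derivative)
    show "((\<lambda>t. f (A *v y + t *\<^sub>R v)) has_vector_derivative f' (A *v y + t *\<^sub>R v)) (at t within UNIV)" for t y
      using d by simp
    show "(\<lambda>y. f (A *v y + t *\<^sub>R v)) integrable_on cbox 0 1" for t
      by (intro integrable_continuous continuous_on_compose2[OF f(1)] continuous_intros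
          linear_continuous_on matrix_vector_mul_bounded_linear) auto
    show "continuous_on (UNIV \<times> cbox 0 1) (\<lambda>(t, y). f' (A *v y + t *\<^sub>R v))"
      unfolding split_beta
      by (intro continuous_on_compose2[OF f'] continuous_intros
          continuous_on_compose2[OF linear_continuous_on[OF matrix_vector_mul_bounded_linear[of A]]]) auto
  qed auto
  moreover have "integral (cbox 0 1) (\<lambda>y. f (A *v y + t *\<^sub>R v)) = periodic_mean A f" for t
    using periodic_mean_translate[OF A f] by (simp add: periodic_mean_def)
  ultimately have "((\<lambda>t::real. periodic_mean A f) has_vector_derivative periodic_mean A f') (at 0)"
    by (simp add: periodic_mean_def)
  then show ?thesis
    by (metis has_vector_derivative_const vector_derivative_at)
qed

lemma periodic_mean_plane_wave:
  assumes A: "invertible A" and u: "u \<in> dual_lattice A"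
  shows "periodic_mean A (plane_wave u) = (if u = 0 then 1 else 0)"
proof (cases "u = 0")
  case True
  then have "plane_wave u = (\<lambda>_. 1)" by auto
  then show ?thesis using True by simp
next
  case False
  \<comment> \<open>Chosen so that \<open>u \<bullet> t = 1/2\<close>: translation by
    \<open>t\<close> multiplies the wave by -1 but preserves its mean.\<close>
  define t where "t = (1 / (2 * (u \<bullet> u))) *\<^sub>R u"
  have half_nonint: "(1/2 :: real) \<notin> \<int>"
  proof
    assume "(1/2 :: real) \<in> \<int>"
    then obtain k :: int where "1/2 = real_of_int k" by (auto elim: Ints_cases)
    then have "real_of_int (2 * k) = real_of_int 1" by simp
    then have "2 * k = 1" by (simp only: of_int_eq_iff)
    then show False by presburger
  qed
  have "u \<bullet> t = 1 / 2" using False by (simp add: t_def)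
  then have t: "plane_wave u t \<noteq> 1"
    using half_nonint unfolding plane_wave_eq_1_iff by metis
  have "periodic_mean A (plane_wave u) = periodic_mean A (\<lambda>x. plane_wave u (x + t))"
    using u by (intro periodic_mean_translate[OF A, symmetric])
      (auto intro: continuous_intros simp: lattice_periodic_plane_wave)
  also have "\<dots> = plane_wave u t * periodic_mean A (plane_wave u)"
    by (simp add: plane_wave_add_right mult.commute flip: periodic_mean_mult)
  finally show ?thesis using t False by simp
qed

text \<open>Makes the peak used below strict: within one period the minimum of the cosine is
  attained at the midpoint only.\<close>

lemma cos_2pi_unit_interval:
  assumes "0 \<le> t" "t \<le> 1" "t \<noteq> 1/2"
  shows "cos (2 * pi * t) > -1"
proof -
  have "cos (2 * pi * t) \<noteq> -1"
  proof
    assume "cos (2 * pi * t) = -1"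
    then obtain k :: int where "2 * pi * t = (2 * of_int k + 1) * pi"
      by (auto simp: cos_eq_minus1 algebra_simps)
    then have k: "2 * t = 2 * real_of_int k + 1" by simp
    with assms have "(2::real) * of_int k < 2 * 1" "2 * of_int k > (2::real) * (-1)" by linarith+
    then have "k < 1" "k > -1" by linarith+
    then have "k = 0" by linarith
    with k have "2 * t = 1" by simp
    with assms show False by simp
  qed
  then show ?thesis using cos_ge_minus_one[of "2 * pi * t"] by linarith
qed

text \<open>The powers of a trigonometric polynomial peaking at a single point of the period cell
  concentrate the mean there, so a function orthogonal to all plane waves vanishes at that point.\<close>

lemma fourier_vanish_center:
  fixes f :: "real ^ 'n \<Rightarrow> complex"
  assumes A: "invertible A" and f: "continuous_on UNIV f"
    and coeff: "\<And>u. u \<in> dual_lattice A \<Longrightarrow> periodic_mean A (\<lambda>x. f x * plane_wave u x) = 0"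
  shows "f (A *v (\<chi> i. 1/2)) = 0"
proof -
  \<comment> \<open>The dual basis of the columns of \<open>A\<close>; its inner products read off
    the coordinates in the period cell.\<close>
  define d where "d i = row i (matrix_inv A)" for i
  have dA: "d i \<bullet> (A *v y) = y $ i" for i y
  proof -
    have "d i \<bullet> (A *v y) = (matrix_inv A *v (A *v y)) $ i"
      by (simp add: d_def matrix_vector_mul_component row_def)
    then show ?thesis using A by (simp add: matrix_vector_mul_assoc invertible_matrix_inv)
  qed
  have d: "d i \<in> dual_lattice A" for i
    unfolding dual_lattice_def mem_Collect_eq matrix_vector_mult_basis[symmetric] dA by (auto simp: axis_def)
  \<comment> \<open>This is the squared sine of half the angle: values between 0 and 1, equal to 1
    on the cell only where the \<open>i\<close>-th coordinate is 1/2, and a combination of the waves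
    for 0 and \<open>\<plusminus> d i\<close>.\<close>
  define w where "w i x = (1 - cos (2 * pi * (d i \<bullet> x))) / 2" for i x
  have w: "of_real (w i x) = 1/2 - 1/4 * plane_wave (d i) x - 1/4 * plane_wave (- d i) x" for i x
  proof -
    have c: "complex_of_real (cos (2 * pi * (d i \<bullet> x))) = (plane_wave (d i) x + plane_wave (- d i) x) / 2"
      unfolding cos_of_real[symmetric] cos_exp_eq plane_wave_def by (simp add: mult_ac)
    have "complex_of_real (w i x) = (1 - (plane_wave (d i) x + plane_wave (- d i) x) / 2) / 2"
      unfolding w_def of_real_divide of_real_diff c by (simp only: of_real_1 of_real_numeral)
    moreover have "(1 - (p + q) / 2) / 2 = 1/2 - 1/4 * p - 1/4 * q" for p q :: complex
      by (simp add: field_simps)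
    ultimately show ?thesis by (simp only:)
  qed
  \<comment> \<open>Multiplication by \<open>w i\<close> only shifts frequencies by dual lattice
    vectors, so orthogonality to all waves survives it, and hence survives every power of
    \<open>Q\<close>.\<close>
  define N where "N = {g. continuous_on UNIV g \<and>
    (\<forall>u\<in>dual_lattice A. periodic_mean A (\<lambda>x. g x * plane_wave u x) = 0)}"
  have wc: "continuous_on S (w i)" for S i
    unfolding w_def by (intro continuous_intros) auto
  have mult_w: "(\<lambda>x. g x * of_real (w i x)) \<in> N" if g: "g \<in> N" for g i
  proof -
    have gc: "continuous_on UNIV g" using g by (simp add: N_def)
    have "periodic_mean A (\<lambda>x. g x * of_real (w i x) * plane_wave u x) = 0" if u: "u \<in> dual_lattice A" for u
    proof -
      have eq: "(\<lambda>x. g x * of_real (w i x) * plane_wave u x) =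
        (\<lambda>x. (1/2 * (g x * plane_wave u x) + (- 1/4) * (g x * plane_wave (u + d i) x))
          + (- 1/4) * (g x * plane_wave (u - d i) x))"
        unfolding w diff_conv_add_uminus[of u] plane_wave_add_left by (simp add: algebra_simps)
        have K: "continuous_on UNIV (\<lambda>x. c * (g x * plane_wave v x))" for c v
          by (intro continuous_intros gc)
        have "periodic_mean A (\<lambda>x. g x * plane_wave v x) = 0" if "v \<in> dual_lattice A" for v
          using g that by (simp add: N_def)
        then show ?thesis
          using u d[of i] dual_lattice_add[OF u d[of i]] dual_lattice_add[OF u, of "- d i"]
          unfolding eq periodic_mean_add[OF continuous_on_add[OF K K] K] periodic_mean_add[OF K K] periodic_mean_mult
          by (simp add: dual_lattice_minus)
    qed
    then show ?thesis using gc wc by (auto simp: N_def intro!: continuous_intros)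
  qed
  define Q where "Q x = (\<Prod>i\<in>UNIV. w i x)" for x
  have mult_Q: "(\<lambda>x. g x * of_real (Q x)) \<in> N" if "g \<in> N" for g
  proof -
    have "(\<lambda>x. g x * of_real (\<Prod>i\<in>S. w i x)) \<in> N" if "finite S" for S
      using that
    proof (induction S rule: finite_induct)
      case empty
      then show ?case using \<open>g \<in> N\<close> by simp
    next
      case (insert i S)
      from mult_w[OF insert.IH, of i] show ?case
        using insert.hyps by (simp add: mult_ac)
    qed
    then show ?thesis by (simp add: Q_def)
  qed
  have fQ: "(\<lambda>x. f x * of_real (Q x) ^ k) \<in> N" for k
  proof (induction k)
    case 0
    then show ?case using f coeff by (simp add: N_def)
  next
    case (Suc k)
    from mult_Q[OF this] show ?case by (simp add: mult_ac)
  qed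
  define c :: "real ^ 'n" where "c = (\<chi> i. 1/2)"
  have wA: "w i (A *v y) = (1 - cos (2 * pi * (y $ i))) / 2" for i y
    by (simp add: w_def dA)
  have w01: "0 \<le> w i x" "w i x \<le> 1" for i x
    using cos_ge_minus_one[of "2 * pi * (d i \<bullet> x)"] cos_le_one[of "2 * pi * (d i \<bullet> x)"] by (auto simp: w_def)
  have Qc: "Q (A *v c) = 1"
    by (simp add: Q_def wA c_def)
  have "f (A *v c) = 0"
  proof (rule concentration_point[where F = "\<lambda>y. f (A *v y)" and Q = "\<lambda>y. Q (A *v y)" and a = 0 and b = 1])
    show "c \<in> box 0 1" by (simp add: c_def mem_box_cart)
    show "continuous_on (cbox 0 1) (\<lambda>y. f (A *v y))" by (rule continuous_mean_integrand[OF f])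
    show "continuous_on (cbox 0 1) (\<lambda>y. Q (A *v y))"
      by (rule continuous_mean_integrand) (unfold Q_def, intro continuous_on_prod wc)
    show "0 \<le> Q (A *v y)" for y unfolding Q_def by (intro prod_nonneg w01 ballI)
    show "Q (A *v y) < Q (A *v c)" if y: "y \<in> cbox 0 1" "y \<noteq> c" for y
    proof -
      obtain i where i: "y $ i \<noteq> 1/2" using y(2) by (auto simp: c_def vec_eq_iff)
      have "Q (A *v y) = w i (A *v y) * (\<Prod>j\<in>UNIV - {i}. w j (A *v y))"
        unfolding Q_def by (rule prod.remove) auto
      also have "\<dots> \<le> w i (A *v y) * 1"
        by (intro mult_left_mono prod_le_1 w01) (auto simp: w01)
      also have "\<dots> < 1"
        using cos_2pi_unit_interval[of "y $ i"] i y(1) by (simp add: wA mem_box_cart)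
      finally show ?thesis by (simp add: Qc)
    qed
    show "integral (cbox 0 1) (\<lambda>y. f (A *v y) * of_real (Q (A *v y)) ^ k) = 0" for k
    proof -
      \<comment> \<open>The plain integral is the coefficient at frequency 0.\<close>
      have "0 \<in> dual_lattice A" by (simp add: dual_lattice_def)
      then show ?thesis using fQ[of k] by (auto simp: N_def periodic_mean_def)
    qed
  qed
  then show ?thesis by (simp add: c_def)
qed

text \<open>The peak argument sees only the centre of the cell. A translation brings any point there
  and multiplies the coefficients by phases.\<close>

lemma fourier_coeff_unique:
  fixes f :: "real ^ 'n \<Rightarrow> complex"
  assumes A: "invertible A" and f: "continuous_on UNIV f" "lattice_periodic A f"
    and coeff: "\<And>u. u \<in> dual_lattice A \<Longrightarrow> fourier_coeff A f u = 0"
  shows "f x = 0"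
proof -
  define t where "t = x - A *v (\<chi> i. 1/2)"
  have ft: "continuous_on UNIV (\<lambda>x. f (x + t))"
    by (intro continuous_on_compose2[OF f(1)] continuous_intros) auto
  have "f (A *v (\<chi> i. 1/2) + t) = 0"
  proof (rule fourier_vanish_center[OF A ft])
    fix u assume u: "u \<in> dual_lattice A"
    have "plane_wave u x = plane_wave (- u) t * plane_wave u (x + t)" for x
      using plane_wave_inverse[of "- u" t] by (simp add: plane_wave_add_right mult.left_commute)
    then have "(\<lambda>x. f (x + t) * plane_wave u x) = (\<lambda>x. plane_wave (- u) t * (f (x + t) * plane_wave u (x + t)))"
      by (metis mult.left_commute)
    then have "periodic_mean A (\<lambda>x. f (x + t) * plane_wave u x)
        = periodic_mean A (\<lambda>x. plane_wave (- u) t * (f (x + t) * plane_wave u (x + t)))" by simp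
    also have "\<dots> = plane_wave (- u) t * periodic_mean A (\<lambda>x. f x * plane_wave u x)"
      unfolding periodic_mean_mult
      using u f(2) lattice_periodic_plane_wave[of A u]
      by (subst periodic_mean_translate[OF A, where f = "\<lambda>x. f x * plane_wave u x"])
        (auto intro!: continuous_intros f(1) simp: lattice_periodic_def)
    also have "\<dots> = 0"
      using coeff[of "- u"] u by (simp add: fourier_coeff_def dual_lattice_minus)
    finally show "periodic_mean A (\<lambda>x. f (x + t) * plane_wave u x) = 0" .
  qed
  then show ?thesis by (simp add: t_def)
qed

text \<open>Orthogonality of waves, stated for frequencies that may coincide: the averaged waves
  below are indexed by group elements, several of which can send \<open>u\<close> to the same
  vector.\<close>

lemma fourier_coeff_sum_plane_waves:
  assumes A: "invertible A" and J: "finite J" "\<And>j. j \<in> J \<Longrightarrow> k j \<in> dual_lattice A"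
    and v: "v \<in> dual_lattice A"
  shows "fourier_coeff A (\<lambda>x. \<Sum>j\<in>J. c j * plane_wave (k j) x) v = (\<Sum>j\<in>J. if k j = v then c j else 0)"
proof -
  have "fourier_coeff A (\<lambda>x. \<Sum>j\<in>J. c j * plane_wave (k j) x) v
      = periodic_mean A (\<lambda>x. \<Sum>j\<in>J. c j * plane_wave (k j - v) x)"
    by (simp add: fourier_coeff_def sum_distrib_right mult.assoc flip: plane_wave_add_left)
  also have "\<dots> = (\<Sum>j\<in>J. c j * periodic_mean A (plane_wave (k j - v)))"
    by (subst periodic_mean_sum) (auto intro!: continuous_intros J simp: periodic_mean_mult)
  also have "\<dots> = (\<Sum>j\<in>J. if k j = v then c j else 0)"
  proof (intro sum.cong refl)
    fix j assume "j \<in> J"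
    then have "k j - v \<in> dual_lattice A"
      using dual_lattice_add[OF J(2), of j "- v"] v by (simp add: dual_lattice_minus)
    then show "c j * periodic_mean A (plane_wave (k j - v)) = (if k j = v then c j else 0)"
      by (simp add: periodic_mean_plane_wave[OF A])
  qed
  finally show ?thesis .
qed

text \<open>The difference of the two sides has no Fourier coefficient left, so uniqueness applies
  and no convergence question arises.\<close>

lemma fourier_finite_expansion:
  fixes f :: "real ^ 'n \<Rightarrow> complex"
  assumes A: "invertible A" and f: "continuous_on UNIV f" "lattice_periodic A f"
    and U: "finite U" "U \<subseteq> dual_lattice A"
    and coeff: "\<And>u. u \<in> dual_lattice A - U \<Longrightarrow> fourier_coeff A f u = 0"
  shows "f x = (\<Sum>u\<in>U. fourier_coeff A f u * plane_wave u x)"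
proof -
  let ?s = "\<lambda>x. \<Sum>u\<in>U. fourier_coeff A f u * plane_wave u x"
  have sc: "continuous_on UNIV ?s" by (intro continuous_intros)
  have "f x - ?s x = 0"
  proof (rule fourier_coeff_unique[OF A, where f = "\<lambda>x. f x - ?s x"])
    show "continuous_on UNIV (\<lambda>x. f x - ?s x)" by (intro continuous_intros f sc)
    show "lattice_periodic A (\<lambda>x. f x - ?s x)"
      using f(2) lattice_periodic_plane_wave[of A] U(2) unfolding lattice_periodic_def
      by (auto intro!: sum.cong) (use subset_iff in blast)+
    fix v assume v: "v \<in> dual_lattice A"
    have "fourier_coeff A (\<lambda>x. f x - ?s x) v
       = periodic_mean A (\<lambda>x. f x * plane_wave (- v) x + (-1) * (?s x * plane_wave (- v) x))"
      by (simp add: fourier_coeff_def algebra_simps)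
    also have "\<dots> = fourier_coeff A f v - fourier_coeff A ?s v"
      by (subst periodic_mean_add, (intro continuous_intros f(1) sc)+)
        (simp only: fourier_coeff_def periodic_mean_mult, simp)
    also have "\<dots> = 0"
      using fourier_coeff_sum_plane_waves[OF A U(1) _ v, of "\<lambda>u. u" "fourier_coeff A f"] U coeff[of v] v
      by (cases "v \<in> U") (auto simp: subset_iff)
    finally show "fourier_coeff A (\<lambda>x. f x - ?s x) v = 0" .
  qed
  then show ?thesis by simp
qed

section \<open>Bieberbach's first theorem\<close>

declare transpose_matrix_vector [simp del]

section \<open>Operator norms and orthogonal matrices\<close>

lemma matrix_diff_ldistrib: "A ** (B - C) = A ** B - A ** C" for B C :: "'a::ring_1 ^ 'k ^ 'm"
  by (vector matrix_matrix_mult_def sum_subtractf[symmetric] algebra_simps)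

lemma matrix_diff_rdistrib: "(B - C) ** A = B ** A - C ** A" for B C :: "'a::ring_1 ^ 'k ^ 'm"
  by (vector matrix_matrix_mult_def sum_subtractf[symmetric] algebra_simps)

abbreviation opnorm :: "real ^ 'n ^ 'n \<Rightarrow> real" where
  "opnorm A \<equiv> onorm ((*v) A)"

lemma norm_matrix_vector_le: "norm (A *v x) \<le> opnorm A * norm x"
  by (rule onorm) (rule matrix_vector_mul_bounded_linear)

lemma opnorm_nonneg: "0 \<le> opnorm A"
  by (rule onorm_pos_le) (rule matrix_vector_mul_bounded_linear)

lemma opnorm_mult: "opnorm (A ** B) \<le> opnorm A * opnorm B"
proof -
  have "(*v) (A ** B) = (*v) A \<circ> (*v) B" by (simp add: fun_eq_iff matrix_vector_mul_assoc)
  then show ?thesis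
    using onorm_compose[of "(*v) A" "(*v) B"] by (simp add: matrix_vector_mul_bounded_linear)
qed

lemma opnorm_diff: "opnorm (A - B) \<le> opnorm A + opnorm B"
proof (rule onorm_le)
  fix x
  have "norm ((A - B) *v x) \<le> norm (A *v x) + norm (B *v x)"
    by (simp add: matrix_vector_mult_diff_rdistrib norm_triangle_ineq4)
  also have "\<dots> \<le> opnorm A * norm x + opnorm B * norm x"
    by (intro add_mono norm_matrix_vector_le)
  finally show "norm ((A - B) *v x) \<le> (opnorm A + opnorm B) * norm x"
    by (simp add: algebra_simps)
qed

text \<open>Compactness lives in the Euclidean norm, the geometric estimates in the operator norm.
  This comparison and its converse link them, and the crude factor is harmless.\<close>

lemma opnorm_le_norm: "opnorm A \<le> (real CARD('n))\<^sup>2 * norm A" for A :: "real ^ 'n ^ 'n"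
proof -
  have "\<bar>A $ i $ j\<bar> \<le> norm A" for i j
    by (meson component_le_norm_cart Finite_Cartesian_Product.norm_nth_le order_trans)
  then have "opnorm A \<le> real CARD('n) * real CARD('n) * norm A"
    by (rule onorm_le_matrix_component)
  then show ?thesis by (simp add: power2_eq_square)
qed

lemma norm_le_opnorm: "norm A \<le> (real CARD('n))\<^sup>2 * opnorm A" for A :: "real ^ 'n ^ 'n"
proof -
  have "norm A \<le> (\<Sum>i\<in>UNIV. norm (A $ i))"
    unfolding norm_vec_def[of A] by (rule L2_set_le_sum) simp
  also have "\<dots> \<le> (\<Sum>i\<in>UNIV. \<Sum>j\<in>UNIV. \<bar>A $ i $ j\<bar>)"
    by (intro sum_mono norm_le_l1_cart)
  also have "\<dots> \<le> (\<Sum>i\<in>(UNIV::'n set). \<Sum>j\<in>(UNIV::'n set). opnorm A)"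
    by (intro sum_mono matrix_component_le_onorm)
  finally show ?thesis by (simp add: power2_eq_square)
qed

lemma norm_orthogonal_mult:
  "orthogonal_matrix A \<Longrightarrow> norm (A *v x) = norm x" for A :: "real ^ 'n ^ 'n"
  by (metis orthogonal_transformation_matrix orthogonal_transformation_norm matrix_of_matrix_vector_mul matrix_vector_mul_linear)

lemma opnorm_orthogonal: "orthogonal_matrix A \<Longrightarrow> opnorm A \<le> 1"
  by (rule onorm_le) (simp add: norm_orthogonal_mult)

lemma opnorm_mult_orthogonal:
  assumes "orthogonal_matrix Q"
  shows "opnorm (Q ** A) \<le> opnorm A" and "opnorm (A ** Q) \<le> opnorm A"
  using opnorm_mult[of Q A] opnorm_mult[of A Q] opnorm_orthogonal[OF assms]
    mult_left_mono[OF opnorm_orthogonal[OF assms] opnorm_nonneg, of A]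
    mult_right_mono[OF opnorm_orthogonal[OF assms] opnorm_nonneg, of A] by auto

lemma orthogonal_matrix_transpose_mult:
  "orthogonal_matrix Q \<Longrightarrow> Q ** transpose Q = mat 1"
  "orthogonal_matrix Q \<Longrightarrow> transpose Q ** Q = mat 1"
  by (simp_all add: orthogonal_matrix_def)

lemma orthogonal_transpose_vector:
  "orthogonal_matrix Q \<Longrightarrow> Q *v (transpose Q *v y) = y"
  "orthogonal_matrix Q \<Longrightarrow> transpose Q *v (Q *v y) = y"
  by (simp_all add: matrix_vector_mul_assoc orthogonal_matrix_transpose_mult)

lemma opnorm_eq_0: "opnorm A = 0 \<longleftrightarrow> A = 0"
proof
  assume "opnorm A = 0"
  then have "norm A \<le> 0" using norm_le_opnorm[of A] by simp
  then show "A = 0" by simp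
qed (simp add: onorm_eq_0[OF matrix_vector_mul_bounded_linear])

text \<open>\<open>A B - B A\<close> does not change when 1 is subtracted from both factors, so it
  is of second order in the distances from the identity. This makes the commutator descent
  contract.\<close>

lemma opnorm_commutator:
  assumes A: "orthogonal_matrix A" and B: "orthogonal_matrix B"
  shows "opnorm (A ** B ** transpose A ** transpose B - mat 1)
    \<le> 2 * opnorm (A - mat 1) * opnorm (B - mat 1)"
proof -
  let ?P = "(A - mat 1) ** (B - mat 1)" and ?Q = "(B - mat 1) ** (A - mat 1)"
  have "A ** B ** transpose A ** transpose B - mat 1 = (A ** B - B ** A) ** transpose A ** transpose B"
    by (simp add: matrix_diff_rdistrib matrix_mul_assoc[symmetric] orthogonal_matrix_transpose_mult[OF A]
        orthogonal_matrix_transpose_mult[OF B])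
  moreover have "A ** B - B ** A = ?P - ?Q"
    by (simp add: matrix_diff_rdistrib matrix_diff_ldistrib)
  ultimately have "opnorm (A ** B ** transpose A ** transpose B - mat 1)
      = opnorm ((?P - ?Q) ** transpose A ** transpose B)" by simp
  also have "\<dots> \<le> opnorm (?P - ?Q)"
    using opnorm_mult_orthogonal(2)[of "transpose B" "(?P - ?Q) ** transpose A"]
      opnorm_mult_orthogonal(2)[of "transpose A" "?P - ?Q"] A B by simp
  also have "\<dots> \<le> opnorm ?P + opnorm ?Q" by (rule opnorm_diff)
  also have "\<dots> \<le> opnorm (A - mat 1) * opnorm (B - mat 1) + opnorm (B - mat 1) * opnorm (A - mat 1)"
    by (intro add_mono opnorm_mult)
  finally show ?thesis by simp
qed

text \<open>\<open>affine_in \<Gamma> A a\<close> says that \<open>x \<mapsto> A x + a\<close> belongs to \<open>\<Gamma>\<close>, whose elements \<open>(B, b)\<close> encode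
  \<open>x \<mapsto> B (x + b)\<close>.\<close>

definition affine_in :: "'n::finite isom set \<Rightarrow> real ^ 'n ^ 'n \<Rightarrow> real ^ 'n \<Rightarrow> bool" where
  "affine_in \<Gamma> A a \<longleftrightarrow> (A, transpose A *v a) \<in> \<Gamma>"

abbreviation isom_mult :: "'n::finite isom \<Rightarrow> 'n isom \<Rightarrow> 'n isom" (infixl "\<odot>" 70) where
  "g \<odot> h \<equiv> g \<otimes>\<^bsub>Isom\<^esub> h"

lemma isom_inverse:
  assumes "subgroup \<Gamma> Isom" "(B, b) \<in> \<Gamma>"
  shows "(transpose B, - (B *v b)) \<in> \<Gamma>"
proof -
  interpret group "Isom :: 'a isom monoid" by (rule group_Isom)
  have B: "(B, b) \<in> carrier Isom" "orthogonal_matrix B"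
    using subgroup.mem_carrier[OF assms] by (auto simp: Isom_def)
  have "inv\<^bsub>Isom\<^esub> (B, b) = (transpose B, - (B *v b))"
    using B by (intro inv_equality) (auto simp: Isom_def orthogonal_matrix_def
        linear_neg[OF matrix_vector_mul_linear] orthogonal_transpose_vector)
  then show ?thesis using subgroup.m_inv_closed[OF assms] by simp
qed

context
  fixes \<Gamma> :: "'n::finite isom set"
  assumes sub: "subgroup \<Gamma> Isom"
begin

lemma affine_in_orthogonal: "affine_in \<Gamma> A a \<Longrightarrow> orthogonal_matrix A"
  using subgroup.mem_carrier[OF sub] by (fastforce simp: affine_in_def Isom_def)

lemma affine_in_mult:
  assumes "affine_in \<Gamma> A a" "affine_in \<Gamma> B b"
  shows "affine_in \<Gamma> (A ** B) (A *v b + a)"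
proof -
  have "(A, transpose A *v a) \<odot> (B, transpose B *v b) \<in> \<Gamma>"
    using assms subgroup.m_closed[OF sub] by (simp add: affine_in_def)
  then show ?thesis
    using affine_in_orthogonal[OF assms(1)]
    by (simp add: affine_in_def Isom_def matrix_transpose_mul matrix_vector_right_distrib
        orthogonal_transpose_vector flip: matrix_vector_mul_assoc)
qed

lemma affine_in_inverse:
  assumes "affine_in \<Gamma> A a"
  shows "affine_in \<Gamma> (transpose A) (- (transpose A *v a))"
  using isom_inverse[OF sub, of A "transpose A *v a"] assms affine_in_orthogonal[OF assms]
  by (simp add: affine_in_def linear_neg[OF matrix_vector_mul_linear] orthogonal_transpose_vector)

text \<open>The translational part is arranged as a leading term \<open>(A - 1) b\<close> plus a
  remainder in which \<open>b\<close> and \<open>a\<close> meet only \<open>1 - C\<close> and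
  \<open>1 - B\<close>; it is therefore small when the rotational part of \<open>B\<close>
  is.\<close>

lemma affine_in_commutator:
  assumes "affine_in \<Gamma> A a" "affine_in \<Gamma> B b"
  defines "C \<equiv> A ** B ** transpose A ** transpose B"
  shows "affine_in \<Gamma> C ((A - mat 1) *v b + ((mat 1 - C) *v b + (A ** (mat 1 - B) ** transpose A) *v a))"
proof -
  note o = affine_in_orthogonal[OF assms(1)] affine_in_orthogonal[OF assms(2)]
  have "affine_in \<Gamma> ((A ** B) ** (transpose A ** transpose B))
     ((A ** B) *v (transpose A *v (- (transpose B *v b)) + (- (transpose A *v a))) + (A *v b + a))"
    by (intro affine_in_mult affine_in_inverse assms)
  moreover have "(A ** B) *v (transpose A *v (- (transpose B *v b)) + (- (transpose A *v a))) + (A *v b + a)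
    = (A - mat 1) *v b + ((mat 1 - C) *v b + (A ** (mat 1 - B) ** transpose A) *v a)"
    using o by (simp add: C_def matrix_vector_mult_diff_rdistrib matrix_vector_right_distrib matrix_diff_rdistrib
        matrix_diff_ldistrib linear_neg[OF matrix_vector_mul_linear] matrix_vector_mul_assoc matrix_mul_assoc
        orthogonal_matrix_transpose_mult algebra_simps)
  ultimately show ?thesis by (simp add: C_def matrix_mul_assoc)
qed

end

section \<open>Consequences of discreteness and cocompactness\<close>

lemma finite_bounded_separated:
  fixes S :: "'a::euclidean_space set"
  assumes "bounded S" "\<delta> > 0" "\<And>x y. x \<in> S \<Longrightarrow> y \<in> S \<Longrightarrow> dist x y < \<delta> \<Longrightarrow> x = y"
  shows "finite S"
proof -
  have "uniform_discrete S"
    unfolding uniform_discrete_def using assms by blast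
  then show ?thesis using assms(1) uniform_discrete_finite_iff by blast
qed

lemma bounded_orthogonal_matrices: "bounded {A :: real ^ 'n ^ 'n. orthogonal_matrix A}"
proof (rule boundedI)
  fix A :: "real ^ 'n ^ 'n" assume "A \<in> {A. orthogonal_matrix A}"
  then have "(real CARD('n))\<^sup>2 * opnorm A \<le> (real CARD('n))\<^sup>2 * 1"
    by (intro mult_left_mono opnorm_orthogonal) auto
  then show "norm A \<le> (real CARD('n))\<^sup>2"
    using norm_le_opnorm[of A] by (simp only: mult_1_right)
qed

lemma finite_minimizer:
  fixes f :: "'a \<Rightarrow> real"
  assumes "P p" "finite {q. P q \<and> f q \<le> f p}"
  obtains q where "P q" "\<And>r. P r \<Longrightarrow> f q \<le> f r"
proof -
  let ?S = "{q. P q \<and> f q \<le> f p}"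
  have "arg_min_on f ?S \<in> ?S" and le: "\<And>y. y \<in> ?S \<Longrightarrow> f (arg_min_on f ?S) \<le> f y"
    using arg_min_if_finite(1)[OF assms(2)] arg_min_least[OF assms(2)] assms(1) by auto
  then show ?thesis
    by (intro that[of "arg_min_on f ?S"]) (auto, smt (verit, best) assms(1) mem_Collect_eq)
qed

text \<open>Discreteness is used only at the identity. Two nearby elements have a quotient near the
  identity, uniformly because linear parts are isometries, so the bounded set is separated.\<close>

lemma affine_in_finite:
  fixes \<Gamma> :: "'n::finite isom set"
  assumes sub: "subgroup \<Gamma> Isom" and d: "discrete \<Gamma>"
  shows "finite {(A, a). affine_in \<Gamma> A a \<and> norm a \<le> C}"
proof -
  have "(mat 1, 0) \<in> \<Gamma>" using subgroup_actD(2)[OF sub] .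
  then obtain e where e: "e > 0" "\<And>p. p \<in> \<Gamma> \<Longrightarrow> dist (mat 1, 0) p < e \<Longrightarrow> p = (mat 1, 0)"
    using d isolated_inE_dist by (metis discreteD)
  \<comment> \<open>One factor for each passage between the two norms; the additional 2 in
    \<open>e / (2 * K)\<close> shares \<open>e\<close> between the two components of the
    pair.\<close>
  define K where "K = (real CARD('n))\<^sup>2 * (real CARD('n))\<^sup>2"
  have K: "K > 0" by (simp add: K_def)
  have K1: "K \<ge> 1"
    unfolding K_def by (metis mult_ge1_I one_le_power of_nat_1 of_nat_le_iff zero_less_card_finite One_nat_def Suc_leI)
  show ?thesis
  proof (rule finite_bounded_separated[where \<delta> = "e / (2 * K)"])
    have "{(A, a). affine_in \<Gamma> A a \<and> norm a \<le> C} \<subseteq> {A. orthogonal_matrix A} \<times> cball 0 C"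
      using affine_in_orthogonal[OF sub] by auto
    then show "bounded {(A, a). affine_in \<Gamma> A a \<and> norm a \<le> C}"
      by (rule bounded_subset[rotated]) (intro bounded_Times bounded_orthogonal_matrices bounded_cball)
    show "e / (2 * K) > 0" using e K by simp
    fix p q
    assume p: "p \<in> {(A, a). affine_in \<Gamma> A a \<and> norm a \<le> C}" and q: "q \<in> {(A, a). affine_in \<Gamma> A a \<and> norm a \<le> C}"
      and pq: "dist p q < e / (2 * K)"
    obtain A a B b where pq_def: "p = (A, a)" "q = (B, b)" by (cases p; cases q)
    have g: "affine_in \<Gamma> A a" "affine_in \<Gamma> B b" using p q by (auto simp: pq_def)
    note o = affine_in_orthogonal[OF sub g(1)] affine_in_orthogonal[OF sub g(2)]
    have "affine_in \<Gamma> (transpose A ** B) (transpose A *v b + - (transpose A *v a))"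
      by (intro affine_in_mult[OF sub] affine_in_inverse[OF sub] g)
    then have in_\<Gamma>: "(transpose A ** B, transpose (transpose A ** B) *v (transpose A *v (b - a))) \<in> \<Gamma>"
      by (simp add: affine_in_def matrix_vector_mult_diff_distrib)
    have dAB: "dist A B < e / (2 * K)" "dist a b < e / (2 * K)"
      using pq dist_fst_le[of p q] dist_snd_le[of p q] by (auto simp: pq_def)
    have "norm (transpose A ** B - mat 1) = norm (transpose A ** (B - A))"
      using o by (simp add: matrix_diff_ldistrib orthogonal_matrix_transpose_mult)
    also have "\<dots> \<le> (real CARD('n))\<^sup>2 * opnorm (transpose A ** (B - A))" by (rule norm_le_opnorm)
    also have "\<dots> \<le> (real CARD('n))\<^sup>2 * opnorm (B - A)"
      using o by (intro mult_left_mono opnorm_mult_orthogonal) auto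
    also have "\<dots> \<le> (real CARD('n))\<^sup>2 * ((real CARD('n))\<^sup>2 * norm (B - A))"
      by (intro mult_left_mono opnorm_le_norm) auto
    also have "\<dots> = K * dist A B" by (simp add: K_def dist_norm norm_minus_commute)
    also have "\<dots> < K * (e / (2 * K))" using K dAB by (intro mult_strict_left_mono) auto
    also have "\<dots> = e / 2" using K by simp
    finally have d1: "dist (mat 1) (transpose A ** B) < e / 2" by (simp add: dist_norm norm_minus_commute)
    have "norm (transpose (transpose A ** B) *v (transpose A *v (b - a))) = norm (b - a)"
      using o by (simp add: norm_orthogonal_mult orthogonal_matrix_mul)
    also have "\<dots> < e / (2 * K)" using dAB by (simp add: dist_norm norm_minus_commute)
    also have "\<dots> \<le> e / 2" using K1 e by (intro divide_left_mono) auto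
    finally have d2: "dist 0 (transpose (transpose A ** B) *v (transpose A *v (b - a))) < e / 2" by simp
    have "dist (mat 1, 0) (transpose A ** B, transpose (transpose A ** B) *v (transpose A *v (b - a)))
      < e"
      unfolding dist_Pair_Pair
      using d1 d2 by (intro order_le_less_trans[OF sqrt_sum_squares_le_sum]) auto
    from e(2)[OF in_\<Gamma> this] have eq: "transpose A ** B = mat 1"
      "transpose (transpose A ** B) *v (transpose A *v (b - a)) = 0" by auto
    have "B = A ** (transpose A ** B)" using o by (simp add: matrix_mul_assoc orthogonal_matrix_transpose_mult)
    then have "A = B" using eq by simp
    moreover have "transpose A *v (b - a) = 0" using eq by simp
    then have "b - a = 0" using o(1) orthogonal_transpose_vector(1)[of A "b - a"] by simp
    ultimately show "p = q" by (simp add: pq_def)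
  qed
qed

text \<open>The orbits of points in balls of growing integral radius form an open cover of the orbit
  space. A finite subcover bounds the distance from any point to the orbit of the origin, and
  \<open>a\<close> is the image of the origin under \<open>x \<mapsto> A x + a\<close>.\<close>

lemma cocompact_orbit:
  fixes \<Gamma> :: "'n::finite isom set"
  assumes sub: "subgroup \<Gamma> Isom" and comp: "compact_space (orbit_space \<Gamma>)"
  obtains d where "\<And>y. \<exists>A a. affine_in \<Gamma> A a \<and> norm (a - y) \<le> d"
proof -
  define orb where "orb x = (\<lambda>g. iso_act g x) ` \<Gamma>" for x
  define U where "U k = orb ` ball 0 (real k)" for k
  have Uk: "openin (orbit_space \<Gamma>) (U k)" for k
  proof -
    have "\<Union>(U k) = (\<Union>g\<in>\<Gamma>. iso_act g ` ball 0 (real k))" by (auto simp: U_def orb_def)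
    moreover have "open (iso_act g ` ball 0 (real k))" if g: "g \<in> \<Gamma>" for g
    proof -
      obtain B b where [simp]: "g = (B, b)" by (cases g)
      have "(B, b) \<in> carrier Isom" using subgroup.mem_carrier[OF sub g] by simp
      then have "surj ((*v) B)"
        by (intro surjI[where f = "(*v) (transpose B)" for f]) (auto simp: Isom_def orthogonal_transpose_vector)
      then have "open ((*v) B ` ((\<lambda>x. b + x) ` ball 0 (real k)))"
        by (intro open_surjective_linear_image open_translation) auto
      moreover have "(*v) B ` ((\<lambda>x. b + x) ` ball 0 (real k)) = iso_act g ` ball 0 (real k)"
        by (auto simp: iso_act_def image_image add.commute)
      ultimately show ?thesis by simp
    qed
    ultimately show ?thesis
      unfolding openin_orbit_space[OF sub] by (auto simp: U_def orb_def)
  qed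
  have top: "topspace (orbit_space \<Gamma>) = range orb"
  proof
    show "topspace (orbit_space \<Gamma>) \<subseteq> range orb"
      using openin_topspace[of "orbit_space \<Gamma>"] unfolding openin_orbit_space[OF sub] orb_def by simp
    have "x \<in> orb x" for x :: "real ^ 'n" using subgroup_actD(1,2)[OF sub] by (metis orb_def image_eqI)
    then have "\<Union>(range orb) = UNIV" by blast
    then have "openin (orbit_space \<Gamma>) (range orb)"
      unfolding openin_orbit_space[OF sub] by (simp add: orb_def)
    then show "range orb \<subseteq> topspace (orbit_space \<Gamma>)" by (rule openin_subset)
  qed
  have "range orb \<subseteq> \<Union>(range U)"
  proof safe
    fix x :: "real ^ 'n"
    obtain k :: nat where "norm x < real k" using reals_Archimedean2 by blast
    then have "x \<in> ball 0 (real k)" by simp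
    then show "orb x \<in> \<Union>(range U)" unfolding U_def by blast
  qed
  then obtain F where F: "finite F" "F \<subseteq> range U" "range orb \<subseteq> \<Union>F"
    using comp[unfolded compact_space_alt, rule_format, of "range U"] Uk top by auto
  obtain I where I: "finite I" "F = U ` I" using F(1,2) by (meson finite_subset_image)
  obtain N where N: "\<And>i. i \<in> I \<Longrightarrow> i \<le> N" using I(1) by (meson finite_nat_set_iff_bounded_le)
  have "\<exists>A a. affine_in \<Gamma> A a \<and> norm (a - y) \<le> real N" for y
  proof -
    have "orb y \<in> \<Union>F" using F(3) by blast
    then obtain i z where iz: "i \<in> I" "norm z < real i" "orb y = orb z" by (auto simp: I(2) U_def)
    have "y \<in> orb y" using subgroup_actD(1,2)[OF sub] by (metis orb_def image_eqI)
    then obtain A b where g: "(A, b) \<in> \<Gamma>" "y = A *v (z + b)" using iz(3) by (auto simp: orb_def iso_act_def)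
    have A: "orthogonal_matrix A" using subgroup.mem_carrier[OF sub g(1)] by (simp add: Isom_def)
    have "affine_in \<Gamma> A (A *v b)"
      using g(1) A by (simp add: affine_in_def orthogonal_transpose_vector)
    moreover have "norm (A *v b - y) = norm z"
      using A norm_orthogonal_mult[OF A, of z] by (simp add: g(2) matrix_vector_right_distrib)
    ultimately show ?thesis using iz N[OF iz(1)] by (intro exI[of _ A] exI[of _ "A *v b"]) auto
  qed
  then show ?thesis using that by blast
qed


text \<open>Take group elements whose translational parts lie within \<open>d\<close> of
  \<open>k u\<close>, for all \<open>k\<close>. Their rotational parts accumulate, so two of them
  nearly agree even when the indices are far apart; the quotient of these two moves almost along
  \<open>u\<close> with little rotation.\<close>

lemma almost_translation_in_direction:
  fixes \<Gamma> :: "'n::finite isom set"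
  assumes sub: "subgroup \<Gamma> Isom" and comp: "compact_space (orbit_space \<Gamma>)"
    and u: "norm u = 1" and \<epsilon>: "\<epsilon> > 0" and \<delta>: "\<delta> > 0"
  obtains B b t where "affine_in \<Gamma> B b" "opnorm (B - mat 1) \<le> \<epsilon>" "t > 0" "norm (b - t *\<^sub>R u) \<le> \<delta> * t"
proof -
  obtain d where d: "\<And>y. \<exists>A a. affine_in \<Gamma> A a \<and> norm (a - y) \<le> d"
    using cocompact_orbit[OF sub comp] by metis
  then have "\<forall>k::nat. \<exists>p. affine_in \<Gamma> (fst p) (snd p) \<and> norm (snd p - real k *\<^sub>R u) \<le> d"
    by (metis fst_conv snd_conv)
  then obtain p where p: "\<And>k::nat. affine_in \<Gamma> (fst (p k)) (snd (p k))"
    "\<And>k. norm (snd (p k) - real k *\<^sub>R u) \<le> d" by metis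
  define A where "A k = fst (p k)" for k
  define a where "a k = snd (p k)" for k
  have Aa: "affine_in \<Gamma> (A k) (a k)" "norm (a k - real k *\<^sub>R u) \<le> d" for k
    using p by (auto simp: A_def a_def)
  note o = affine_in_orthogonal[OF sub Aa(1)]
  have "bounded (range A)"
    by (rule bounded_subset[OF bounded_orthogonal_matrices]) (auto simp: o)
  then obtain l r where r: "strict_mono r" "(A \<circ> r) \<longlonglongrightarrow> l"
    using bounded_imp_convergent_subsequence by blast
  define K where "K = (real CARD('n))\<^sup>2"
  have K: "K > 0" by (simp add: K_def)
  have "Cauchy (A \<circ> r)" using r(2) by (rule LIMSEQ_imp_Cauchy)
  then obtain N where N: "\<And>k. k \<ge> N \<Longrightarrow> dist (A (r k)) (A (r N)) < \<epsilon> / K"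
    unfolding Cauchy_def using \<epsilon> K by (metis comp_apply divide_pos_pos le_refl)
  define i where "i = r N"
  \<comment> \<open>The total error of the quotient depends on the fixed index \<open>i\<close> and
    not on \<open>j\<close>, so a large \<open>j\<close> makes it negligible relative to
    \<open>j - i\<close>.\<close>
  define D where "D = d + norm (a i) + real i"
  obtain k0 :: nat where k0: "D / \<delta> + real i + 1 < real k0" using reals_Archimedean2 by blast
  define k where "k = max N k0"
  define j where "j = r k"
  have "real k0 \<le> real j"
    using seq_suble[OF r(1), of k] by (simp add: j_def k_def)
  moreover have "0 \<le> D / \<delta>"
    using order_trans[OF norm_ge_zero Aa(2)] \<delta> by (simp add: D_def)
  ultimately have j: "D / \<delta> < real j - real i" "real j - real i > 0"
    using k0 \<open>0 \<le> D / \<delta>\<close> by linarith+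
  have dist_ji: "norm (A j - A i) \<le> \<epsilon> / K"
    using N[of k] by (simp add: j_def i_def k_def dist_norm)
  let ?B = "A j ** transpose (A i)"
  let ?b = "A j *v (- (transpose (A i) *v a i)) + a j"
  have "affine_in \<Gamma> ?B ?b"
    by (intro affine_in_mult[OF sub] affine_in_inverse[OF sub] Aa)
  moreover have "opnorm (?B - mat 1) \<le> \<epsilon>"
  proof -
    have "?B - mat 1 = (A j - A i) ** transpose (A i)"
      by (simp add: matrix_diff_rdistrib orthogonal_matrix_transpose_mult o)
    then have "opnorm (?B - mat 1) \<le> opnorm (A j - A i)"
      using opnorm_mult_orthogonal(2)[of "transpose (A i)" "A j - A i"] o by simp
    also have "\<dots> \<le> K * norm (A j - A i)" unfolding K_def by (rule opnorm_le_norm)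
    also have "\<dots> \<le> K * (\<epsilon> / K)" using dist_ji K by (intro mult_left_mono) auto
    finally show ?thesis using K by simp
  qed
  moreover have "norm (?b - (real j - real i) *\<^sub>R u) \<le> \<delta> * (real j - real i)"
  proof -
    have "?b - (real j - real i) *\<^sub>R u = (a j - real j *\<^sub>R u) + (A j *v (- (transpose (A i) *v a i)) + real i *\<^sub>R u)"
      by (simp add: algebra_simps)
    also have "norm \<dots> \<le> norm (a j - real j *\<^sub>R u) + (norm (A j *v (- (transpose (A i) *v a i))) + norm (real i *\<^sub>R u))"
      by (intro norm_triangle_le add_left_mono norm_triangle_ineq)
    also have "\<dots> \<le> D"
      using Aa(2)[of j] u by (simp add: D_def norm_orthogonal_mult o)
    also have "D < \<delta> * (real j - real i)" using j \<delta> by (simp add: field_simps)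
    finally show ?thesis by simp
  qed
  ultimately show ?thesis using that j(2) by blast
qed

section \<open>Small rotational parts are trivial\<close>

lemma norm_transpose_minus_id:
  fixes A :: "real ^ 'n ^ 'n"
  assumes A: "orthogonal_matrix A"
  shows "norm ((transpose A - mat 1) *v y) = norm ((A - mat 1) *v y)"
proof -
  have "norm ((transpose A - mat 1) *v y) = norm (A *v ((transpose A - mat 1) *v y))"
    by (rule norm_orthogonal_mult[OF A, symmetric])
  also have "A *v ((transpose A - mat 1) *v y) = - ((A - mat 1) *v y)"
    by (simp add: matrix_vector_mult_diff_rdistrib matrix_vector_mult_diff_distrib orthogonal_transpose_vector[OF A])
  finally show ?thesis by simp
qed

text \<open>\<open>A - 1\<close> is normal, so the stretching factor does not decrease when it is iterated.\<close>

lemma norm_square_minus_id_le: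
  fixes A :: "real ^ 'n ^ 'n"
  assumes A: "orthogonal_matrix A"
  shows "(norm ((A - mat 1) *v x))\<^sup>2 \<le> norm ((A - mat 1) *v ((A - mat 1) *v x)) * norm x"
proof -
  let ?N = "A - mat 1"
  have t: "transpose ?N = transpose A - mat 1" by (simp add: transpose_def mat_def vec_eq_iff)
  have "(norm (?N *v x))\<^sup>2 = (?N *v x) \<bullet> (?N *v x)" by (simp add: power2_norm_eq_inner)
  also have "\<dots> = (transpose ?N *v (?N *v x)) \<bullet> x"
    by (metis dot_lmul_matrix inner_commute transpose_matrix_vector)
  also have "\<dots> \<le> norm (transpose ?N *v (?N *v x)) * norm x"
    by (rule norm_cauchy_schwarz)
  also have "norm (transpose ?N *v (?N *v x)) = norm (?N *v (?N *v x))"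
    unfolding t by (rule norm_transpose_minus_id[OF A])
  finally show ?thesis .
qed

lemma exists_large_stretch:
  assumes "opnorm A > 0" "c < 1"
  obtains u :: "real ^ 'n" where "norm u = 1" "norm (A *v u) \<ge> c * opnorm A"
proof -
  have "\<exists>x. norm (A *v x) > c * opnorm A * norm x"
  proof (rule ccontr)
    assume "\<not> ?thesis"
    then have "opnorm A \<le> c * opnorm A" by (intro onorm_le) (auto simp: not_less)
    then show False using assms by (simp add: mult_le_cancel_right1)
  qed
  then obtain x where x: "norm (A *v x) > c * opnorm A * norm x" by blast
  then have "x \<noteq> 0" by auto
  then have "norm ((1 / norm x) *\<^sub>R x) = 1" by simp
  moreover have "norm (A *v ((1 / norm x) *\<^sub>R x)) \<ge> c * opnorm A"
    using x \<open>x \<noteq> 0\<close> by (simp add: matrix_vector_mult_scaleR field_simps)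
  ultimately show ?thesis using that by blast
qed

text \<open>Let \<open>A x + a\<close> be a non-translation with small rotational part and \<open>|a|\<close> minimal.  Among the
  elements whose translational part is stretched well by \<open>N = A - 1\<close>, with a margin controlled by
  their rotational part, commutation with \<open>A x + a\<close> produces one with a shorter translational part.\<close>

lemma small_rotation_trivial:
  fixes \<Gamma> :: "'n::finite isom set"
  assumes sub: "subgroup \<Gamma> Isom" and d: "discrete \<Gamma>" and comp: "compact_space (orbit_space \<Gamma>)"
    and \<alpha>: "affine_in \<Gamma> A0 a0" "opnorm (A0 - mat 1) \<le> 1/4"
  shows "A0 = mat 1"
proof (rule ccontr)
  assume nz: "A0 \<noteq> mat 1"
  define P where "P = (\<lambda>(A, a). affine_in \<Gamma> A a \<and> opnorm (A - mat 1) \<le> 1/4 \<and> A \<noteq> mat 1)"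
  have P0: "P (A0, a0)" using \<alpha> nz by (simp add: P_def)
  have fin: "finite {q. P q \<and> norm (snd q) \<le> C}" for C
    by (rule finite_subset[OF _ affine_in_finite[OF sub d, of C]]) (auto simp: P_def)
  obtain q where q: "P q" "\<And>r. P r \<Longrightarrow> norm (snd q) \<le> norm (snd r)"
    using finite_minimizer[where f = "\<lambda>q. norm (snd q)" and P = P, OF P0 fin] by metis
  obtain A a where qA: "q = (A, a)" by (cases q)
  have Aa: "affine_in \<Gamma> A a" "opnorm (A - mat 1) \<le> 1/4" "A \<noteq> mat 1"
    and amin: "\<And>B b. affine_in \<Gamma> B b \<Longrightarrow> opnorm (B - mat 1) \<le> 1/4 \<Longrightarrow> B \<noteq> mat 1 \<Longrightarrow> norm a \<le> norm b"
    using q by (auto simp: P_def qA)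
  have oA: "orthogonal_matrix A" using affine_in_orthogonal[OF sub Aa(1)] .
  define N where "N = A - mat 1"
  define m where "m = opnorm N"
  define \<mu> where "\<mu> B = opnorm (B - mat 1)" for B :: "real ^ 'n ^ 'n"
  have m: "m > 0" "m \<le> 1/4"
    using Aa(2,3) opnorm_nonneg[of N] opnorm_eq_0[of N] by (auto simp: m_def N_def less_le)
  have Nle: "norm (N *v x) \<le> m * norm x" for x unfolding m_def by (rule norm_matrix_vector_le)
  \<comment> \<open>The margin 16 leaves ample room: commutation at least halves the rotational part
    \<open>k\<close>, so the demand drops to \<open>8 k\<close>, and it disturbs \<open>N b\<close>
    by at most \<open>2 k |b|\<close>. As no stretch exceeds \<open>m\<close>, membership forces
    \<open>k \<le> m / 32\<close>.\<close>
  define S where "S = (\<lambda>(B, b). affine_in \<Gamma> B b \<and> b \<noteq> 0 \<and> norm (N *v b) \<ge> (m / 2 + 16 * \<mu> B) * norm b)"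
  obtain u where u: "norm u = 1" "norm (N *v u) \<ge> 9/10 * m"
    using exists_large_stretch[of N "9/10"] m unfolding m_def by auto
  \<comment> \<open>With these constants \<open>|N b0|\<close> is at least
    \<open>(9/10 - 1/10) m t\<close>, whereas \<open>S\<close> asks for at most
    \<open>(1/2 + 1/10) m * (11/10) t\<close>, that is \<open>0.66 m t\<close>.\<close>
  obtain B0 b0 t where B0: "affine_in \<Gamma> B0 b0" "\<mu> B0 \<le> m / 160" "t > 0" "norm (b0 - t *\<^sub>R u) \<le> 1/10 * t"
    using almost_translation_in_direction[OF sub comp u(1), of "m / 160" "1/10"] m(1) unfolding \<mu>_def by auto
  have "S (B0, b0)"
  proof -
    have e: "b0 = t *\<^sub>R u + (b0 - t *\<^sub>R u)" by simp
    have n1: "norm (t *\<^sub>R u) = t" using u B0(3) by simp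
    have b1: "norm b0 \<le> 11/10 * t"
      using norm_triangle_ineq[of "t *\<^sub>R u" "b0 - t *\<^sub>R u"] n1 B0(4) by simp
    have b2: "norm b0 \<ge> 9/10 * t"
      using norm_triangle_ineq2[of "t *\<^sub>R u" "t *\<^sub>R u - b0"] n1 B0(4) by (simp add: norm_minus_commute)
    have "N *v b0 = t *\<^sub>R (N *v u) + N *v (b0 - t *\<^sub>R u)"
      by (simp add: matrix_vector_mult_diff_distrib matrix_vector_mult_scaleR)
    then have "norm (N *v b0) \<ge> norm (t *\<^sub>R (N *v u)) - norm (N *v (b0 - t *\<^sub>R u))"
      by (metis norm_diff_ineq)
    moreover have "norm (N *v (b0 - t *\<^sub>R u)) \<le> m * (1/10 * t)"
      using Nle[of "b0 - t *\<^sub>R u"] B0(4) m(1) by (meson less_imp_le mult_left_mono order_trans)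
    moreover have "norm (t *\<^sub>R (N *v u)) \<ge> t * (9/10 * m)" using u(2) B0(3) by simp
    ultimately have "norm (N *v b0) \<ge> 8/10 * (m * t)" by (simp add: algebra_simps)
    moreover have "(m / 2 + 16 * \<mu> B0) * norm b0 \<le> (m / 2 + 16 * (m / 160)) * (11/10 * t)"
      using B0(2) b1 m(1) opnorm_nonneg by (intro mult_mono) (auto simp: \<mu>_def)
    moreover have "(m / 2 + 16 * (m / 160)) * (11/10 * t) \<le> 8/10 * (m * t)"
      using m(1) B0(3) by (simp add: field_simps)
    ultimately show ?thesis using b2 B0 by (auto simp: S_def)
  qed
  have finS: "finite {q. S q \<and> norm (snd q) \<le> C}" for C
    by (rule finite_subset[OF _ affine_in_finite[OF sub d, of C]]) (auto simp: S_def)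
  obtain p where p: "S p" "\<And>r. S r \<Longrightarrow> norm (snd p) \<le> norm (snd r)"
    using finite_minimizer[where f = "\<lambda>q. norm (snd q)" and P = S, OF \<open>S (B0, b0)\<close> finS] by metis
  obtain B b where pB: "p = (B, b)" by (cases p)
  have Bb: "affine_in \<Gamma> B b" "b \<noteq> 0" "norm (N *v b) \<ge> (m / 2 + 16 * \<mu> B) * norm b"
    and bmin: "\<And>C c. S (C, c) \<Longrightarrow> norm b \<le> norm c"
    using p by (auto simp: S_def pB)
  have oB: "orthogonal_matrix B" using affine_in_orthogonal[OF sub Bb(1)] .
  define C where "C = A ** B ** transpose A ** transpose B"
  define r where "r = (mat 1 - C) *v b + (A ** (mat 1 - B) ** transpose A) *v a"
  define c where "c = N *v b + r"
  have Cc: "affine_in \<Gamma> C c"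
    using affine_in_commutator[OF sub Aa(1) Bb(1)] by (simp add: C_def c_def r_def N_def)
  define k x y z where "k = \<mu> B" and "x = norm b" and "y = norm (N *v b)" and "z = norm (N *v (N *v b))"
  have k0: "k \<ge> 0" by (simp add: k_def \<mu>_def opnorm_nonneg)
  have x0: "x > 0" using Bb(2) by (simp add: x_def)
  have yx: "y \<ge> (m / 2 + 16 * k) * x" "y \<le> m * x"
    using Bb(3) Nle[of b] by (auto simp: y_def x_def k_def)
  then have "(m / 2 + 16 * k) * x \<le> m * x" by linarith
  then have km: "16 * k \<le> m / 2" using x0 by (simp add: mult_le_cancel_right)
  have \<mu>C: "\<mu> C \<le> 2 * m * k"
    using opnorm_commutator[OF oA oB] by (simp add: \<mu>_def C_def m_def N_def k_def)
  have \<mu>C2: "\<mu> C \<le> k / 2"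
    using \<mu>C mult_right_mono[OF m(2) k0] by simp
  \<comment> \<open>Either \<open>B\<close> is the identity and \<open>k = 0\<close>, or minimality
    of \<open>a\<close> applies to \<open>(B, b)\<close>.\<close>
  have ka: "k * norm a \<le> k * x"
  proof (cases "B = mat 1")
    case True
    then have "k = 0" using opnorm_eq_0[of "0 :: real ^ 'n ^ 'n"] by (simp add: k_def \<mu>_def)
    then show ?thesis by simp
  next
    case False
    then have "norm a \<le> x" unfolding x_def using amin[OF Bb(1)] km m by (simp add: k_def \<mu>_def)
    then show ?thesis using k0 by (rule mult_left_mono)
  qed
  have opn_minus: "opnorm (mat 1 - D) = \<mu> D" for D :: "real ^ 'n ^ 'n"
  proof -
    have "(*v) (mat 1 - D) = (\<lambda>v. - ((D - mat 1) *v v))"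
      by (simp add: fun_eq_iff matrix_vector_mult_diff_rdistrib)
    then show ?thesis by (simp add: \<mu>_def onorm_neg)
  qed
  have "norm r \<le> norm ((mat 1 - C) *v b) + norm ((A ** (mat 1 - B) ** transpose A) *v a)"
    unfolding r_def by (rule norm_triangle_ineq)
  also have "\<dots> \<le> \<mu> C * x + k * norm a"
  proof (rule add_mono)
    show "norm ((mat 1 - C) *v b) \<le> \<mu> C * x"
      unfolding x_def opn_minus[symmetric] by (rule norm_matrix_vector_le)
    have "norm ((A ** (mat 1 - B) ** transpose A) *v a) = norm ((mat 1 - B) *v (transpose A *v a))"
      by (simp add: norm_orthogonal_mult[OF oA] flip: matrix_vector_mul_assoc)
    also have "\<dots> \<le> k * norm (transpose A *v a)"
      unfolding k_def opn_minus[symmetric] by (rule norm_matrix_vector_le)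
    also have "norm (transpose A *v a) = norm a"
      using oA by (intro norm_orthogonal_mult) simp
    finally show "norm ((A ** (mat 1 - B) ** transpose A) *v a) \<le> k * norm a" .
  qed
  also have "\<dots> \<le> k / 2 * x + k * x"
    using \<mu>C2 x0 ka by (intro add_mono mult_right_mono) auto
  also have "\<dots> \<le> 2 * k * x" using k0 x0 by simp
  finally have r: "norm r \<le> 2 * k * x" .
  have y2: "y\<^sup>2 \<le> z * x"
    unfolding x_def y_def z_def N_def by (rule norm_square_minus_id_le[OF oA])
  have c1: "norm c \<le> y + 2 * k * x"
    using norm_triangle_ineq[of "N *v b" r] r by (simp add: c_def y_def)
  have c2: "norm c \<ge> y - 2 * k * x"
    using norm_diff_ineq[of "N *v b" r] r by (simp add: c_def y_def)
  have "N *v c = N *v (N *v b) + N *v r" by (simp add: c_def matrix_vector_right_distrib)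
  then have "norm (N *v c) \<ge> z - norm (N *v r)"
    using norm_diff_ineq[of "N *v (N *v b)" "N *v r"] by (simp add: z_def)
  moreover have "norm (N *v r) \<le> m * (2 * k * x)"
    using Nle[of r] r m(1) by (meson less_imp_le mult_left_mono order_trans)
  ultimately have Nc: "norm (N *v c) \<ge> z - m * (2 * k * x)" by linarith
  have key: "(m / 2 + 16 * \<mu> C) * norm c \<le> norm (N *v c)"
  proof -
    \<comment> \<open>The stretching factor of \<open>b\<close>. Normality gives
      \<open>z \<ge> \<rho>\<^sup>2 x\<close>, so everything reduces to a quadratic inequality in
      \<open>\<rho>\<close> and \<open>k\<close>, where \<open>\<rho> \<ge> m / 2\<close> pays for
      the error \<open>2 m k\<close>.\<close>
    define \<rho> where "\<rho> = y / x"
    have y\<rho>: "y = \<rho> * x" using x0 by (simp add: \<rho>_def)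
    have \<rho>: "m / 2 + 16 * k \<le> \<rho>" using yx(1) x0 by (simp add: \<rho>_def pos_le_divide_eq)
    have "\<rho>\<^sup>2 * x * x \<le> z * x" using y2 by (simp add: y\<rho> power2_eq_square mult_ac)
    then have z: "\<rho>\<^sup>2 * x \<le> z" using x0 by simp
    have "(m / 2 + 16 * \<mu> C) * norm c \<le> (m / 2 + 8 * k) * (y + 2 * k * x)"
      using \<mu>C2 c1 m(1) k0 by (intro mult_mono) auto
    also have "\<dots> \<le> (\<rho> - 8 * k) * ((\<rho> + 2 * k) * x)"
      using \<rho> x0 k0 m(1) unfolding y\<rho> distrib_right[symmetric] by (intro mult_right_mono) auto
    also have "\<dots> = (\<rho>\<^sup>2 - 6 * k * \<rho> - 16 * k * k) * x"
      by (simp add: power2_eq_square algebra_simps)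
    also have "\<dots> \<le> (\<rho>\<^sup>2 - 2 * m * k) * x"
    proof (rule mult_right_mono)
      have "k * (m / 2) \<le> k * \<rho>" using \<rho> k0 by (intro mult_left_mono) auto
      then have "0 \<le> 6 * (k * \<rho> - k * (m / 2)) + k * m + 16 * (k * k)"
        using k0 m(1) by (intro add_nonneg_nonneg) (auto simp: mult_ac)
      also have "\<dots> = 6 * k * \<rho> + 16 * k * k - 2 * m * k" by (simp add: algebra_simps)
      finally have "0 \<le> 6 * k * \<rho> + 16 * k * k - 2 * m * k" .
      moreover have "X - Y - Z \<le> X - W" if "0 \<le> Y + Z - W" for X Y Z W :: real using that by linarith
      ultimately show "\<rho>\<^sup>2 - 6 * k * \<rho> - 16 * k * k \<le> \<rho>\<^sup>2 - 2 * m * k" by blast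
    qed (use x0 in simp)
    also have "\<dots> \<le> z - m * (2 * k * x)" using z by (simp add: algebra_simps)
    finally show ?thesis using Nc by linarith
  qed
  have kx: "k * x \<le> m / 32 * x" using km x0 by (intro mult_right_mono) auto
  have mx: "m * x > 0" using m(1) x0 by simp
  have mx4: "m * x \<le> 1/4 * x" using m(2) x0 by (intro mult_right_mono) auto
  have y3: "y \<ge> m * x / 2 + 16 * (k * x)" using yx(1) by (simp add: algebra_simps)
  have kx0: "0 \<le> k * x" using k0 x0 by simp
  have "norm c > 0" using c2 y3 kx0 mx unfolding mult.assoc[of 2] by linarith
  then have "S (C, c)" using Cc key by (auto simp: S_def)
  then have "x \<le> norm c" using bmin by (simp add: x_def)
  \<comment> \<open>\<open>|c| \<le> (m + m / 16) |b|\<close>, which is less than \<open>|b|\<close>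
    because \<open>m \<le> 1/4\<close>.\<close>
  then show False using c1 yx(2) kx mx4 x0 unfolding mult.assoc[of 2] by simp
qed

section \<open>Finite holonomy and full rank\<close>

text \<open>Two holonomy matrices closer than the stated threshold have a quotient within 1/4 of the
  identity and therefore coincide; a separated subset of the orthogonal group is finite.\<close>

lemma bieberbach_holonomy_finite:
  assumes "bieberbach_group \<Gamma>"
  shows "finite (holonomy \<Gamma>)"
proof -
  have sub: "subgroup \<Gamma> Isom" and d: "discrete \<Gamma>" and comp: "compact_space (orbit_space \<Gamma>)"
    using assms by (auto simp: bieberbach_group_def)
  have H: "\<exists>a. affine_in \<Gamma> A a" if "A \<in> holonomy \<Gamma>" for A
  proof -
    from that obtain a where a: "(A, a) \<in> \<Gamma>" by (auto simp: holonomy_def)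
    then have "orthogonal_matrix A" using subgroup.mem_carrier[OF sub a] by (simp add: Isom_def)
    then have "affine_in \<Gamma> A (A *v a)"
      using a by (simp add: affine_in_def orthogonal_transpose_vector)
    then show ?thesis by blast
  qed
  show ?thesis
  proof (rule finite_bounded_separated)
    show "bounded (holonomy \<Gamma>)"
      by (rule bounded_subset[OF bounded_orthogonal_matrices]) (use H affine_in_orthogonal[OF sub] in blast)
    show "1 / (4 * (real CARD('a))\<^sup>2) > 0" by simp
    fix A B assume AB: "A \<in> holonomy \<Gamma>" "B \<in> holonomy \<Gamma>" "dist A B < 1 / (4 * (real CARD('a))\<^sup>2)"
    obtain a b where ab: "affine_in \<Gamma> A a" "affine_in \<Gamma> B b" using H AB by blast
    note o = affine_in_orthogonal[OF sub ab(1)] affine_in_orthogonal[OF sub ab(2)]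
    have "A ** transpose B = mat 1"
    proof (rule small_rotation_trivial[OF sub d comp])
      show "affine_in \<Gamma> (A ** transpose B) (A *v (- (transpose B *v b)) + a)"
        by (intro affine_in_mult[OF sub] affine_in_inverse[OF sub] ab)
      have "A ** transpose B - mat 1 = (A - B) ** transpose B"
        using o by (simp add: matrix_diff_rdistrib orthogonal_matrix_transpose_mult)
      then have "opnorm (A ** transpose B - mat 1) \<le> opnorm (A - B)"
        using opnorm_mult_orthogonal(2)[of "transpose B" "A - B"] o by simp
      also have "\<dots> \<le> (real CARD('a))\<^sup>2 * norm (A - B)" by (rule opnorm_le_norm)
      also have "\<dots> \<le> 1/4" using AB(3) by (simp add: dist_norm field_simps)
      finally show "opnorm (A ** transpose B - mat 1) \<le> 1/4" .
    qed
    then have "(A ** transpose B) ** B = B" by simp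
    then show "A = B" using o by (simp add: orthogonal_matrix_transpose_mult flip: matrix_mul_assoc)
  qed
qed

text \<open>If the translations missed a direction \<open>u\<close>, an almost translation along
  \<open>u\<close> would have trivial rotational part, hence be a translation after all. The columns
  are a basis of the space and need not generate the whole lattice.\<close>

lemma bieberbach_lattice_basis:
  fixes \<Gamma> :: "'n::finite isom set"
  assumes "bieberbach_group \<Gamma>"
  obtains A :: "real ^ 'n ^ 'n" where "invertible A" "\<And>i. column i A \<in> trans_lattice \<Gamma>"
proof -
  have sub: "subgroup \<Gamma> Isom" and d: "discrete \<Gamma>" and comp: "compact_space (orbit_space \<Gamma>)"
    using assms by (auto simp: bieberbach_group_def)
  let ?T = "trans_lattice \<Gamma>"
  have span: "span ?T = UNIV"
  proof (rule ccontr)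
    assume "span ?T \<noteq> UNIV"
    then obtain v where v: "v \<noteq> 0" "\<And>x. x \<in> span ?T \<Longrightarrow> orthogonal v x"
      using orthogonal_to_subspace_exists_gen[of ?T UNIV] by (metis psubsetI span_UNIV subset_UNIV)
    define u where "u = (1 / norm v) *\<^sub>R v"
    have u: "norm u = 1" "\<And>x. x \<in> ?T \<Longrightarrow> x \<bullet> u = 0"
      using v by (auto simp: u_def orthogonal_def span_base inner_commute)
    obtain B b t where B: "affine_in \<Gamma> B b" "opnorm (B - mat 1) \<le> 1/4" "t > 0" "norm (b - t *\<^sub>R u) \<le> 1/2 * t"
      using almost_translation_in_direction[OF sub comp u(1), of "1/4" "1/2"] by auto
    have "B = mat 1" using small_rotation_trivial[OF sub d comp B(1,2)] .
    then have "b \<in> ?T" using B(1) by (simp add: affine_in_def trans_lattice_def translation_def)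
    \<comment> \<open>\<open>b\<close> is orthogonal to \<open>u\<close>, so the error has component
      \<open>- t\<close> along \<open>u\<close>, too large for the bound
      \<open>t / 2\<close>.\<close>
    then have "(b - t *\<^sub>R u) \<bullet> u = - t" using u by (simp add: inner_diff_left dot_square_norm)
    then have "t \<le> norm (b - t *\<^sub>R u) * norm u" using Cauchy_Schwarz_ineq2[of "b - t *\<^sub>R u" u] B(3) by simp
    then show False using B(3,4) u(1) by simp
  qed
  obtain S where S: "S \<subseteq> ?T" "independent S" "?T \<subseteq> span S" "card S = dim ?T"
    using basis_exists[of ?T] by metis
  have "span S = UNIV" using S(1,3) span by (metis span_mono span_span top.extremum_unique)
  then have cS: "card S = CARD('n)" using S(4) span by (metis dim_span dim_UNIV DIM_cart DIM_real mult.right_neutral)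
  have "finite S" using S(2) by (rule independent_imp_finite)
  then obtain f where f: "bij_betw f (UNIV :: 'n set) S"
    using cS by (metis finite finite_same_card_bij)
  define A where "A = (\<chi> i j. f j $ i)"
  have col: "column j A = f j" for j by (simp add: A_def column_def vec_eq_iff)
  have "columns A = S" using f by (auto simp: columns_def col bij_betw_def)
  then have "\<exists>B. A ** B = mat 1"
    unfolding matrix_right_invertible_span_columns span_vec_eq using \<open>span S = UNIV\<close> by simp
  then have "invertible A" by (simp add: invertible_right_inverse)
  moreover have "column i A \<in> ?T" for i using f S(1) by (auto simp: col bij_betw_def)
  ultimately show ?thesis using that by blast
qed

section \<open>Traces in the spin module\<close>

lemma commute_mult:
  fixes x :: "'a::semigroup_mult"
  assumes "x * a = a * x" "x * b = b * x"
  shows "x * (a * b) = a * b * x"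
proof -
  have "x * (a * b) = a * (x * b)" by (simp add: assms(1) flip: mult.assoc)
  then show ?thesis by (simp add: assms(2) mult.assoc)
qed

context
  fixes L :: "'n::{finite,linorder} clifford \<Rightarrow> complex ^ 's ^ 's"
  assumes rep: "clifford_rep L"
begin

lemma clifford_rep_simps:
  "L 1 = mat 1" "L (x * y) = L x ** L y" "L (x + y) = L x + L y" "L (- x) = - L x"
  "L (c *\<^sub>R x) = c *\<^sub>R L x"
proof -
  have lin: "linear L" using rep by (simp add: clifford_rep_def)
  show "L 1 = mat 1" "L (x * y) = L x ** L y" using rep by (auto simp: clifford_rep_def)
  show "L (x + y) = L x + L y" "L (- x) = - L x" "L (c *\<^sub>R x) = c *\<^sub>R L x"
    using lin by (simp_all add: linear_add linear_neg linear_scale)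
qed

lemma rep_of_real: "L (of_real c) = mat (of_real c)"
  by (simp add: of_real_def clifford_rep_simps) (simp add: vec_eq_iff mat_def of_real_def)

lemma trace_rep_commute: "trace (L (x * y)) = trace (L (y * x))"
  unfolding clifford_rep_simps(2) by (rule trace_mul_sym)

lemma trace_rep_conjugate: "y * x = 1 \<Longrightarrow> trace (L (x * z * y)) = trace (L z)"
  using trace_rep_commute[of "x * z" y] by (simp flip: mult.assoc)

lemma trace_rep_simps:
  "trace (L (x + y)) = trace (L x) + trace (L y)" "trace (L (- x)) = - trace (L x)"
  "trace (L (c *\<^sub>R x)) = of_real c * trace (L x)"
  by (simp_all add: clifford_rep_simps trace_add)
    (simp_all add: trace_def sum_negf sum_distrib_left scaleR_conv_of_real[where 'a = complex])

text \<open>Conjugation by \<open>cvec v\<close> preserves the trace and turns \<open>x\<close> into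
  \<open>- x\<close>.\<close>

lemma trace_rep_anticommute:
  assumes v: "norm v = 1" and anti: "cvec v * x = - (x * cvec v)"
  shows "trace (L x) = 0"
proof -
  have vv: "cvec v * cvec v = - 1" using cvec_square[of v] v by simp
  have "cvec v * x * (- cvec v) = x * (cvec v * cvec v)"
    using anti by (simp add: mult.assoc)
  then have "cvec v * x * (- cvec v) = - x" by (simp add: vv)
  moreover have "trace (L (cvec v * x * (- cvec v))) = trace (L x)"
    by (rule trace_rep_conjugate) (simp add: vv)
  ultimately have "trace (L x) = - trace (L x)" by (simp add: trace_rep_simps)
  then show ?thesis by simp
qed

text \<open>A multiplicative measure of size on the spin group; it later shows that a scalar in this
  group is a sign. For a unit vector it follows from \<open>v\<^sup>2 = -1\<close>.\<close>

lemma norm_det_rep_Spin: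
  assumes "g \<in> carrier Spin"
  shows "norm (det (L g)) = 1"
proof -
  have neg: "norm (det (- mat 1 :: complex ^ 's ^ 's)) = 1"
  proof -
    have "det (- mat 1 :: complex ^ 's ^ 's) = (\<Prod>i\<in>(UNIV::'s set). - 1)"
      by (subst det_diagonal) (auto simp: mat_def)
    then show ?thesis by (simp add: norm_power)
  qed
  have v: "norm (det (L (cvec v))) = 1" if "norm v = 1" for v
  proof -
    have "det (L (cvec v)) * det (L (cvec v)) = det (L (cvec v * cvec v))"
      by (simp add: clifford_rep_simps det_mul)
    also have "cvec v * cvec v = - 1" using cvec_square[of v] that by simp
    finally have "norm (det (L (cvec v))) * norm (det (L (cvec v))) = 1"
      using neg by (simp add: clifford_rep_simps flip: norm_mult)
    then have "(norm (det (L (cvec v))))\<^sup>2 = 1" by (simp add: power2_eq_square)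
    then show ?thesis using power2_eq_1_iff norm_ge_zero by (metis neg_0_le_iff_le not_one_le_zero)
  qed
  have "norm (det (L (prod_list (map cvec vs)))) = 1" if "\<forall>v\<in>set vs. norm v = 1" for vs
    using that by (induction vs) (auto simp: clifford_rep_simps det_mul norm_mult v)
  then show ?thesis using assms by (auto simp: Spin_def)
qed

end

section \<open>The spin group acting on vectors\<close>

lemma Spin_simps: "mult Spin = (*)" "one Spin = 1"
  by (simp_all add: Spin_def)

lemma Spin_inverse:
  assumes "g \<in> carrier Spin"
  shows "inv\<^bsub>Spin\<^esub> g \<in> carrier Spin" "g * inv\<^bsub>Spin\<^esub> g = 1" "inv\<^bsub>Spin\<^esub> g * g = 1"
  using group.inv_closed[OF group_Spin assms] group.r_inv[OF group_Spin assms]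
    group.l_inv[OF group_Spin assms] by (simp_all add: Spin_simps)

lemma Spin_mult: "g \<in> carrier Spin \<Longrightarrow> h \<in> carrier Spin \<Longrightarrow> g * h \<in> carrier Spin"
  using monoid.m_closed[OF group.is_monoid[OF group_Spin], of g h] by (simp add: Spin_simps)

lemma spin_mu_compose:
  "g \<in> carrier Spin \<Longrightarrow> h \<in> carrier Spin \<Longrightarrow> spin_mu (g * h) x = spin_mu g (spin_mu h x)"
  using group.inv_mult_group[OF group_Spin, of g h] by (simp add: spin_mu_def Spin_simps mult.assoc)

lemma spin_mu_mult: "g \<in> carrier Spin \<Longrightarrow> spin_mu g (x * y) = spin_mu g x * spin_mu g y"
proof -
  assume g: "g \<in> carrier Spin"
  have "inv\<^bsub>Spin\<^esub> g * (g * z) = z" for z by (simp add: Spin_inverse[OF g] flip: mult.assoc)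
  then show ?thesis by (simp add: spin_mu_def mult.assoc)
qed

lemma spin_mu_iff: "g \<in> carrier Spin \<Longrightarrow> spin_mu g x = y \<longleftrightarrow> g * x = y * g"
proof -
  assume g: "g \<in> carrier Spin"
  have "z * inv\<^bsub>Spin\<^esub> g * g = z" "z * g * inv\<^bsub>Spin\<^esub> g = z" for z
    by (simp_all add: Spin_inverse[OF g] mult.assoc)
  then show ?thesis unfolding spin_mu_def by metis
qed

lemma cvec_simps: "cvec (v + w) = cvec v + cvec w" "cvec (v - w) = cvec v - cvec w" "cvec (- v) = - cvec v" "cvec (c *\<^sub>R v) = c *\<^sub>R cvec v"
  by (simp_all add: linear_add linear_diff linear_neg linear_scale linear_cvec)

text \<open>Conjugation by a unit vector \<open>v\<close> is minus the reflection in the hyperplane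
  orthogonal to \<open>v\<close>.\<close>

lemma cvec_conjugate:
  assumes "norm v = 1"
  shows "cvec v * cvec y = cvec ((2 * (v \<bullet> y)) *\<^sub>R v - y) * cvec v"
proof -
  have "cvec ((2 * (v \<bullet> y)) *\<^sub>R v - y) * cvec v = (2 * (v \<bullet> y)) *\<^sub>R (cvec v * cvec v) - cvec y * cvec v"
    by (simp add: cvec_simps left_diff_distrib)
  also have "\<dots> = of_real (- 2 * (v \<bullet> y)) - cvec y * cvec v"
    using cvec_square[of v] assms by (simp add: of_real_def)
  also have "\<dots> = cvec v * cvec y"
    using cvec_anticommute[of v y] by (simp add: algebra_simps)
  finally show ?thesis ..
qed

lemma cvec_pair_Spin: "norm v = 1 \<Longrightarrow> norm w = 1 \<Longrightarrow> cvec v * cvec w \<in> carrier Spin"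
  unfolding Spin_def by (auto intro!: exI[of _ "[v, w]"])

lemma spin_mu_vector:
  assumes "g \<in> carrier Spin"
  obtains w where "spin_mu g (cvec y) = cvec w" "norm w = norm y"
proof -
  have "\<exists>w. prod_list (map cvec vs) * cvec y = cvec w * prod_list (map cvec vs) \<and> norm w = norm y"
    if "\<forall>v\<in>set vs. norm v = 1" for vs
    using that
  proof (induction vs)
    case (Cons v vs)
    then obtain w where w: "prod_list (map cvec vs) * cvec y = cvec w * prod_list (map cvec vs)" "norm w = norm y"
      by auto
    let ?w = "(2 * (v \<bullet> w)) *\<^sub>R v - w"
    have v: "norm v = 1" using Cons.prems by simp
    have "prod_list (map cvec (v # vs)) * cvec y = cvec v * cvec w * prod_list (map cvec vs)"
      using w(1) by (simp add: mult.assoc)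
    also have "\<dots> = cvec ?w * prod_list (map cvec (v # vs))"
      using cvec_conjugate[OF v, of w] by (simp add: mult.assoc)
    finally have "prod_list (map cvec (v # vs)) * cvec y = cvec ?w * prod_list (map cvec (v # vs))" .
    moreover have "(norm ?w)\<^sup>2 = (norm w)\<^sup>2"
      using v by (simp add: power2_norm_eq_inner inner_diff_left inner_diff_right inner_commute)
        (simp add: dot_square_norm power2_eq_square)
    then have "norm ?w = norm w" by (simp add: power2_eq_iff_nonneg)
    ultimately show ?case using w(2) by metis
  qed auto
  moreover obtain vs where "g = prod_list (map cvec vs)" "\<forall>v\<in>set vs. norm v = 1"
    using assms by (auto simp: Spin_def)
  ultimately show ?thesis using that spin_mu_iff[OF assms] by metis
qed

text \<open>If the vector \<open>w\<close> obtained from the unit vector \<open>e\<close> is not \<open>- e\<close>, then \<open>e (w + e)\<close> is, up to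
  scaling, an element of the spin group that commutes with \<open>x\<close> and moves \<open>w\<close> back to \<open>e\<close>.\<close>

lemma Spin_conjugate_fixing:
  assumes k: "k \<in> carrier Spin" "spin_mu k g = x" "spin_mu k (cvec e) = cvec w"
    and e: "norm e = 1" and w: "norm w = 1" "w \<noteq> - e"
    and comm: "x * cvec e = cvec e * x" "x * cvec w = cvec w * x"
  obtains k' where "k' \<in> carrier Spin" "spin_mu k' g = x" "spin_mu k' (cvec e) = cvec e"
proof -
  have nz: "w + e \<noteq> 0" using w(2) by (simp add: add_eq_0_iff2)
  define v where "v = (1 / norm (w + e)) *\<^sub>R (w + e)"
  have v: "norm v = 1" using nz by (simp add: v_def)
  have n2: "(norm (w + e))\<^sup>2 = 2 + 2 * (w \<bullet> e)"
    using e w(1) by (simp add: power2_norm_eq_inner inner_add_left inner_add_right inner_commute)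
      (simp add: dot_square_norm)
  have vw: "(w + e) \<bullet> w = 1 + w \<bullet> e" using w(1) by (simp add: inner_add_left dot_square_norm inner_commute[of e w])
  \<comment> \<open>As \<open>w\<close> and \<open>e\<close> have equal length, \<open>w + e\<close>
    bisects them, and minus the reflection along it interchanges the two.\<close>
  have "(2 * (v \<bullet> w)) *\<^sub>R v = (2 * (1 + w \<bullet> e) / (norm (w + e))\<^sup>2) *\<^sub>R (w + e)"
    using vw by (simp add: v_def power2_eq_square)
  also have "\<dots> = w + e"
  proof -
    have "2 + 2 * (w \<bullet> e) \<noteq> 0" using n2 nz by (metis norm_eq_zero power2_eq_iff_nonneg zero_eq_power2)
    then show ?thesis unfolding n2 by (simp add: distrib_left)
  qed
  finally have refl: "cvec v * cvec w = cvec e * cvec v"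
    using cvec_conjugate[OF v, of w] by simp
  \<comment> \<open>The factor \<open>e\<close> makes the product even; conjugation by it leaves
    \<open>e\<close> in place, so the effect on \<open>w\<close> is still
    \<open>w \<mapsto> e\<close>.\<close>
  define Z where "Z = cvec e * cvec v"
  have Z: "Z \<in> carrier Spin" unfolding Z_def by (rule cvec_pair_Spin[OF e v])
  have Zw: "spin_mu Z (cvec w) = cvec e"
    unfolding spin_mu_iff[OF Z] by (simp add: Z_def mult.assoc refl)
  have "x * cvec v = cvec v * x"
    using comm by (simp add: v_def cvec_simps algebra_simps)
  then have "Z * x = x * Z" unfolding Z_def using commute_mult[OF comm(1), of "cvec v"] by simp
  then have Zx: "spin_mu Z x = x" unfolding spin_mu_iff[OF Z] .
  show ?thesis
  proof (rule that)
    show "Z * k \<in> carrier Spin" by (rule Spin_mult[OF Z k(1)])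
    show "spin_mu (Z * k) g = x" "spin_mu (Z * k) (cvec e) = cvec e"
      using k by (simp_all add: spin_mu_compose[OF Z k(1)] Zx Zw)
  qed
qed

section \<open>The maximal torus and the volume element\<close>

lemma norm_ebasis: "norm (ebasis j :: real ^ 'n::{finite,linorder}) = 1"
  by (simp add: ebasis_def)

lemma inner_ebasis:
  assumes "i \<in> {1..CARD('n)}" "j \<in> {1..CARD('n)}" "i \<noteq> j"
  shows "(ebasis i :: real ^ 'n::{finite,linorder}) \<bullet> ebasis j = 0"
proof -
  let ?l = "sorted_list_of_set (UNIV :: 'n set)"
  have "distinct ?l" "length ?l = CARD('n)" by auto
  then have "?l ! (i - 1) \<noteq> ?l ! (j - 1)"
    using assms by (subst nth_eq_iff_index_eq) auto
  then show ?thesis by (simp add: ebasis_def inner_axis_axis)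
qed

lemma cvec_ebasis_anticommute:
  assumes "i \<in> {1..CARD('n)}" "j \<in> {1..CARD('n)}" "i \<noteq> j"
  shows "cvec (ebasis i :: real ^ 'n::{finite,linorder}) * cvec (ebasis j) = - (cvec (ebasis j) * cvec (ebasis i))"
  using cvec_anticommute[of "ebasis i :: (real, 'n) vec" "ebasis j"] inner_ebasis[OF assms]
  by (simp add: add_eq_0_iff2)

lemma cvec_ebasis_square: "cvec (ebasis j) * cvec (ebasis j) = - 1"
  using cvec_square[of "ebasis j"] by (simp add: norm_ebasis)

lemma commute_prod_list:
  fixes x :: "'a::monoid_mult"
  assumes "\<And>y. y \<in> set ys \<Longrightarrow> x * y = y * x"
  shows "x * prod_list ys = prod_list ys * x"
  using assms by (induction ys) (auto intro!: commute_mult)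

text \<open>The volume element of the subalgebra generated by the first \<open>2k\<close> basis
  vectors. Growing in pairs it stays even, so later basis vectors commute with it.\<close>

definition ebasis_prod :: "nat \<Rightarrow> 'n::{finite,linorder} clifford" where
  "ebasis_prod k = prod_list (map (\<lambda>j. cvec (ebasis j)) [1..<2*k+1])"

definition torus_factor :: "real \<Rightarrow> nat \<Rightarrow> 'n::{finite,linorder} clifford" where
  "torus_factor \<theta> j = of_real (cos \<theta>) + sin \<theta> *\<^sub>R (cvec (ebasis (2 * j - 1)) * cvec (ebasis (2 * j)))"

lemma torus_elem_eq: "torus_elem m t = prod_list (map (\<lambda>j. torus_factor (t j) j) [1..<m+1])"
  by (simp add: torus_elem_def torus_factor_def)

lemma ebasis_prod_0: "ebasis_prod 0 = 1"
  by (simp add: ebasis_prod_def)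

lemma ebasis_prod_Suc:
  "ebasis_prod (Suc k) = ebasis_prod k * (cvec (ebasis (2*k+1)) * cvec (ebasis (2*k+2)))"
proof -
  have "[1..<2 * Suc k + 1] = [1..<2*k+1] @ [2*k+1, 2*k+2]"
    by (simp add: upt_rec[of "2*k+1"] flip: upt_Suc_append)
  then show ?thesis by (simp add: ebasis_prod_def mult.assoc)
qed

lemma ebasis_commute_pair:
  assumes "i \<in> {1..CARD('n)}" "a \<in> {1..CARD('n)}" "b \<in> {1..CARD('n)}" "i \<noteq> a" "i \<noteq> b"
  shows "cvec (ebasis i :: real ^ 'n::{finite,linorder}) * (cvec (ebasis a) * cvec (ebasis b))
    = (cvec (ebasis a) * cvec (ebasis b)) * cvec (ebasis i)"
proof -
  let ?e = "\<lambda>i. cvec (ebasis i :: (real, 'n) vec)"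
  have "?e i * (?e a * ?e b) = (?e i * ?e a) * ?e b" by (simp add: mult.assoc)
  also have "\<dots> = - (?e a * (?e i * ?e b))"
    unfolding cvec_ebasis_anticommute[OF assms(1,2,4)] by (simp add: mult.assoc)
  also have "\<dots> = ?e a * ?e b * ?e i"
    unfolding cvec_ebasis_anticommute[OF assms(1,3,5)] by (simp add: mult.assoc)
  finally show ?thesis .
qed

lemma ebasis_commute_torus_factor:
  assumes "i \<in> {1..CARD('n)}" "j \<ge> 1" "2 * j \<le> CARD('n)" "i \<noteq> 2 * j - 1" "i \<noteq> 2 * j"
  shows "cvec (ebasis i :: real ^ 'n::{finite,linorder}) * torus_factor \<theta> j = torus_factor \<theta> j * cvec (ebasis i)"
proof -
  have "2 * j - 1 \<in> {1..CARD('n)}" "2 * j \<in> {1..CARD('n)}" using assms by auto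
  from ebasis_commute_pair[OF assms(1) this assms(4,5)] show ?thesis
    by (simp add: torus_factor_def distrib_left distrib_right of_real_def)
qed

lemma ebasis_commute_ebasis_prod:
  assumes "i \<in> {1..CARD('n)}" "2 * k < i"
  shows "cvec (ebasis i :: real ^ 'n::{finite,linorder}) * ebasis_prod k = ebasis_prod k * cvec (ebasis i)"
  using assms
proof (induction k)
  case (Suc k)
  have 1: "cvec (ebasis i :: (real, 'n) vec) * ebasis_prod k = ebasis_prod k * cvec (ebasis i)"
    using Suc by simp
  have 2: "cvec (ebasis i :: (real, 'n) vec) * (cvec (ebasis (2*k+1)) * cvec (ebasis (2*k+2)))
    = (cvec (ebasis (2*k+1)) * cvec (ebasis (2*k+2))) * cvec (ebasis i)"
    using Suc.prems by (intro ebasis_commute_pair) auto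
  show ?case unfolding ebasis_prod_Suc using 1 2 by (rule commute_mult)
qed (simp add: ebasis_prod_0)

lemma ebasis_prod_square:
  assumes "2 * k \<le> CARD('n)"
  shows "ebasis_prod k * ebasis_prod k = ((- 1) ^ k :: 'n::{finite,linorder} clifford)"
  using assms
proof (induction k)
  case (Suc k)
  let ?a = "cvec (ebasis (2*k+1) :: (real, 'n) vec)" and ?b = "cvec (ebasis (2*k+2) :: (real, 'n) vec)"
  let ?P = "ebasis_prod k :: 'n clifford"
  have P: "?P * ?P = (- 1) ^ k" using Suc by simp
  have a: "?a * ?P = ?P * ?a" and b: "?b * ?P = ?P * ?b"
    using Suc.prems by (intro ebasis_commute_ebasis_prod; simp)+
  have ab: "?b * ?a = - (?a * ?b)" using Suc.prems by (intro cvec_ebasis_anticommute) auto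
  have abP: "(?a * ?b) * ?P = ?P * (?a * ?b)" using commute_mult[OF a[symmetric] b[symmetric]] by simp
  have abab: "(?a * ?b) * (?a * ?b) = - 1"
  proof -
    have "(?a * ?b) * (?a * ?b) = ?a * (?b * ?a) * ?b" by (simp add: mult.assoc)
    also have "\<dots> = - (?a * ?a * (?b * ?b))" unfolding ab by (simp add: mult.assoc)
    finally show ?thesis by (simp add: cvec_ebasis_square)
  qed
  have "ebasis_prod (Suc k) * ebasis_prod (Suc k) = ?P * ((?a * ?b) * ?P) * (?a * ?b)"
    by (simp add: ebasis_prod_Suc mult.assoc)
  also have "\<dots> = ?P * ?P * ((?a * ?b) * (?a * ?b))" unfolding abP by (simp add: mult.assoc)
  finally show ?case unfolding P abab by simp
qed (simp add: ebasis_prod_0)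

lemma ebasis_last_commute_torus:
  assumes "CARD('n) = 2 * m + 1"
  shows "torus_elem m t * cvec (ebasis (CARD('n)) :: real ^ 'n::{finite,linorder})
    = cvec (ebasis (CARD('n))) * torus_elem m t"
  unfolding torus_elem_eq using assms
  by (intro commute_prod_list[symmetric]) (auto intro!: ebasis_commute_torus_factor)

text \<open>The torus factors are expanded one at a time. A cosine term contributes no trace, since
  a basis vector is then missing that anticommutes with the rest; the sine terms build up the volume
  element.\<close>

lemma trace_torus_ebasis:
  fixes L :: "'n::{finite,linorder} clifford \<Rightarrow> complex ^ 's ^ 's"
  assumes rep: "clifford_rep L" and n: "CARD('n) = 2 * m + 1"
  shows "trace (L (torus_elem m t * cvec (ebasis (CARD('n)))))
    = of_real (\<Prod>j = 1..m. sin (t j)) * trace (L (ebasis_prod m * cvec (ebasis (CARD('n)))))"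
proof -
  let ?e = "\<lambda>i. cvec (ebasis i :: (real, 'n) vec)"
  let ?Q = "\<lambda>k. prod_list (map (\<lambda>j. torus_factor (t j) j) [k+1..<m+1]) :: 'n clifford"
  have "trace (L (torus_elem m t * ?e (CARD('n))))
      = of_real (\<Prod>j = 1..k. sin (t j)) * trace (L (ebasis_prod k * ?Q k * ?e (CARD('n))))" if "k \<le> m" for k
    using that
  proof (induction k)
    case 0
    then show ?case by (simp add: ebasis_prod_0 torus_elem_eq)
  next
    case (Suc k)
    let ?i = "2 * k + 1"
    have Q: "?Q k = torus_factor (t (Suc k)) (Suc k) * ?Q (Suc k)"
      using Suc.prems by (subst upt_rec) simp
    \<comment> \<open>\<open>e\<^sub>2\<^sub>k\<^sub>+\<^sub>1\<close> occurs in neither factor and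
      both are even, so it commutes with \<open>?X\<close> and anticommutes with
      \<open>e\<^sub>n\<close>.\<close>
    let ?X = "ebasis_prod k * ?Q (Suc k)"
    have eQ: "?e ?i * ?Q (Suc k) = ?Q (Suc k) * ?e ?i"
      using n Suc.prems by (intro commute_prod_list) (auto intro!: ebasis_commute_torus_factor)
    have eP: "?e ?i * ebasis_prod k = ebasis_prod k * ?e ?i"
      using n Suc.prems by (intro ebasis_commute_ebasis_prod) auto
    have eE: "?e ?i * ?e (CARD('n)) = - (?e (CARD('n)) * ?e ?i)"
      using n Suc.prems by (intro cvec_ebasis_anticommute) auto
    have "?e ?i * (?X * ?e (CARD('n))) = ?e ?i * ebasis_prod k * ?Q (Suc k) * ?e (CARD('n))"
      by (simp only: mult.assoc)
    also have "\<dots> = ebasis_prod k * (?e ?i * ?Q (Suc k)) * ?e (CARD('n))"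
      by (simp only: eP mult.assoc)
    also have "\<dots> = ?X * (?e ?i * ?e (CARD('n)))" by (simp only: eQ mult.assoc)
    also have "\<dots> = - (?X * ?e (CARD('n)) * ?e ?i)"
      by (simp only: eE mult_minus_right mult.assoc)
    finally have "?e ?i * (?X * ?e (CARD('n))) = - (?X * ?e (CARD('n)) * ?e ?i)" .
    then have 0: "trace (L (?X * ?e (CARD('n)))) = 0"
      by (rule trace_rep_anticommute[OF rep norm_ebasis])
    have tf: "torus_factor (t (Suc k)) (Suc k) = cos (t (Suc k)) *\<^sub>R 1
        + sin (t (Suc k)) *\<^sub>R (?e (2*k+1) * ?e (2*k+2))"
      by (simp add: torus_factor_def of_real_def)
    have "ebasis_prod k * ?Q k * ?e (CARD('n)) = cos (t (Suc k)) *\<^sub>R (?X * ?e (CARD('n)))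
        + sin (t (Suc k)) *\<^sub>R (ebasis_prod (Suc k) * ?Q (Suc k) * ?e (CARD('n)))"
      unfolding Q ebasis_prod_Suc tf
      by (simp only: distrib_left distrib_right mult.assoc mult_scaleR_left mult_scaleR_right mult_1_left)
    then have "trace (L (ebasis_prod k * ?Q k * ?e (CARD('n))))
      = of_real (sin (t (Suc k))) * trace (L (ebasis_prod (Suc k) * ?Q (Suc k) * ?e (CARD('n))))"
      by (simp only: trace_rep_simps[OF rep] 0) simp
    then show ?case using Suc by simp
  qed
  from this[of m] show ?thesis by simp
qed

lemma half_spin_ebasis_prod:
  "half_spin L m c = {w. L (ebasis_prod m) *v w = (c * \<i> ^ m) *s w}"
  by (simp add: half_spin_def ebasis_prod_def)

text \<open>Divided by \<open>\<i> ^ m\<close>, the operator \<open>?W\<close> is an involution, so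
  every spinor splits into half-spin parts. The sign of \<open>?W\<close> on each part cancels the
  sign with which \<open>e\<^sub>n\<close> acts there, and the product is scalar.\<close>

lemma spin_module_volume_element:
  fixes L :: "'n::{finite,linorder} clifford \<Rightarrow> complex ^ 's ^ 's"
  assumes L: "spin_module m L" and n: "CARD('n) = 2 * m + 1"
  shows "L (cvec (ebasis CARD('n)) * ebasis_prod m) = mat (- \<i> * \<i> ^ m)"
proof -
  have rep: "clifford_rep L" using L by (simp add: spin_module_def irreducible_clifford_rep_def)
  let ?c = "\<i> ^ m" let ?W = "L (ebasis_prod m)" let ?E = "L (cvec (ebasis CARD('n)))"
  have c2: "?c * ?c = (- 1) ^ m" by (simp flip: power_mult_distrib)
  have "L ((- 1) ^ m) = mat ((- 1) ^ m)"
    by (induction m) (simp_all add: clifford_rep_simps[OF rep] vec_eq_iff mat_def)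
  then have "?W ** ?W = mat (?c * ?c)"
    using ebasis_prod_square[of m, where 'n = 'n] n c2 by (simp flip: clifford_rep_simps(2)[OF rep])
  then have WW: "?W *v (?W *v w) = (?c * ?c) *s w" for w
    by (simp add: matrix_vector_mul_assoc) (simp add: vec_eq_iff matrix_vector_mult_def mat_def if_distrib[of "\<lambda>z. z * _"] cong: if_cong)
  have c0: "?c \<noteq> 0" by simp
  have "?E *v (?W *v w) = (- \<i> * ?c) *s w" for w
  proof -
    \<comment> \<open>The components of \<open>w\<close> for the eigenvalues \<open>\<i> ^ m\<close>
      and \<open>- \<i> ^ m\<close> of \<open>?W\<close>.\<close>
    define p where "p = (1/2) *s (w + inverse ?c *s (?W *v w))"
    define q where "q = (1/2) *s (w - inverse ?c *s (?W *v w))"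
    have w: "w = p + q" by (simp add: p_def q_def vec_eq_iff field_simps)
    have Wp: "?W *v p = (1 * ?c) *s p" and Wq: "?W *v q = (- 1 * ?c) *s q"
      unfolding p_def q_def
      by (simp_all add: vector_scalar_commute matrix_vector_right_distrib matrix_vector_mult_diff_distrib WW)
    have "p \<in> half_spin L m 1" "q \<in> half_spin L m (- 1)"
      using Wp Wq by (auto simp: half_spin_ebasis_prod)
    then have Ep: "?E *v p = (- \<i>) *s p" and Eq: "?E *v q = \<i> *s q"
      using L by (auto simp: spin_module_def)
    have "?E *v (?W *v w) = (1 * ?c) *s (?E *v p) + (- 1 * ?c) *s (?E *v q)"
      unfolding w matrix_vector_right_distrib Wp Wq by (simp only: vector_scalar_commute)
    also have "\<dots> = (- \<i> * ?c) *s w"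
      unfolding Ep Eq w by (simp add: vec_eq_iff algebra_simps)
    finally show ?thesis .
  qed
  then have "(?E ** ?W) *v w = mat (- \<i> * ?c) *v w" for w
    by (simp add: matrix_vector_mul_assoc[symmetric])
      (simp add: vec_eq_iff matrix_vector_mult_def mat_def if_distrib[of "\<lambda>z. z * _"] cong: if_cong)
  then show ?thesis by (simp add: clifford_rep_simps[OF rep] matrix_eq)
qed

text \<open>Origin of the constant \<open>(2 * \<i>) ^ m\<close>: the dimension of the spinors gives
  \<open>2 ^ m\<close>, the volume element gives \<open>- \<i> * \<i> ^ m\<close>, and the extra
  \<open>\<i>\<close> on the left removes \<open>- \<i>\<close>.\<close>

lemma trace_spin_module_torus:
  fixes L :: "'n::{finite,linorder} clifford \<Rightarrow> complex ^ 's ^ 's"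
  assumes L: "spin_module m L" and n: "CARD('n) = 2 * m + 1"
  shows "\<i> * trace (L (torus_elem m t * cvec (ebasis CARD('n)))) = (2 * \<i>) ^ m * of_real (\<Prod>j = 1..m. sin (t j))"
proof -
  have rep: "clifford_rep L" and s: "CARD('s) = 2 ^ m"
    using L by (simp_all add: spin_module_def irreducible_clifford_rep_def)
  have "trace (L (ebasis_prod m * cvec (ebasis CARD('n)))) = trace (mat (- \<i> * \<i> ^ m) :: complex ^ 's ^ 's)"
    unfolding trace_rep_commute[OF rep, of "ebasis_prod m"] spin_module_volume_element[OF L n] ..
  also have "\<dots> = 2 ^ m * (- \<i> * \<i> ^ m)"
    by (simp add: trace_def mat_def s)
  finally have "trace (L (ebasis_prod m * cvec (ebasis CARD('n)))) = 2 ^ m * (- \<i> * \<i> ^ m)" .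
  moreover have "\<i> * (p * (a * (- \<i> * b))) = a * b * p" for a b p :: complex
    by (simp add: complex_eq_iff algebra_simps)
  ultimately show ?thesis
    unfolding trace_torus_ebasis[OF rep n] power_mult_distrib by (simp only:)
qed

lemma trace_fixed_vector_sign:
  fixes L :: "'n::{finite,linorder} clifford \<Rightarrow> complex ^ 's ^ 's"
  assumes rep: "clifford_rep L"
    and g: "g \<in> carrier Spin" "g * cvec u = cvec u * g"
    and h: "h \<in> carrier Spin" "spin_mu h (cvec u) = cvec (norm u *\<^sub>R ebasis CARD('n))"
    and k: "k \<in> carrier Spin" "spin_mu k g = x"
    and x: "x * cvec (ebasis CARD('n)) = cvec (ebasis CARD('n)) * x"
    and u: "u \<noteq> 0"
  shows "trace (L (g * cvec u)) = of_real (norm u) *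
    (if \<exists>k \<in> Spin_pred. spin_mu k (spin_mu h g) = x then 1 else - 1) *
      trace (L (x * cvec (ebasis CARD('n))))"
proof -
  let ?e = "ebasis CARD('n) :: (real, 'n) vec"
  define g' where "g' = spin_mu h g"
  have conj: "trace (L (spin_mu j z)) = trace (L z)" if "j \<in> carrier Spin" for j z
    unfolding spin_mu_def using Spin_inverse(3)[OF that] by (rule trace_rep_conjugate[OF rep])
  have "trace (L (g * cvec u)) = trace (L (spin_mu h (g * cvec u)))" by (simp add: conj h)
  also have "\<dots> = of_real (norm u) * trace (L (g' * cvec ?e))"
    by (simp add: spin_mu_mult h g'_def cvec_simps trace_rep_simps[OF rep])
  finally have tr: "trace (L (g * cvec u)) = of_real (norm u) * trace (L (g' * cvec ?e))" .
  show ?thesis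
  proof (cases "\<exists>k \<in> Spin_pred. spin_mu k (spin_mu h g) = x")
    case True
    then obtain j where j: "j \<in> carrier Spin" "spin_mu j (cvec ?e) = cvec ?e" "spin_mu j g' = x"
      by (auto simp: Spin_pred_def g'_def)
    have "trace (L (g' * cvec ?e)) = trace (L (spin_mu j (g' * cvec ?e)))" by (simp add: conj j)
    also have "\<dots> = trace (L (x * cvec ?e))" by (simp add: spin_mu_mult j)
    finally show ?thesis using True tr by simp
  next
    case False
    \<comment> \<open>\<open>j\<close> conjugates \<open>g'\<close> to \<open>x\<close>, but it may
      move the last basis vector to some other unit vector \<open>w\<close> commuting with
      \<open>x\<close>. Were \<open>w \<noteq> - ?e\<close>, the correction would give an element of
      \<open>Spin_pred\<close> doing the same, which the case excludes.\<close>
    define j where "j = k * inv\<^bsub>Spin\<^esub> h"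
    note hi = Spin_inverse[OF h(1)]
    have j: "j \<in> carrier Spin" unfolding j_def by (rule Spin_mult[OF k(1) hi(1)])
    have "spin_mu (inv\<^bsub>Spin\<^esub> h) g' = g"
      unfolding g'_def spin_mu_compose[OF hi(1) h(1), symmetric] hi(3)
      by (simp add: spin_mu_def monoid.inv_one[OF group.is_monoid[OF group_Spin], unfolded Spin_simps])
    then have jg: "spin_mu j g' = x" unfolding j_def spin_mu_compose[OF k(1) hi(1)] using k(2) by simp
    obtain w where w: "spin_mu j (cvec ?e) = cvec w" "norm w = norm ?e"
      using spin_mu_vector[OF j] .
    have "spin_mu h (g * cvec u) = spin_mu h (cvec u * g)" using g(2) by simp
    then have "g' * cvec ?e = cvec ?e * g'"
      using u by (simp add: spin_mu_mult h g'_def cvec_simps)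
    then have "spin_mu j (g' * cvec ?e) = spin_mu j (cvec ?e * g')" by simp
    then have xw: "x * cvec w = cvec w * x" by (simp add: spin_mu_mult j jg w)
    have "w = - ?e"
    proof (rule ccontr)
      assume "w \<noteq> - ?e"
      then obtain k' where "k' \<in> carrier Spin" "spin_mu k' g' = x" "spin_mu k' (cvec ?e) = cvec ?e"
        using Spin_conjugate_fixing[OF j jg w(1) norm_ebasis _ _ x xw] w(2) norm_ebasis by metis
      then show False using False by (auto simp: Spin_pred_def g'_def)
    qed
    have "trace (L (g' * cvec ?e)) = trace (L (spin_mu j (g' * cvec ?e)))" by (simp add: conj j)
    also have "\<dots> = - trace (L (x * cvec ?e))"
      by (simp add: spin_mu_mult j jg w \<open>w = - ?e\<close> cvec_simps trace_rep_simps[OF rep])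
    finally show ?thesis using False tr by simp
  qed
qed

text \<open>\<open>u\<close> itself is fixed, so a fixed space of dimension other than 1 is larger
  than the line through \<open>u\<close>; orthogonalising against \<open>u\<close> produces the
  fixed unit vector \<open>v\<close>.\<close>

lemma trace_fixed_dim_ne_1:
  fixes L :: "'n::{finite,linorder} clifford \<Rightarrow> complex ^ 's ^ 's"
  assumes rep: "clifford_rep L" and g: "\<And>y. g * cvec y = cvec (B *v y) * g"
    and u: "u \<noteq> 0" "B *v u = u" and dim: "fixed_dim B \<noteq> 1"
  shows "trace (L (g * cvec u)) = 0"
proof -
  let ?F = "{y. (B - mat 1) *v y = 0}"
  have F: "y \<in> ?F \<longleftrightarrow> B *v y = y" for y by (simp add: matrix_vector_mult_diff_rdistrib)
  have "\<not> ?F \<subseteq> span {u}"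
  proof
    assume "?F \<subseteq> span {u}"
    moreover have "span {u} \<subseteq> ?F"
      using u(2) by (auto simp: span_singleton matrix_vector_mult_diff_rdistrib matrix_vector_mult_scaleR)
    ultimately have "?F = span {u}" by blast
    then have "fixed_dim B = 1" using u(1) by (simp add: fixed_dim_def dim_insert)
    then show False using dim by simp
  qed
  then obtain y where y: "B *v y = y" "y \<notin> span {u}" using F by blast
  define z where "z = y - ((y \<bullet> u) / (u \<bullet> u)) *\<^sub>R u"
  have z: "z \<noteq> 0" using y(2) by (auto simp: z_def span_singleton)
  have zu: "z \<bullet> u = 0" using u(1) by (simp add: z_def inner_diff_left)
  have Bz: "B *v z = z" using y(1) u(2) by (simp add: z_def matrix_vector_mult_diff_distrib matrix_vector_mult_scaleR)
  define v where "v = (1 / norm z) *\<^sub>R z"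
  have v: "norm v = 1" "B *v v = v" "v \<bullet> u = 0"
    using z zu Bz by (simp_all add: v_def matrix_vector_mult_scaleR)
  have gv: "g * cvec v = cvec v * g" using g[of v] v(2) by simp
  have vu: "cvec v * cvec u = - (cvec u * cvec v)"
    using cvec_anticommute[of v u] v(3) by (simp add: add_eq_0_iff2)
  show ?thesis
  proof (rule trace_rep_anticommute[OF rep v(1)])
    have "cvec v * (g * cvec u) = g * (cvec v * cvec u)" using gv by (simp flip: mult.assoc)
    then show "cvec v * (g * cvec u) = - (g * cvec u * cvec v)" by (simp add: vu mult.assoc)
  qed
qed

section \<open>Central elements of the spin group\<close>

lemma even_card_sym_diff_singleton:
  fixes C :: "'n::finite set"
  shows "even (card (sym_diff {i} C)) \<longleftrightarrow> odd (card C)"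
proof (cases "i \<in> C")
  case True
  then have "sym_diff {i} C = C - {i}" by auto
  moreover have "card C = Suc (card (C - {i}))" using True card.remove[of C i] by simp
  ultimately show ?thesis by simp
next
  case False
  then have "sym_diff {i} C = insert i C" by auto
  then show ?thesis using False by simp
qed

text \<open>The parity grading: a product of vectors has coefficients only in degrees of the parity
  of the number of factors. The induction therefore runs over products of arbitrary length.\<close>

lemma ccoeff_Spin_odd:
  fixes g :: "'n::{finite,linorder} clifford"
  assumes "g \<in> carrier Spin" "odd (card A)"
  shows "ccoeff g A = 0"
proof -
  have "ccoeff (prod_list (map cvec vs)) A = 0" if "odd (card A + length vs)"
    for vs :: "(real, 'n) vec list" and A
    using that
  proof (induction vs arbitrary: A)
    case Nil
    then show ?case by auto
  next
    case (Cons v vs)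
    have "ccoeff (cvec v) B * ccoeff (prod_list (map cvec vs)) (sym_diff B A) = 0" for B
    proof (cases "is_singleton B")
      case True
      then obtain i where B: "B = {i}" by (auto simp: is_singleton_def)
      have "odd (card (sym_diff {i} A) + length vs)"
        using Cons.prems even_card_sym_diff_singleton[of i A] by simp
      then show ?thesis using Cons.IH unfolding B by simp
    qed (simp add: ccoeff_cvec)
    then show ?case
      unfolding list.map prod_list.Cons ccoeff_times_sum mult.assoc by (simp only: mult_zero_right sum.neutral_const)
  qed
  then show ?thesis using assms by (auto simp: Spin_def)
qed

text \<open>In odd dimension the volume element of the whole algebra is central as well, so parity
  must exclude it. For nonempty \<open>A\<close> of even size and \<open>i \<in> A\<close>,
  \<open>e\<^sub>i\<close> anticommutes with \<open>e\<^sub>A\<close>, and comparing coefficients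
  removes \<open>A\<close>.\<close>

lemma Spin_central:
  fixes g :: "'n::{finite,linorder} clifford"
  assumes g: "g \<in> carrier Spin" and comm: "\<And>v. g * cvec v = cvec v * g"
  obtains c where "g = of_real c"
proof -
  have zero: "ccoeff g A = 0" if "A \<noteq> {}" for A
  proof (cases "odd (card A)")
    case True
    then show ?thesis using g by (rule ccoeff_Spin_odd[rotated])
  next
    case False
    obtain i where i: "i \<in> A" using \<open>A \<noteq> {}\<close> by blast
    \<comment> \<open>The index at which both \<open>e\<^sub>i e\<^sub>A\<close> and
      \<open>e\<^sub>A e\<^sub>i\<close> land; no other coefficient of \<open>g\<close> reaches
      it.\<close>
    let ?C = "sym_diff {i} A"
    have sd: "sym_diff {i} ?C = A" "\<And>B. sym_diff B ?C = {i} \<longleftrightarrow> B = A" "sym_diff A ?C = {i}" by auto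
    have "ccoeff (cgen i * g) ?C = (\<Sum>B\<in>UNIV. if B = {i} then csign B (sym_diff B ?C) * ccoeff g (sym_diff B ?C) else 0)"
      unfolding ccoeff_times_sum by (intro sum.cong) (auto simp: ccoeff_cgen)
    also have "\<dots> = csign {i} A * ccoeff g A" using sd(1) by (simp del: insert_Diff_if)
    finally have 1: "ccoeff (cgen i * g) ?C = csign {i} A * ccoeff g A" .
    have "ccoeff (g * cgen i) ?C = (\<Sum>B\<in>UNIV. if B = A then csign A {i} * ccoeff g A else 0)"
      unfolding ccoeff_times_sum ccoeff_cgen sd(2) using sd(3) by (intro sum.cong) auto
    also have "\<dots> = csign A {i} * ccoeff g A" by simp
    finally have 2: "ccoeff (g * cgen i) ?C = csign A {i} * ccoeff g A" .
    \<comment> \<open>The index \<open>i\<close> contributes two minus signs and each other element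
      of \<open>A\<close> exactly one; there is an odd number of the latter.\<close>
    have "csign {i} A * csign A {i} = (\<Prod>a\<in>A. (if a \<le> i then - 1 else 1) * (if i \<le> a then - 1 else 1))"
      by (simp add: csign_prod prod.distrib)
    also have "\<dots> = (\<Prod>a\<in>A. if a = i then 1 else - 1)" by (intro prod.cong) auto
    also have "\<dots> = (\<Prod>a\<in>A - {i}. - 1)"
      using i by (subst prod.remove[of A i]) (auto intro!: prod.cong)
    also have "\<dots> = - 1"
      using False i by (simp add: card_Diff_singleton) (metis Suc_diff_1 card_gt_0_iff empty_iff even_Suc finite power_minus_odd power_one One_nat_def)
    finally have prod: "csign {i} A * csign A {i} = - 1" .
    have "csign {i} A = csign {i} A * (csign A {i} * csign A {i})" by (simp add: csign_square)
    then have "csign {i} A = - csign A {i}" using prod by (simp flip: mult.assoc)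
    moreover have "csign {i} A * ccoeff g A = csign A {i} * ccoeff g A"
      using comm[of "axis i 1"] 1 2 by (simp add: cgen_def)
    moreover have "csign A {i} \<noteq> 0" using csign_square[of A "{i}"] by auto
    ultimately show ?thesis by simp
  qed
  have "g = of_real (ccoeff g {})"
    by (rule clifford_eqI) (auto simp: of_real_def zero)
  then show ?thesis by (rule that)
qed

text \<open>A scalar \<open>c\<close> acts with determinant \<open>c ^ CARD('s)\<close>, and
  determinants of spin elements have modulus 1.\<close>

lemma Spin_central_sign:
  fixes L :: "'n::{finite,linorder} clifford \<Rightarrow> complex ^ 's ^ 's" and g :: "'n clifford"
  assumes rep: "clifford_rep L" and g: "g \<in> carrier Spin" and comm: "\<And>v. g * cvec v = cvec v * g"
  obtains c where "g = of_real c" "c\<^sup>2 = 1"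
proof -
  obtain c where c: "g = of_real c" using Spin_central[OF g comm] .
  have "L g = mat (of_real c)" by (simp add: c rep_of_real[OF rep])
  moreover have "det (mat z :: complex ^ 's ^ 's) = z ^ CARD('s)" for z
    by (subst det_diagonal) (auto simp: mat_def)
  ultimately have "\<bar>c\<bar> ^ CARD('s) = 1"
    using norm_det_rep_Spin[OF rep g] by (simp add: norm_power)
  then have "\<bar>c\<bar> = 1" using power_eq_imp_eq_base[of "\<bar>c\<bar>" "CARD('s)" 1] by simp
  then have "c\<^sup>2 = 1" by (metis one_power2 power2_abs)
  then show ?thesis using c that by blast
qed

section \<open>Lattice sums and plane waves\<close>

text \<open>The expansion writes the identity of \<open>E\<close> as a sum of rank one maps; its
  trace is the dimension, also when the \<open>q i\<close> are dependent. Linearity of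
  \<open>\<phi>\<close> is asked on combinations from \<open>E\<close> only, since Fourier
  coefficients of arbitrary functions are not additive. The bound by \<open>card I\<close> is
  obtained together with finite dimension.\<close>

lemma (in vector_space) dim_eq_frame_sum:
  assumes I: "finite I" and q: "\<And>i. i \<in> I \<Longrightarrow> q i \<in> E"
    and expand: "\<And>f. f \<in> E \<Longrightarrow> f = (\<Sum>i\<in>I. scale (\<phi> i f) (q i))"
    and lin: "\<And>i B c. i \<in> I \<Longrightarrow> finite B \<Longrightarrow> B \<subseteq> E \<Longrightarrow> \<phi> i (\<Sum>b\<in>B. scale (c b) b) = (\<Sum>b\<in>B. c b * \<phi> i b)"
  shows "of_nat (dim E) = (\<Sum>i\<in>I. \<phi> i (q i))" and "dim E \<le> card I"
proof -
  obtain B where B: "B \<subseteq> E" "independent B" "E \<subseteq> span B" "card B = dim E"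
    using basis_exists[of E] by metis
  have Eq: "E \<subseteq> span (q ` I)"
  proof
    fix f assume "f \<in> E"
    then have "f = (\<Sum>i\<in>I. scale (\<phi> i f) (q i))" by (rule expand)
    also have "\<dots> \<in> span (q ` I)" by (intro span_sum span_scale span_base) auto
    finally show "f \<in> span (q ` I)" .
  qed
  have finB: "finite B"
    using independent_span_bound[of "q ` I" B] I B(1,2) Eq by auto
  have "dim E \<le> card (q ` I)" using Eq I by (intro dim_le_card) auto
  then show "dim E \<le> card I" using card_image_le[OF I, of q] by linarith
  have rep: "f = (\<Sum>b\<in>B. scale (representation B f b) b)" if "f \<in> E" for f
    using sum_representation_eq[OF B(2) _ finB order_refl, of f] that B(3) by auto
  have "(\<Sum>i\<in>I. \<phi> i (q i)) = (\<Sum>i\<in>I. \<Sum>b\<in>B. representation B (q i) b * \<phi> i b)"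
    using lin[OF _ finB B(1)] rep q by (intro sum.cong refl) metis
  also have "\<dots> = (\<Sum>b\<in>B. \<Sum>i\<in>I. \<phi> i b * representation B (q i) b)"
    by (subst sum.swap) (simp add: mult.commute)
  also have "\<dots> = (\<Sum>b\<in>B. representation B (\<Sum>i\<in>I. scale (\<phi> i b) (q i)) b)"
  proof (intro sum.cong refl)
    fix b
    have sp: "q i \<in> span B" if "i \<in> I" for i using q[OF that] B(3) by blast
    have "representation B (\<Sum>i\<in>I. scale (\<phi> i b) (q i)) = (\<lambda>b'. \<Sum>i\<in>I. representation B (scale (\<phi> i b) (q i)) b')"
      using sp by (intro representation_sum[OF B(2)] span_scale) auto
    also have "\<dots> = (\<lambda>b'. \<Sum>i\<in>I. \<phi> i b * representation B (q i) b')"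
      using sp by (intro ext sum.cong) (auto simp: representation_scale[OF B(2)])
    finally show "(\<Sum>i\<in>I. \<phi> i b * representation B (q i) b) = representation B (\<Sum>i\<in>I. scale (\<phi> i b) (q i)) b"
      by simp
  qed
  also have "\<dots> = (\<Sum>b\<in>B. representation B b b)"
    using expand B(1) by (intro sum.cong refl) (metis subsetD)
  also have "\<dots> = (\<Sum>b\<in>B. 1)"
    by (intro sum.cong refl) (simp add: representation_basis[OF B(2)])
  finally show "of_nat (dim E) = (\<Sum>i\<in>I. \<phi> i (q i))" by (simp add: B(4))
qed

section \<open>Counting dual lattice points\<close>

lemma dual_lattice_component_bound:
  fixes A :: "real ^ 'n ^ 'n"
  obtains C where "C \<ge> 1" "\<And>u i. \<bar>u \<bullet> column i A\<bar> \<le> C * norm u"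
proof -
  define C where "C = 1 + (\<Sum>i\<in>UNIV. norm (column i A))"
  have "norm (column i A) \<le> C" for i
    using member_le_sum[of i UNIV "\<lambda>i. norm (column i A)"] by (simp add: C_def)
  then have "\<bar>u \<bullet> column i A\<bar> \<le> C * norm u" for u i
    using Cauchy_Schwarz_ineq2[of u "column i A"]
    by (smt (verit) mult.commute mult_left_mono norm_ge_zero)
  moreover have "C \<ge> 1" by (simp add: C_def sum_nonneg)
  ultimately show ?thesis using that by blast
qed

lemma inner_columns_eq_0:
  fixes A :: "real ^ 'n ^ 'n"
  assumes "invertible A" "\<And>i. u \<bullet> column i A = 0"
  shows "u = 0"
proof -
  have "transpose A *v u = 0"
    using assms(2) by (simp add: vec_eq_iff matrix_vector_mul_component row_transpose inner_commute)
      (simp add: matrix_vector_mult_def inner_vec_def column_def transpose_def mult.commute)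
  moreover have "transpose (matrix_inv A) *v (transpose A *v u) = u"
    by (simp add: matrix_vector_mul_assoc matrix_transpose_mul[symmetric] invertible_matrix_inv[OF assms(1)])
  ultimately show ?thesis by simp
qed

lemma dual_lattice_large_component:
  assumes "invertible A" "u \<in> dual_lattice A" "u \<noteq> 0"
  obtains i where "\<bar>u \<bullet> column i A\<bar> \<ge> 1"
proof -
  obtain i where i: "u \<bullet> column i A \<noteq> 0" using inner_columns_eq_0[OF assms(1)] assms(3) by blast
  moreover obtain k where "u \<bullet> column i A = of_int k" using assms(2) by (auto simp: dual_lattice_def elim: Ints_cases)
  ultimately show ?thesis using that[of i] by auto
qed

text \<open>The difference of two distinct dual vectors has a nonzero integral coordinate, hence
  length at least \<open>1 / C\<close>.\<close>

lemma finite_dual_lattice_ball: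
  fixes A :: "real ^ 'n ^ 'n"
  assumes A: "invertible A"
  shows "finite {u \<in> dual_lattice A. norm u \<le> r}"
proof -
  obtain C where C: "C \<ge> 1" "\<And>u i. \<bar>u \<bullet> column i A\<bar> \<le> C * norm u"
    using dual_lattice_component_bound[of A] by blast
  show ?thesis
  proof (rule finite_bounded_separated[where \<delta> = "1 / C"])
    show "bounded {u \<in> dual_lattice A. norm u \<le> r}" by (rule boundedI) auto
    show "1 / C > 0" using C by simp
    fix u v assume uv: "u \<in> {u \<in> dual_lattice A. norm u \<le> r}" "v \<in> {u \<in> dual_lattice A. norm u \<le> r}" "dist u v < 1 / C"
    show "u = v"
    proof (rule ccontr)
      assume "u \<noteq> v"
      moreover have "u - v \<in> dual_lattice A"
        using uv dual_lattice_add[of u A "- v"] by (simp add: dual_lattice_minus)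
      ultimately obtain i where "\<bar>(u - v) \<bullet> column i A\<bar> \<ge> 1"
        using dual_lattice_large_component[OF A] by (metis eq_iff_diff_eq_0)
      then have "1 \<le> C * dist u v" using C(2)[of "u - v" i] by (simp add: dist_norm)
      then show False using uv(3) C(1) by (simp add: field_simps)
    qed
  qed
qed

lemma summable_on_int_powr:
  assumes "p > 1"
  shows "(\<lambda>k::int. (1 + \<bar>of_int k\<bar>) powr (- p) :: real) summable_on UNIV"
proof -
  let ?f = "\<lambda>k::int. (1 + \<bar>of_int k\<bar>) powr (- p) :: real"
  have "summable (\<lambda>n. real (Suc n) powr (- p))"
    using summable_real_powr_iff[of "- p"] assms by (subst summable_Suc_iff) simp
  then have s: "(\<lambda>n. (1 + real n) powr (- p)) summable_on UNIV"
    by (subst summable_on_UNIV_nonneg_real_iff) (auto simp: add.commute)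
  have "?f summable_on (int ` UNIV)"
    by (subst summable_on_reindex) (use s in \<open>auto simp: o_def\<close>)
  moreover have "?f summable_on ((\<lambda>n. - int n) ` (UNIV - {0}))"
    by (subst summable_on_reindex)
      (use summable_on_subset_banach[OF s, of "UNIV - {0}"] in \<open>auto simp: o_def inj_on_def\<close>)
  moreover have "int ` UNIV \<inter> (\<lambda>n. - int n) ` (UNIV - {0}) = {}" by auto
  ultimately have "?f summable_on (int ` UNIV \<union> (\<lambda>n. - int n) ` (UNIV - {0}))"
    by (rule summable_on_Un_disjoint)
  moreover have "int ` UNIV \<union> (\<lambda>n. - int n) ` (UNIV - {0}) = UNIV"
  proof -
    have "k \<in> int ` UNIV \<union> (\<lambda>n. - int n) ` (UNIV - {0})" for k :: int
      by (cases k rule: int_cases3) (auto simp: image_iff)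
    then show ?thesis by (rule UNIV_eq_I[symmetric])
  qed
  ultimately show ?thesis by (simp only:)
qed

text \<open>A power of \<open>|u|\<close> beyond the dimension is dominated by a product of one-variable powers of the
  integral coordinates of \<open>u\<close>.\<close>

lemma summable_on_dual_lattice_powr:
  fixes A :: "real ^ 'n ^ 'n"
  assumes A: "invertible A" and \<sigma>: "\<sigma> > real CARD('n)"
  shows "(\<lambda>u. norm u powr (- \<sigma>)) summable_on (dual_lattice A - {0})"
proof -
  obtain C where C: "C \<ge> 1" "\<And>u i. \<bar>u \<bullet> column i A\<bar> \<le> C * norm u"
    using dual_lattice_component_bound[of A] by blast
  \<comment> \<open>Each coordinate gets an equal share of the exponent, which exceeds 1 exactly
    because \<open>\<sigma>\<close> exceeds the dimension.\<close>
  define p where "p = \<sigma> / real CARD('n)"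
  have p: "p > 1" using \<sigma> by (simp add: p_def)
  define a where "a k = (1 + \<bar>of_int k\<bar>) powr (- p)" for k :: int
  define kk where "kk u = (\<lambda>i. \<lfloor>u \<bullet> column i A\<rfloor>)" for u
  let ?D = "dual_lattice A - {0}"
  have "(\<lambda>k. \<Prod>i\<in>(UNIV::'n set). a (k i)) summable_on (PiE UNIV (\<lambda>i. UNIV))"
  proof -
    have "(\<lambda>k. norm (a k)) summable_on UNIV"
      using summable_on_int_powr[OF p] by (simp add: a_def)
    then have "Infinite_Set_Sum.abs_summable_on a UNIV" by (simp only: abs_summable_equivalent)
    then have "Infinite_Set_Sum.abs_summable_on (\<lambda>k. \<Prod>i\<in>(UNIV::'n set). a (k i)) (PiE UNIV (\<lambda>i. UNIV))"
      by (intro abs_summable_on_prod_PiE) auto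
    then show ?thesis by (rule abs_summable_summable[OF abs_summable_equivalent[THEN iffD2]])
  qed
  moreover have inj: "inj_on kk ?D"
  proof (rule inj_onI)
    fix u v assume uv: "u \<in> ?D" "v \<in> ?D" "kk u = kk v"
    have "(u - v) \<bullet> column i A = 0" for i
    proof -
      obtain k l where "u \<bullet> column i A = of_int k" "v \<bullet> column i A = of_int l"
        using uv(1,2) by (auto simp: dual_lattice_def elim!: Ints_cases dest!: spec[of _ i])
      then show ?thesis using fun_cong[OF uv(3), of i] by (simp add: kk_def inner_diff_left)
    qed
    from inner_columns_eq_0[OF A this] show "u = v" by simp
  qed
  ultimately have s: "(\<lambda>u. \<Prod>i\<in>(UNIV::'n set). a (kk u i)) summable_on ?D"
    using summable_on_subset_banach[of "\<lambda>k. \<Prod>i\<in>(UNIV::'n set). a (k i)" "PiE UNIV (\<lambda>i. UNIV)" "kk ` ?D"]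
      summable_on_reindex[OF inj, of "\<lambda>k. \<Prod>i\<in>(UNIV::'n set). a (k i)"] by (simp add: o_def)
  then have s': "(\<lambda>u. (2 * C) powr \<sigma> * (\<Prod>i\<in>(UNIV::'n set). a (kk u i))) summable_on ?D"
    by (rule summable_on_cmult_right)
  show ?thesis
  proof (rule summable_on_comparison_test[OF s'])
    fix u assume u: "u \<in> ?D"
    \<comment> \<open>Some integral coordinate is nonzero, so \<open>C * norm u \<ge> 1\<close>;
      this absorbs the summand 1 in \<open>1 + |k|\<close> at the price of a factor 2.\<close>
    obtain i0 where i0: "\<bar>u \<bullet> column i0 A\<bar> \<ge> 1" using dual_lattice_large_component[OF A] u by blast
    then have Cu: "1 \<le> C * norm u" using C(2)[of u i0] by linarith
    have u0: "norm u > 0" using u by simp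
    have "1 + \<bar>of_int (kk u i)\<bar> \<le> 2 * C * norm u" for i
    proof -
      obtain k where "u \<bullet> column i A = of_int k"
        using u by (auto simp: dual_lattice_def elim!: Ints_cases dest!: spec[of _ i])
      then show ?thesis using C(2)[of u i] Cu by (simp add: kk_def)
    qed
    then have "(2 * C * norm u) powr (- p) \<le> a (kk u i)" for i
      unfolding a_def using p by (intro powr_mono2') auto
    then have "(\<Prod>i\<in>(UNIV::'n set). (2 * C * norm u) powr (- p)) \<le> (\<Prod>i\<in>(UNIV::'n set). a (kk u i))"
      by (intro prod_mono) auto
    also have "(\<Prod>i\<in>(UNIV::'n set). (2 * C * norm u) powr (- p)) = (2 * C * norm u) powr (- \<sigma>)"
      using C(1) u0 by (simp add: p_def powr_powr flip: powr_realpow)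
    also have "\<dots> = (2 * C) powr (- \<sigma>) * norm u powr (- \<sigma>)"
      using C(1) u0 by (simp add: powr_mult)
    finally have "(2 * C) powr \<sigma> * ((2 * C) powr (- \<sigma>) * norm u powr (- \<sigma>)) \<le> (2 * C) powr \<sigma> * (\<Prod>i\<in>(UNIV::'n set). a (kk u i))"
      by (intro mult_left_mono) auto
    moreover have "(2 * C) powr \<sigma> * (2 * C) powr (- \<sigma>) = 1"
      using C(1) by (simp flip: powr_add)
    ultimately show "norm u powr (- \<sigma>) \<le> (2 * C) powr \<sigma> * (\<Prod>i\<in>(UNIV::'n set). a (kk u i))"
      by (simp flip: mult.assoc)
  qed simp
qed

text \<open>Groups the dual lattice by length. Lengths that do not occur have empty shells, so
  \<open>\<mu>\<close> may run over all positive reals.\<close>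

lemma summable_on_dual_lattice_shells:
  fixes A :: "real ^ 'n ^ 'n"
  assumes A: "invertible A" and \<sigma>: "\<sigma> > real CARD('n)"
  shows "(\<lambda>\<mu>. real (card {u \<in> dual_lattice A. norm u = \<mu>}) * \<mu> powr (- \<sigma>)) summable_on {0<..}"
proof -
  let ?S = "\<lambda>\<mu>. {u \<in> dual_lattice A. norm u = \<mu>}"
  have fin: "finite (?S \<mu>)" for \<mu>
    by (rule finite_subset[OF _ finite_dual_lattice_ball[OF A, of \<mu>]]) auto
  have bij: "bij_betw snd (Sigma {0<..} ?S) (dual_lattice A - {0})"
    by (rule bij_betw_byWitness[where f' = "\<lambda>u. (norm u, u)"]) auto
  have "(\<lambda>x. norm (snd x) powr (- \<sigma>)) summable_on (Sigma {0<..} ?S)"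
    using summable_on_dual_lattice_powr[OF assms]
    unfolding summable_on_reindex_bij_betw[OF bij, of "\<lambda>u. norm u powr (- \<sigma>)"] .
  then have "(\<lambda>\<mu>. infsum (\<lambda>u. norm (snd (\<mu>, u)) powr (- \<sigma>)) (?S \<mu>)) summable_on {0<..}"
    by (rule summable_on_SigmaD) (use fin in auto)
  moreover have "infsum (\<lambda>u. norm (snd (\<mu>, u)) powr (- \<sigma>)) (?S \<mu>) = real (card (?S \<mu>)) * \<mu> powr (- \<sigma>)" for \<mu>
    using fin by simp
  ultimately show ?thesis by simp
qed

section \<open>Finite sums of plane waves\<close>

definition wave_sum :: "'j set \<Rightarrow> ('j \<Rightarrow> real ^ 'n) \<Rightarrow> ('j \<Rightarrow> complex ^ 'k) \<Rightarrow> real ^ 'n \<Rightarrow> complex ^ 'k" where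
  "wave_sum J k w x = (\<Sum>j\<in>J. plane_wave (k j) x *s w j)"

lemma bounded_linear_vector_scale: "bounded_linear (\<lambda>c::complex. c *s (w :: complex ^ 'k))"
proof -
  have "linear (\<lambda>c::complex. c *s w)"
    by (rule linearI) (simp_all add: vec_eq_iff algebra_simps)
  then show ?thesis by (rule linear_conv_bounded_linear[THEN iffD1])
qed

lemma has_derivative_plane_wave:
  "(plane_wave u has_derivative (\<lambda>h. of_real (u \<bullet> h) * (2 * pi * \<i> * plane_wave u x))) (at x)"
proof -
  have "((\<lambda>x. of_real (u \<bullet> x) :: complex) has_derivative (\<lambda>h. of_real (u \<bullet> h))) (at x)"
    by (intro bounded_linear.has_derivative[OF bounded_linear_of_real] derivative_intros)
  moreover have "((\<lambda>z. exp (2 * pi * \<i> * z)) has_derivative (\<lambda>h. h * (2 * pi * \<i> * plane_wave u x)))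
      (at (of_real (u \<bullet> x)))"
    unfolding has_field_derivative_def[symmetric] mult.commute[of _ "2 * pi * \<i> * plane_wave u x"]
    by (auto intro!: derivative_eq_intros simp: plane_wave_def)
  ultimately show ?thesis
    unfolding plane_wave_def[abs_def] by (rule has_derivative_compose)
qed

lemma has_derivative_wave_sum:
  fixes k :: "'j \<Rightarrow> real ^ 'n"
  shows "(wave_sum J k w has_derivative
    (\<lambda>h. \<Sum>j\<in>J. (of_real (k j \<bullet> h) * (2 * pi * \<i> * plane_wave (k j) x)) *s w j)) (at x)"
  unfolding wave_sum_def[abs_def]
  by (intro has_derivative_sum bounded_linear.has_derivative[OF bounded_linear_vector_scale]
      has_derivative_plane_wave)

lemma partial_deriv_has_derivative:
  assumes "(f has_derivative f') (at x)"
  shows "((\<lambda>t. f (x + t *\<^sub>R axis i 1)) has_vector_derivative f' (axis i 1)) (at 0)"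
proof -
  have "((\<lambda>t. x + t *\<^sub>R axis i 1) has_vector_derivative axis i 1) (at (0::real))"
    by (auto intro!: derivative_eq_intros)
  moreover have "(f has_derivative f') (at (x + 0 *\<^sub>R axis i 1) within range (\<lambda>t. x + t *\<^sub>R axis i 1))"
    using assms by (simp add: has_derivative_at_withinI)
  ultimately show ?thesis
    using vector_derivative_diff_chain_within[of "\<lambda>t. x + t *\<^sub>R axis i 1" "axis i 1" 0 UNIV f f'] by (simp add: o_def)
qed

lemma partial_deriv_wave_sum:
  "partial_deriv i (wave_sum J k w) = wave_sum J k (\<lambda>j. (2 * pi * \<i> * of_real (k j $ i)) *s w j)"
proof
  fix x
  show "partial_deriv i (wave_sum J k w) x = wave_sum J k (\<lambda>j. (2 * pi * \<i> * of_real (k j $ i)) *s w j) x"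
    unfolding partial_deriv_def
    using vector_derivative_at[OF partial_deriv_has_derivative[OF has_derivative_wave_sum]]
    by (simp add: wave_sum_def inner_axis mult_ac)
qed

text \<open>Partial derivatives are again wave sums with the same frequencies, so the induction has
  to be over all coefficient families.\<close>

lemma smooth_wave_sum: "smooth (wave_sum J k w)"
proof -
  have "C_k m (wave_sum J k w)" for m
  proof (induction m arbitrary: w)
    case 0
    show ?case unfolding C_k.simps
      using has_derivative_continuous[OF has_derivative_wave_sum] by (intro continuous_at_imp_continuous_on ballI)
  next
    case (Suc m)
    show ?case unfolding C_k.simps partial_deriv_wave_sum
      using Suc has_derivative_wave_sum unfolding differentiable_def by blast
  qed
  then show ?thesis by (simp add: smooth_def)
qed

lemma smooth_partial_deriv:
  assumes "smooth f"
  shows "((\<lambda>t. f (x + t *\<^sub>R axis i 1)) has_vector_derivative partial_deriv i f x) (at 0)"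
    and "continuous_on UNIV f" and "continuous_on UNIV (partial_deriv i f)"
proof -
  have 1: "C_k 1 f" and 0: "C_k 0 f" using assms by (auto simp: smooth_def)
  show "continuous_on UNIV f" using 0 by simp
  show "continuous_on UNIV (partial_deriv i f)" using 1 by simp
  have "f differentiable at x" using 1 by simp
  then obtain f' where "(f has_derivative f') (at x)" by (auto simp: differentiable_def)
  from partial_deriv_has_derivative[OF this]
  show "((\<lambda>t. f (x + t *\<^sub>R axis i 1)) has_vector_derivative partial_deriv i f x) (at 0)"
    by (metis partial_deriv_def vector_derivative_at)
qed

text \<open>Integration by parts: the derivative of \<open>f\<close> times the conjugate wave has
  mean zero.\<close>

lemma fourier_coeff_partial_deriv:
  fixes f :: "real ^ 'n \<Rightarrow> complex ^ 'k"
  assumes A: "invertible A" and f: "smooth f" "lattice_periodic A f" and u: "u \<in> dual_lattice A"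
  shows "fourier_coeff A (\<lambda>x. partial_deriv i f x $ p) u
    = 2 * pi * \<i> * of_real (u $ i) * fourier_coeff A (\<lambda>x. f x $ p) u"
proof -
  let ?c = "2 * pi * \<i> * of_real (u $ i) :: complex"
  note sm = smooth_partial_deriv[OF f(1)]
  have c1: "continuous_on UNIV (\<lambda>x. f x $ p)" and c2: "continuous_on UNIV (\<lambda>x. partial_deriv i f x $ p)"
    by (intro continuous_on_component sm)+
  let ?g = "\<lambda>x. f x $ p * plane_wave (- u) x"
  let ?g' = "\<lambda>x. partial_deriv i f x $ p * plane_wave (- u) x + (- ?c) * (f x $ p * plane_wave (- u) x)"
  have "periodic_mean A ?g' = 0"
  proof (rule periodic_mean_directional_derivative[OF A, where f = ?g and v = "axis i 1"])
    show "continuous_on UNIV ?g" "continuous_on UNIV ?g'"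
      by (intro continuous_intros c1 c2)+
    show "lattice_periodic A ?g"
      using f(2) u lattice_periodic_plane_wave[of A "- u"] by (simp add: lattice_periodic_def dual_lattice_minus)
    fix x
    have "((\<lambda>t. f (x + t *\<^sub>R axis i 1) $ p) has_vector_derivative partial_deriv i f x $ p) (at 0)"
      by (rule bounded_linear.has_vector_derivative[OF bounded_linear_vec_nth sm(1)])
    moreover have "((\<lambda>t. plane_wave (- u) (x + t *\<^sub>R axis i 1)) has_vector_derivative
        (- ?c) * plane_wave (- u) x) (at 0)"
      using partial_deriv_has_derivative[OF has_derivative_plane_wave, of "- u" x i]
      by (simp add: inner_axis mult_ac)
    ultimately have "((\<lambda>t. f (x + t *\<^sub>R axis i 1) $ p * plane_wave (- u) (x + t *\<^sub>R axis i 1)) has_vector_derivative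
       (f (x + 0 *\<^sub>R axis i 1) $ p * ((- ?c) * plane_wave (- u) x)
        + partial_deriv i f x $ p * plane_wave (- u) (x + 0 *\<^sub>R axis i 1))) (at 0)"
      by (rule has_vector_derivative_mult)
    then show "((\<lambda>t. ?g (x + t *\<^sub>R axis i 1)) has_vector_derivative ?g' x) (at 0)"
      by (simp add: algebra_simps)
  qed
  moreover have "periodic_mean A ?g' = fourier_coeff A (\<lambda>x. partial_deriv i f x $ p) u + (- ?c) * fourier_coeff A (\<lambda>x. f x $ p) u"
    unfolding fourier_coeff_def periodic_mean_mult[symmetric]
    by (rule periodic_mean_add) (intro continuous_intros c1 c2)+
  ultimately show ?thesis by (simp add: eq_neg_iff_add_eq_0[symmetric])
qed

section \<open>Kronecker products\<close>

lemma kron_mult: "kron A B ** kron C D = kron (A ** C) (B ** D)"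
proof -
  have "(kron A B ** kron C D) $ p $ q = kron (A ** C) (B ** D) $ p $ q" for p q
  proof -
    have "(kron A B ** kron C D) $ p $ q =
      (\<Sum>(i, j)\<in>UNIV \<times> UNIV. (A $ fst p $ i * C $ i $ fst q) * (B $ snd p $ j * D $ j $ snd q))"
      by (simp add: matrix_matrix_mult_def kron_def case_prod_beta mult_ac)
    also have "\<dots> = (\<Sum>i\<in>UNIV. A $ fst p $ i * C $ i $ fst q) * (\<Sum>j\<in>UNIV. B $ snd p $ j * D $ j $ snd q)"
      by (simp add: sum_product sum.cartesian_product)
    finally show ?thesis by (simp add: matrix_matrix_mult_def kron_def)
  qed
  then show ?thesis by (simp add: vec_eq_iff)
qed

lemma kron_mat: "kron (mat c) (mat 1) = mat c"
  by (simp add: vec_eq_iff kron_def mat_def prod_eq_iff)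

lemma kron_add_left: "kron (A + B) C = kron A C + kron B C"
  and kron_scale_left: "kron (c *\<^sub>R A) C = c *\<^sub>R kron A C"
  by (simp_all add: vec_eq_iff kron_def algebra_simps)

lemma linear_kron_left: "linear (\<lambda>A. kron A C)"
  by (rule linearI) (simp_all add: kron_add_left kron_scale_left)

lemma trace_kron: "trace (kron A B) = trace A * trace B"
proof -
  have "trace (kron A B) = (\<Sum>(i, j)\<in>UNIV \<times> UNIV. A $ i $ i * B $ j $ j)"
    by (simp add: trace_def kron_def case_prod_beta)
  then show ?thesis by (simp add: trace_def sum_product sum.cartesian_product)
qed

lemma mat_vector_mult: "mat c *v w = c *s (w :: 'a::comm_semiring_1 ^ 'k)"
  by (simp add: vec_eq_iff matrix_vector_mult_def mat_def if_distrib[of "\<lambda>z. z * _"] cong: if_cong)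

section \<open>Eigenspinors\<close>

lemma inner_matrix_vector_transpose: "(B *v u) \<bullet> l = u \<bullet> (transpose B *v l)" for B :: "real ^ 'n ^ 'n"
  by (metis dot_lmul_matrix inner_commute transpose_matrix_vector)

lemma matrix_vector_mult_scaled_sum:
  "M *v (\<Sum>j\<in>J. c j *s w j) = (\<Sum>j\<in>J. c j *s (M *v w j))" for M :: "'a::field ^ 'k ^ 'l"
  by (induction J rule: infinite_finite_induct) (simp_all add: matrix_vector_right_distrib vector_scalar_commute)

lemma plane_wave_rotate: "plane_wave (B *v u) x = plane_wave u (transpose B *v x)" for B :: "real ^ 'n ^ 'n"
  by (simp only: plane_wave_def inner_matrix_vector_transpose)

lemma fourier_coeff_linear:
  assumes "finite J" "\<And>j. j \<in> J \<Longrightarrow> continuous_on UNIV (g j)"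
  shows "fourier_coeff A (\<lambda>x. \<Sum>j\<in>J. a j * g j x) u = (\<Sum>j\<in>J. a j * fourier_coeff A (g j) u)"
proof -
  have "fourier_coeff A (\<lambda>x. \<Sum>j\<in>J. a j * g j x) u
      = periodic_mean A (\<lambda>x. \<Sum>j\<in>J. a j * (g j x * plane_wave (- u) x))"
    by (simp add: fourier_coeff_def sum_distrib_right mult.assoc)
  also have "\<dots> = (\<Sum>j\<in>J. a j * fourier_coeff A (g j) u)"
    using assms by (subst periodic_mean_sum) (auto intro!: continuous_intros simp: periodic_mean_mult fourier_coeff_def)
  finally show ?thesis .
qed

section \<open>The spin character and the Dirac symbol\<close>

locale spin_data =
  fixes \<Gamma> :: "'n::{finite,linorder} isom set"
    and \<epsilon> :: "'n isom \<Rightarrow> 'n clifford"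
    and L :: "'n clifford \<Rightarrow> complex ^ 's ^ 's"
    and \<rho> :: "'n isom \<Rightarrow> complex ^ 'v ^ 'v"
  assumes bieberbach: "bieberbach_group \<Gamma>"
    and spin: "spin_structure \<Gamma> \<epsilon>"
    and rep: "clifford_rep L"
    and rho_hom: "\<rho> \<in> hom (group_of \<Gamma>) unitary_group"
    and rho_trivial: "\<forall>l \<in> trans_lattice \<Gamma>. \<rho> (translation l) = mat 1"
begin

abbreviation "\<Lambda> \<equiv> trans_lattice \<Gamma>"
abbreviation "\<delta> \<equiv> spin_char \<epsilon>"
abbreviation "shell \<equiv> dual_shell \<Gamma> \<epsilon>"
abbreviation "twisted \<equiv> twisted_spinors L \<Gamma> \<epsilon> \<rho>"
abbreviation "eigenspinors \<equiv> dirac_eigenspace L \<Gamma> \<epsilon> \<rho>"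
abbreviation "eigen_mult \<equiv> dirac_mult L \<Gamma> \<epsilon> \<rho>"
abbreviation "eta \<equiv> eta_term L \<Gamma> \<epsilon> \<rho>"

definition spinor_action :: "'n isom \<Rightarrow> complex ^ ('s \<times> 'v) ^ ('s \<times> 'v)" where
  "spinor_action g = kron (L (\<epsilon> g)) (\<rho> g)"

definition clifford_mult :: "(real, 'n) vec \<Rightarrow> complex ^ ('s \<times> 'v) ^ ('s \<times> 'v)" where
  "clifford_mult u = kron (L (cvec u)) (mat 1)"

lemma sub: "subgroup \<Gamma> Isom"
  using bieberbach by (simp add: bieberbach_group_def)

lemma orthogonal: "(B, b) \<in> \<Gamma> \<Longrightarrow> orthogonal_matrix B"
  using subgroup.mem_carrier[OF sub] by (auto simp: Isom_def)

lemma mult_eq: "(B, b) \<odot> (C, c) = (B ** C, c + transpose C *v b)"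
  by (simp add: Isom_def)

lemma mult_closed: "g \<in> \<Gamma> \<Longrightarrow> h \<in> \<Gamma> \<Longrightarrow> g \<odot> h \<in> \<Gamma>"
  using subgroup.m_closed[OF sub] .

lemma eps_Spin: "g \<in> \<Gamma> \<Longrightarrow> \<epsilon> g \<in> carrier Spin"
  using spin by (auto simp: spin_structure_def hom_def)

lemma eps_mult: "g \<in> \<Gamma> \<Longrightarrow> h \<in> \<Gamma> \<Longrightarrow> \<epsilon> (g \<odot> h) = \<epsilon> g * \<epsilon> h"
  using spin by (auto simp: spin_structure_def hom_def Spin_simps)

lemma eps_vec: "g \<in> \<Gamma> \<Longrightarrow> \<epsilon> g * cvec y = cvec (fst g *v y) * \<epsilon> g"
  using spin spin_mu_iff[OF eps_Spin] by (auto simp: spin_structure_def)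

lemma spinor_action_mult:
  "g \<in> \<Gamma> \<Longrightarrow> h \<in> \<Gamma> \<Longrightarrow> spinor_action (g \<odot> h) = spinor_action g ** spinor_action h"
  using rho_hom by (simp add: spinor_action_def kron_mult eps_mult clifford_rep_simps[OF rep] hom_def unitary_group_def)

lemma clifford_mult_square: "clifford_mult u ** clifford_mult u = mat (- of_real ((norm u)\<^sup>2))"
proof -
  have "L (- of_real ((norm u)\<^sup>2)) = mat (- of_real ((norm u)\<^sup>2))"
    using rep_of_real[OF rep, of "- (norm u)\<^sup>2"] by simp
  then show ?thesis
    by (simp add: clifford_mult_def kron_mult cvec_square kron_mat flip: clifford_rep_simps(2)[OF rep])
qed

lemma clifford_mult_square_vector:
  "clifford_mult u *v (clifford_mult u *v a) = (- of_real ((norm u)\<^sup>2)) *s a"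
  by (simp only: matrix_vector_mul_assoc clifford_mult_square mat_vector_mult)

lemma clifford_mult_spinor_action:
  "g \<in> \<Gamma> \<Longrightarrow> clifford_mult (fst g *v u) ** spinor_action g = spinor_action g ** clifford_mult u"
  using eps_vec[of g u] by (simp add: clifford_mult_def spinor_action_def kron_mult flip: clifford_rep_simps(2)[OF rep])

lemma clifford_mult_sum: "clifford_mult u = (\<Sum>i\<in>UNIV. (u $ i) *\<^sub>R clifford_mult (axis i 1))"
proof -
  have "linear (\<lambda>u. kron (L (cvec u)) (mat 1 :: complex ^ 'v ^ 'v))"
    by (intro linear_compose[OF linear_cvec, unfolded o_def] linear_compose[OF _ linear_kron_left, unfolded o_def])
      (use rep in \<open>simp add: clifford_rep_def linear_compose[OF linear_cvec, unfolded o_def]\<close>)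
  moreover have "u = (\<Sum>i\<in>UNIV. (u $ i) *\<^sub>R axis i 1)"
    using basis_expansion[of u] by (simp add: scalar_mult_eq_scaleR)
  ultimately show ?thesis
    unfolding clifford_mult_def by (metis (no_types, lifting) linear_scale linear_sum sum.cong)
qed

text \<open>A translation has trivial rotational part, so its lift commutes with all vectors and is
  a sign. This is what makes the \<open>THE\<close> in \<open>spin_char\<close> meaningful.\<close>

lemma eps_translation:
  assumes "l \<in> \<Lambda>"
  shows "\<epsilon> (translation l) = of_real (\<delta> l)" and "(\<delta> l)\<^sup>2 = 1"
proof -
  have t: "translation l \<in> \<Gamma>" using assms by (simp add: trans_lattice_def)
  have "\<epsilon> (translation l) * cvec v = cvec v * \<epsilon> (translation l)" for v
    using eps_vec[OF t, of v] by (simp add: translation_def)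
  then obtain c where c: "\<epsilon> (translation l) = of_real c" "c\<^sup>2 = 1"
    using Spin_central_sign[OF rep eps_Spin[OF t]] by metis
  then have "\<delta> l = c"
    unfolding spin_char_def by (intro the_equality) auto
  then show "\<epsilon> (translation l) = of_real (\<delta> l)" "(\<delta> l)\<^sup>2 = 1" using c by auto
qed

lemma spinor_action_translation:
  assumes "l \<in> \<Lambda>"
  shows "spinor_action (translation l) = mat (of_real (\<delta> l))"
  using assms rho_trivial by (simp add: spinor_action_def eps_translation(1) rep_of_real[OF rep] kron_mat)

lemma trans_lattice_add:
  assumes "l \<in> \<Lambda>" "k \<in> \<Lambda>"
  shows "l + k \<in> \<Lambda>" and "\<delta> (l + k) = \<delta> l * \<delta> k"
proof -
  have e: "translation l \<odot> translation k = translation (l + k)"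
    by (simp add: translation_def mult_eq add.commute)
  have t: "translation l \<in> \<Gamma>" "translation k \<in> \<Gamma>" using assms by (auto simp: trans_lattice_def)
  show lk: "l + k \<in> \<Lambda>" using mult_closed[OF t] by (simp add: e trans_lattice_def)
  have "of_real (\<delta> (l + k)) = (of_real (\<delta> l * \<delta> k) :: 'n clifford)"
    using eps_mult[OF t] unfolding e by (simp add: eps_translation(1)[OF lk] eps_translation(1) assms)
  then show "\<delta> (l + k) = \<delta> l * \<delta> k" by (simp only: of_real_eq_iff)
qed

text \<open>Conjugating a translation by \<open>(B, b)\<close> rotates its vector by
  \<open>transpose B\<close>. Lifts of translations are scalars and do not change under
  conjugation.\<close>

lemma trans_lattice_rotate:
  assumes g: "(B, b) \<in> \<Gamma>" and l: "l \<in> \<Lambda>"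
  shows "transpose B *v l \<in> \<Lambda>" and "\<delta> (transpose B *v l) = \<delta> l"
proof -
  let ?l = "transpose B *v l"
  note B = orthogonal[OF g]
  have t: "translation l \<in> \<Gamma>" using l by (simp add: trans_lattice_def)
  have e: "translation l \<odot> (B, b) = (B, b) \<odot> translation ?l"
    by (simp add: translation_def mult_eq add.commute)
  have "(transpose B, - (B *v b)) \<odot> ((B, b) \<odot> translation ?l) = translation ?l"
    using B by (simp add: translation_def mult_eq orthogonal_matrix_transpose_mult matrix_vector_right_distrib
        linear_neg[OF matrix_vector_mul_linear] orthogonal_transpose_vector)
  then have t': "translation ?l \<in> \<Gamma>"
    using mult_closed[OF isom_inverse[OF sub g] mult_closed[OF t g]] by (simp only: e)
  then show l': "?l \<in> \<Lambda>" by (simp add: trans_lattice_def)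
  have "\<epsilon> (translation l) * \<epsilon> (B, b) = \<epsilon> (B, b) * \<epsilon> (translation ?l)"
    using e eps_mult[OF t g] eps_mult[OF g t'] by simp
  then have "\<delta> l *\<^sub>R \<epsilon> (B, b) = \<delta> ?l *\<^sub>R \<epsilon> (B, b)"
    by (simp add: eps_translation(1) l l' of_real_def)
  then have "\<delta> l *\<^sub>R (\<epsilon> (B, b) * inv\<^bsub>Spin\<^esub> (\<epsilon> (B, b))) = \<delta> ?l *\<^sub>R (\<epsilon> (B, b) * inv\<^bsub>Spin\<^esub> (\<epsilon> (B, b)))"
    by (metis mult_scaleR_left)
  then show "\<delta> ?l = \<delta> l"
    unfolding Spin_inverse(2)[OF eps_Spin[OF g]] by (simp flip: of_real_def)
qed

text \<open>Doubling a basis of translations makes the character of the spin structure trivial, so that all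
  twisted spinors become periodic.\<close>

lemma period_matrix:
  obtains A :: "((real, 'n) vec, 'n) vec" where "invertible A" "\<And>i. column i A \<in> \<Lambda>"
    "\<And>i. \<delta> (column i A) = 1"
proof -
  obtain A :: "((real, 'n) vec, 'n) vec" where A: "invertible A" "\<And>i. column i A \<in> \<Lambda>"
    using bieberbach_lattice_basis[OF bieberbach] by blast
  have c: "column i (2 *\<^sub>R A) = column i A + column i A" for i
    by (simp add: column_def vec_eq_iff)
  have "invertible (2 *\<^sub>R A)"
    using invertible_matrix_inv[OF A(1)] unfolding invertible_def
    by (intro exI[of _ "(1/2) *\<^sub>R matrix_inv A"]) (simp add: matrix_scalar_ac flip: scalar_matrix_assoc)
  moreover have "column i (2 *\<^sub>R A) \<in> \<Lambda>" for i
    unfolding c by (rule trans_lattice_add(1)[OF A(2) A(2)])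
  moreover have "\<delta> (column i (2 *\<^sub>R A)) = 1" for i
    unfolding c trans_lattice_add(2)[OF A(2) A(2)] using eps_translation(2)[OF A(2)] by (simp add: power2_eq_square)
  ultimately show ?thesis using that by blast
qed

lemma dual_shell_iff:
  "u \<in> shell \<mu> \<longleftrightarrow> norm u = \<mu> \<and> (\<forall>l\<in>\<Lambda>. of_real (\<delta> l) = plane_wave u l)"
  by (simp add: dual_shell_def plane_wave_def)

lemma dual_shell_rotate:
  assumes g: "(B, b) \<in> \<Gamma>" and u: "u \<in> shell \<mu>"
  shows "B *v u \<in> shell \<mu>"
  using u trans_lattice_rotate[OF g] norm_orthogonal_mult[OF orthogonal[OF g]]
  unfolding dual_shell_iff plane_wave_rotate by metis

lemma twisted_spinors_iff:
  "f \<in> twisted \<longleftrightarrow> smooth f \<and> (\<forall>g\<in>\<Gamma>. \<forall>x. f (iso_act g x) = spinor_action g *v f x)"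
  by (simp add: twisted_spinors_def spinor_action_def)

lemma twisted_spinors_translate:
  assumes "f \<in> twisted" "l \<in> \<Lambda>"
  shows "f (x + l) = of_real (\<delta> l) *s f x"
proof -
  have "translation l \<in> \<Gamma>" using assms(2) by (simp add: trans_lattice_def)
  then have "f (iso_act (translation l) x) = spinor_action (translation l) *v f x"
    using assms(1) by (simp add: twisted_spinors_iff)
  then show ?thesis
    using assms(2) by (simp add: spinor_action_translation mat_vector_mult) (simp add: iso_act_def translation_def)
qed

lemma dirac_eq: "dirac L f x = (\<Sum>i\<in>UNIV. clifford_mult (axis i 1) *v partial_deriv i f x)"
  by (simp add: dirac_def clifford_mult_def)

lemma clifford_mult_vector_sum:
  "clifford_mult u *v a = (\<Sum>i\<in>UNIV. of_real (u $ i) *s (clifford_mult (axis i 1) *v a))"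
proof -
  have "(\<Sum>i\<in>UNIV. (u $ i) *\<^sub>R clifford_mult (axis i 1)) *v a = (\<Sum>i\<in>UNIV. ((u $ i) *\<^sub>R clifford_mult (axis i 1)) *v a)"
    by (simp add: matrix_vector_mult_def vec_eq_iff sum_distrib_right) (subst sum.swap, simp)
  also have "\<dots> = (\<Sum>i\<in>UNIV. of_real (u $ i) *s (clifford_mult (axis i 1) *v a))"
    by (intro sum.cong) (simp_all add: matrix_vector_mult_def vec_eq_iff sum_distrib_left scaleR_conv_of_real[where 'a = complex] mult.assoc)
  finally show ?thesis by (simp flip: clifford_mult_sum)
qed

text \<open>On a wave of frequency \<open>u\<close> the Dirac operator is its symbol, Clifford
  multiplication by \<open>2 \<pi> \<i> u\<close>.\<close>

lemma dirac_wave_sum: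
  "dirac L (wave_sum J k w) x = wave_sum J k (\<lambda>j. (2 * pi * \<i>) *s (clifford_mult (k j) *v w j)) x"
proof -
  have "dirac L (wave_sum J k w) x = (\<Sum>i\<in>UNIV. \<Sum>j\<in>J. plane_wave (k j) x *s
      ((2 * pi * \<i>) *s (of_real (k j $ i) *s (clifford_mult (axis i 1) *v w j))))"
    unfolding dirac_eq partial_deriv_wave_sum wave_sum_def
    by (simp add: matrix_vector_mult_scaled_sum vector_scalar_commute mult.assoc)
  also have "\<dots> = wave_sum J k (\<lambda>j. (2 * pi * \<i>) *s (clifford_mult (k j) *v w j)) x"
    unfolding wave_sum_def clifford_mult_vector_sum[of "k _"]
    by (subst sum.swap) (simp add: vec.scale_sum_right)
  finally show ?thesis .
qed

end

section \<open>Fourier coefficients of eigenspinors\<close>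

locale spin_lattice = spin_data \<Gamma> \<epsilon> L \<rho>
  for \<Gamma> :: "'n::{finite,linorder} isom set"
    and \<epsilon> :: "'n isom \<Rightarrow> 'n clifford"
    and L :: "'n clifford \<Rightarrow> complex ^ 's ^ 's"
    and \<rho> :: "'n isom \<Rightarrow> complex ^ 'v ^ 'v" +
  fixes A :: "((real, 'n) vec, 'n) vec"
  assumes invertible: "invertible A"
    and column_lattice: "column i A \<in> \<Lambda>"
    and column_char: "\<delta> (column i A) = 1"
begin

definition coeff :: "((real, 'n) vec \<Rightarrow> complex ^ ('s \<times> 'v)) \<Rightarrow> (real, 'n) vec \<Rightarrow> complex ^ ('s \<times> 'v)" where
  "coeff f u = (\<chi> p. fourier_coeff A (\<lambda>x. f x $ p) u)"

text \<open>The columns of \<open>A\<close> generate a sublattice on which the character is trivial;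
  its dual may be larger than the set of frequencies in all shells.\<close>

lemma dual_shell_subset: "shell \<mu> \<subseteq> dual_lattice A"
proof
  fix u assume "u \<in> shell \<mu>"
  then have "plane_wave u (column i A) = 1" for i
    using column_lattice column_char by (metis dual_shell_iff of_real_1)
  then show "u \<in> dual_lattice A" by (simp add: dual_lattice_def plane_wave_eq_1_iff)
qed

lemma dual_shell_finite: "finite (shell \<mu>)"
  by (rule finite_subset[OF _ finite_dual_lattice_ball[OF invertible, of \<mu>]])
    (use dual_shell_subset in \<open>auto simp: dual_shell_iff\<close>)

lemma dual_shell_card: "card (shell \<mu>) \<le> card {u \<in> dual_lattice A. norm u = \<mu>}"
proof (rule card_mono)
  show "finite {u \<in> dual_lattice A. norm u = \<mu>}"
    by (rule finite_subset[OF _ finite_dual_lattice_ball[OF invertible, of \<mu>]]) auto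
qed (use dual_shell_subset in \<open>auto simp: dual_shell_iff\<close>)

lemma twisted_spinors_periodic:
  "f \<in> twisted \<Longrightarrow> lattice_periodic A f"
  using twisted_spinors_translate[OF _ column_lattice] column_char by (simp add: lattice_periodic_def)

context
  fixes f \<nu>
  assumes f: "f \<in> eigenspinors \<nu>"
begin

lemma eigenspinor_facts:
  "f \<in> twisted" "smooth f" "dirac L f x = of_real \<nu> *s f x" "lattice_periodic A f"
  "continuous_on UNIV (\<lambda>x. f x $ p)" "lattice_periodic A (\<lambda>x. f x $ p)"
proof -
  show tw: "f \<in> twisted" and "dirac L f x = of_real \<nu> *s f x"
    using f by (auto simp: dirac_eigenspace_def)
  then show sm: "smooth f" by (simp add: twisted_spinors_iff)
  show "lattice_periodic A f" by (rule twisted_spinors_periodic[OF tw])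
  then show "lattice_periodic A (\<lambda>x. f x $ p)" by (simp add: lattice_periodic_def)
  show "continuous_on UNIV (\<lambda>x. f x $ p)" by (intro continuous_on_component smooth_partial_deriv(2)[OF sm])
qed

lemma coeff_eigen:
  assumes u: "u \<in> dual_lattice A"
  shows "(2 * pi * \<i>) *s (clifford_mult u *v coeff f u) = of_real \<nu> *s coeff f u"
proof -
  have "((2 * pi * \<i>) *s (clifford_mult u *v coeff f u)) $ p = (of_real \<nu> *s coeff f u) $ p" for p
  proof -
    let ?M = "\<lambda>i. clifford_mult (axis i 1)"
    have "of_real \<nu> * fourier_coeff A (\<lambda>x. f x $ p) u = fourier_coeff A (\<lambda>x. of_real \<nu> * (f x $ p)) u"
      using fourier_coeff_linear[of "{()}" "\<lambda>_ x. f x $ p" A "\<lambda>_. of_real \<nu>" u] eigenspinor_facts(5) by simp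
    also have "(\<lambda>x. of_real \<nu> * (f x $ p)) = (\<lambda>x. dirac L f x $ p)"
      by (simp add: eigenspinor_facts(3))
    also have "\<dots> = (\<lambda>x. \<Sum>(i, q)\<in>UNIV \<times> UNIV. ?M i $ p $ q * partial_deriv i f x $ q)"
      by (simp add: dirac_eq matrix_vector_mult_def sum.cartesian_product fun_eq_iff)
    also have "fourier_coeff A \<dots> u = (\<Sum>(i, q)\<in>UNIV \<times> UNIV. ?M i $ p $ q * fourier_coeff A (\<lambda>x. partial_deriv i f x $ q) u)"
      unfolding case_prod_beta
      by (rule fourier_coeff_linear) (auto intro!: continuous_on_component smooth_partial_deriv(3) eigenspinor_facts(2))
    also have "\<dots> = (\<Sum>i\<in>UNIV. \<Sum>q\<in>UNIV. ?M i $ p $ q * (2 * pi * \<i> * of_real (u $ i) * coeff f u $ q))"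
      unfolding sum.cartesian_product
      by (intro sum.cong) (auto simp: fourier_coeff_partial_deriv[OF invertible eigenspinor_facts(2,4) u] coeff_def)
    also have "\<dots> = ((2 * pi * \<i>) *s (clifford_mult u *v coeff f u)) $ p"
      unfolding clifford_mult_vector_sum[of u]
      by (simp add: matrix_vector_mult_def sum_distrib_left mult_ac)
    finally show ?thesis by (simp add: coeff_def)
  qed
  then show ?thesis by (simp add: vec_eq_iff)
qed

text \<open>The eigenvalue equation applied twice, where Clifford multiplication squares to minus
  the squared length.\<close>

lemma coeff_norm:
  assumes u: "u \<in> dual_lattice A" and nz: "coeff f u \<noteq> 0"
  shows "2 * pi * norm u = \<bar>\<nu>\<bar>"
proof -
  let ?c = "coeff f u" and ?d = "2 * pi * \<i>"
  have "?d *s (clifford_mult u *v (?d *s (clifford_mult u *v ?c))) = ?d *s (clifford_mult u *v (of_real \<nu> *s ?c))"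
    using coeff_eigen[OF u] by simp
  then have "(?d * ?d) *s ((- of_real ((norm u)\<^sup>2)) *s ?c) = of_real \<nu> *s (?d *s (clifford_mult u *v ?c))"
    unfolding vector_scalar_commute clifford_mult_square_vector
    by (simp only: vector_smult_assoc mult.assoc mult.commute[of "of_real \<nu>"])
  then have "(?d * ?d * (- of_real ((norm u)\<^sup>2))) *s ?c = (of_real \<nu> * of_real \<nu>) *s ?c"
    unfolding coeff_eigen[OF u] by (simp only: vector_smult_assoc)
  then have "?d * ?d * (- of_real ((norm u)\<^sup>2)) = of_real \<nu> * of_real \<nu>"
    using nz by (simp only: vec.scale_right_imp_eq[OF nz])
  moreover have "?d * ?d * (- of_real ((norm u)\<^sup>2)) = of_real ((2 * pi * norm u)\<^sup>2)"
    by (simp add: power2_eq_square mult_ac)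
  ultimately have "complex_of_real ((2 * pi * norm u)\<^sup>2) = of_real (\<nu>\<^sup>2)"
    by (simp add: power2_eq_square)
  then have "(2 * pi * norm u)\<^sup>2 = \<bar>\<nu>\<bar>\<^sup>2" by (simp only: of_real_eq_iff power2_abs)
  then show ?thesis by (subst (asm) power2_eq_iff_nonneg) auto
qed

text \<open>Translation by \<open>l\<close> preserves the mean of \<open>f\<close> times the
  conjugate wave but multiplies it by \<open>\<delta> l\<close> and the phase of the wave. This
  singles out the frequencies that fit the spin structure.\<close>

lemma coeff_char:
  assumes u: "u \<in> dual_lattice A" and nz: "coeff f u \<noteq> 0" and l: "l \<in> \<Lambda>"
  shows "of_real (\<delta> l) = plane_wave u l"
proof -
  obtain p where p: "coeff f u $ p \<noteq> 0" using nz by (auto simp: vec_eq_iff)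
  let ?g = "\<lambda>x. f x $ p * plane_wave (- u) x"
  have "of_real (\<delta> l) * plane_wave (- u) l * periodic_mean A ?g = periodic_mean A (\<lambda>x. ?g (x + l))"
    using twisted_spinors_translate[OF eigenspinor_facts(1) l]
    by (simp add: plane_wave_add_right mult_ac flip: periodic_mean_mult)
  also have "\<dots> = periodic_mean A ?g"
    using lattice_periodic_plane_wave[of A "- u"] u eigenspinor_facts(6)
    by (intro periodic_mean_translate[OF invertible] continuous_intros eigenspinor_facts(5))
      (simp add: lattice_periodic_def dual_lattice_minus)
  finally have "of_real (\<delta> l) * plane_wave (- u) l = 1"
    using p by (simp add: coeff_def fourier_coeff_def)
  then show ?thesis
    using plane_wave_inverse[of u l] by (metis mult.assoc mult.commute mult_1_right)
qed

lemma eigenspinor_expansion: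
  assumes \<mu>: "\<bar>\<nu>\<bar> = 2 * pi * \<mu>"
  shows "f x = (\<Sum>u\<in>shell \<mu>. plane_wave u x *s coeff f u)"
proof -
  have "f x $ p = (\<Sum>u\<in>shell \<mu>. plane_wave u x *s coeff f u) $ p" for p
  proof -
    have "f x $ p = (\<Sum>u\<in>shell \<mu>. fourier_coeff A (\<lambda>x. f x $ p) u * plane_wave u x)"
    proof (rule fourier_finite_expansion[OF invertible eigenspinor_facts(5,6) dual_shell_finite dual_shell_subset])
      fix u assume u: "u \<in> dual_lattice A - shell \<mu>"
      have "coeff f u = 0"
      proof (rule ccontr)
        assume "coeff f u \<noteq> 0"
        then have "u \<in> shell \<mu>"
          using coeff_norm[of u] coeff_char[of u] u \<mu> by (simp add: dual_shell_iff)
        then show False using u by simp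
      qed
      then have "coeff f u $ p = 0" by simp
      then show "fourier_coeff A (\<lambda>x. f x $ p) u = 0" by (simp add: coeff_def)
    qed
    then show ?thesis by (simp add: coeff_def mult.commute)
  qed
  then show ?thesis by (simp add: vec_eq_iff)
qed

end

end

lemma sum_fun_apply: "(\<Sum>b\<in>B. g b) x = (\<Sum>b\<in>B. g b x)"
  by (induction B rule: infinite_finite_induct) (auto simp: zero_fun_def plus_fun_def)

lemma matrix_vector_mult_axis_nth: "(M *v axis p 1) $ q = M $ q $ p" for M :: "'a::semiring_1 ^ 'k ^ 'l"
  by (simp add: matrix_vector_mult_def axis_def if_distrib[of "\<lambda>z. _ * z"] cong: if_cong)

lemma trace_mat_mult: "trace (mat c ** M) = c * trace M" for M :: "'a::comm_semiring_1 ^ 'k ^ 'k"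
proof -
  have "(mat c ** M) $ i $ i = c * M $ i $ i" for i
    by (simp add: matrix_matrix_mult_def mat_def if_distrib[of "\<lambda>z. z * _"] cong: if_cong)
  then show ?thesis by (simp add: trace_def sum_distrib_left)
qed

lemma trace_mult_mat_mult: "trace (K ** (mat c ** M)) = c * trace (K ** M)"
  for M :: "'a::comm_semiring_1 ^ 'k ^ 'k"
  by (metis matrix_mul_assoc trace_mat_mult trace_mul_sym)

section \<open>Averaging over a transversal\<close>

locale spin_transversal = spin_lattice \<Gamma> \<epsilon> L \<rho> A
  for \<Gamma> :: "'n::{finite,linorder} isom set"
    and \<epsilon> :: "'n isom \<Rightarrow> 'n clifford"
    and L :: "'n clifford \<Rightarrow> complex ^ 's ^ 's"
    and \<rho> :: "'n isom \<Rightarrow> complex ^ 'v ^ 'v"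
    and A +
  fixes R :: "'n isom set"
  assumes transversal: "transversal \<Gamma> R"
begin

lemma R_subset: "g \<in> R \<Longrightarrow> g \<in> \<Gamma>"
  using transversal by (auto simp: transversal_def)

lemma fst_mult: "fst (g \<odot> h) = fst g ** fst h"
  by (cases g; cases h) (simp add: mult_eq)

text \<open>Cosets of the translation lattice are the fibres of the rotational part, so a
  transversal picks one element for each holonomy matrix.\<close>

lemma coset_eq:
  assumes "g \<in> \<Gamma>"
  shows "(translation ` \<Lambda>) #>\<^bsub>group_of \<Gamma>\<^esub> g = {h \<in> \<Gamma>. fst h = fst g}"
proof -
  obtain B b where g: "g = (B, b)" by (cases g)
  have gG: "(B, b) \<in> \<Gamma>" using assms g by simp
  note B = orthogonal[OF gG]
  have "h \<in> \<Gamma> \<and> fst h = B \<longleftrightarrow> (\<exists>l\<in>\<Lambda>. h = translation l \<odot> (B, b))" for h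
  proof
    assume h: "h \<in> \<Gamma> \<and> fst h = B"
    then obtain c where hc: "h = (B, c)" by (cases h) auto
    have "(B, c) \<odot> (transpose B, - (B *v b)) = translation (B *v (c - b))"
      using B by (simp add: mult_eq translation_def orthogonal_matrix_transpose_mult matrix_vector_mult_diff_distrib)
    then have "B *v (c - b) \<in> \<Lambda>"
      using mult_closed[OF _ isom_inverse[OF sub gG], of h] h hc by (simp add: trans_lattice_def)
    moreover have "h = translation (B *v (c - b)) \<odot> (B, b)"
      using B by (simp add: hc mult_eq translation_def orthogonal_transpose_vector)
    ultimately show "\<exists>l\<in>\<Lambda>. h = translation l \<odot> (B, b)" by blast
  next
    assume "\<exists>l\<in>\<Lambda>. h = translation l \<odot> (B, b)"
    then obtain l where l: "translation l \<in> \<Gamma>" "h = translation l \<odot> (B, b)"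
      by (auto simp: trans_lattice_def)
    then show "h \<in> \<Gamma> \<and> fst h = B"
      using mult_closed[OF l(1) gG] by (simp add: mult_eq translation_def)
  qed
  then show ?thesis by (auto simp: r_coset_def g)
qed

lemma R_unique:
  assumes "g \<in> \<Gamma>"
  shows "\<exists>!h. h \<in> R \<and> fst h = fst g"
proof -
  have "(translation ` \<Lambda>) #>\<^bsub>group_of \<Gamma>\<^esub> g \<in> rcosets\<^bsub>group_of \<Gamma>\<^esub> (translation ` \<Lambda>)"
    using assms by (auto simp: RCOSETS_def)
  then have "\<exists>!h. h \<in> R \<inter> {h \<in> \<Gamma>. fst h = fst g}"
    using transversal unfolding transversal_def coset_eq[OF assms, symmetric] by blast
  then show ?thesis using R_subset by auto
qed

lemma bij_betw_R: "bij_betw fst R (holonomy \<Gamma>)"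
proof (rule bij_betwI')
  show "fst g = fst h \<longleftrightarrow> g = h" if "g \<in> R" "h \<in> R" for g h
    using R_unique[OF R_subset[OF that(1)]] that by metis
  show "fst g \<in> holonomy \<Gamma>" if "g \<in> R" for g
    using R_subset[OF that] by (simp add: holonomy_def)
  show "\<exists>g\<in>R. B = fst g" if B: "B \<in> holonomy \<Gamma>" for B
  proof -
    obtain g where "g \<in> \<Gamma>" "B = fst g" using B by (auto simp: holonomy_def)
    then show ?thesis using R_unique by metis
  qed
qed

lemma finite_R: "finite R"
  using bij_betw_finite[OF bij_betw_R] bieberbach_holonomy_finite[OF bieberbach] by simp

lemma card_R: "card R = card (holonomy \<Gamma>)"
  by (rule bij_betw_same_card[OF bij_betw_R])

lemma card_R_pos: "card R > 0"
proof -
  have "(mat 1, 0) \<in> \<Gamma>" using subgroup_actD(2)[OF sub] .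
  then have "R \<noteq> {}" using R_unique by blast
  then show ?thesis using finite_R by (simp add: card_gt_0_iff)
qed

text \<open>Left multiplication by \<open>k\<close> leaves \<open>R\<close> but permutes the
  rotational parts. It can be undone by \<open>\<phi>\<close>, which returns to the representative
  with the same rotational part, where \<open>G\<close> has the same value.\<close>

lemma sum_R_mult:
  fixes G :: "'n isom \<Rightarrow> 'b::comm_monoid_add"
  assumes G: "\<And>g h. g \<in> \<Gamma> \<Longrightarrow> h \<in> \<Gamma> \<Longrightarrow> fst g = fst h \<Longrightarrow> G g = G h" and k: "k \<in> \<Gamma>"
  shows "(\<Sum>g\<in>R. G (k \<odot> g)) = (\<Sum>g\<in>R. G g)"
proof -
  define \<phi> where "\<phi> g = (THE h. h \<in> R \<and> fst h = fst (k \<odot> g))" for g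
  have \<phi>: "\<phi> g \<in> R" "fst (\<phi> g) = fst k ** fst g" if "g \<in> R" for g
    using theI'[OF R_unique[OF mult_closed[OF k R_subset[OF that]]]]
    by (simp_all add: \<phi>_def fst_mult)
  have ok: "orthogonal_matrix (fst k)" using orthogonal[of "fst k" "snd k"] k by simp
  have inj: "inj_on \<phi> R"
  proof (rule inj_onI)
    fix g h assume gh: "g \<in> R" "h \<in> R" "\<phi> g = \<phi> h"
    then have "fst k ** fst g = fst k ** fst h" using \<phi>(2) by metis
    then have "transpose (fst k) ** (fst k ** fst g) = transpose (fst k) ** (fst k ** fst h)" by simp
    then have "fst g = fst h" by (simp add: matrix_mul_assoc orthogonal_matrix_transpose_mult[OF ok])
    then show "g = h" using R_unique[OF R_subset[OF gh(1)]] gh by metis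
  qed
  have "\<phi> ` R = R" by (rule endo_inj_surj[OF finite_R _ inj]) (use \<phi>(1) in blast)
  then have "bij_betw \<phi> R R" using inj by (simp add: bij_betw_def)
  then have "(\<Sum>g\<in>R. G g) = (\<Sum>g\<in>R. G (\<phi> g))" by (rule sum.reindex_bij_betw[symmetric])
  also have "\<dots> = (\<Sum>g\<in>R. G (k \<odot> g))"
  proof (intro sum.cong refl G)
    fix g assume g: "g \<in> R"
    show "\<phi> g \<in> \<Gamma>" using \<phi>(1)[OF g] R_subset by blast
    show "k \<odot> g \<in> \<Gamma>" using mult_closed[OF k R_subset[OF g]] .
    show "fst (\<phi> g) = fst (k \<odot> g)"
      using \<phi>(2)[OF g] by (simp add: fst_mult)
  qed
  finally show ?thesis ..
qed

definition iso_inv :: "'n isom \<Rightarrow> (real, 'n) vec \<Rightarrow> (real, 'n) vec" where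
  "iso_inv g x = transpose (fst g) *v x - snd g"

text \<open>The projection onto equivariant functions; \<open>iso_inv g\<close> is the inverse of
  the action of \<open>g\<close>.\<close>

definition average :: "((real, 'n) vec \<Rightarrow> complex ^ ('s \<times> 'v)) \<Rightarrow> (real, 'n) vec \<Rightarrow> complex ^ ('s \<times> 'v)" where
  "average F x = (1 / of_nat (card R)) *s (\<Sum>g\<in>R. spinor_action g *v F (iso_inv g x))"

lemma iso_act_iso_inv:
  assumes "g \<in> \<Gamma>"
  shows "iso_act g (iso_inv g x) = x"
proof -
  have "orthogonal_matrix (fst g)" using orthogonal[of "fst g" "snd g"] assms by simp
  then show ?thesis by (simp add: iso_act_def iso_inv_def orthogonal_transpose_vector)
qed

lemma average_equivariant:
  assumes F: "\<And>l x. l \<in> \<Lambda> \<Longrightarrow> F (x + l) = of_real (\<delta> l) *s F x" and k: "k \<in> \<Gamma>"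
  shows "average F (iso_act k x) = spinor_action k *v average F x"
proof -
  define G where "G y g = spinor_action g *v F (iso_inv g y)" for y g
  \<comment> \<open>Changing the representative by a translation \<open>l\<close> brings in
    \<open>\<delta> l\<close> twice, from the spinor action and from \<open>F\<close>; the square is
    1.\<close>
  have G: "G y g = G y h" if gh: "g \<in> \<Gamma>" "h \<in> \<Gamma>" "fst g = fst h" for y g h
  proof -
    obtain B b c where eq: "g = (B, b)" "h = (B, c)" using gh(3) by (cases g; cases h) auto
    have B: "orthogonal_matrix B" using orthogonal gh(1) eq by blast
    define l where "l = b - c"
    have "(transpose B, - (B *v c)) \<odot> (B, b) = translation l"
      using B by (simp add: mult_eq translation_def l_def orthogonal_matrix_transpose_mult
          linear_neg[OF matrix_vector_mul_linear] orthogonal_transpose_vector)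
    then have l: "l \<in> \<Lambda>"
      using mult_closed[OF isom_inverse[OF sub, of B c], of "(B, b)"] gh eq by (simp add: trans_lattice_def)
    then have t: "translation l \<in> \<Gamma>" by (simp add: trans_lattice_def)
    have "g = h \<odot> translation l" by (simp add: eq mult_eq translation_def l_def)
    then have "spinor_action g = spinor_action h ** mat (of_real (\<delta> l))"
      using spinor_action_mult[OF gh(2) t] by (simp add: spinor_action_translation[OF l])
    moreover have "iso_inv h y = iso_inv g y + l" by (simp add: iso_inv_def eq l_def)
    moreover have "complex_of_real (\<delta> l) * of_real (\<delta> l) = 1"
      using eps_translation(2)[OF l] by (metis of_real_1 of_real_mult power2_eq_square)
    ultimately show ?thesis
      by (simp add: G_def F[OF l] vector_scalar_commute mat_vector_mult flip: matrix_vector_mul_assoc)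
  qed
  have "(\<Sum>g\<in>R. G (iso_act k x) g) = (\<Sum>g\<in>R. G (iso_act k x) (k \<odot> g))"
    by (rule sum_R_mult[symmetric, OF G k])
  also have "\<dots> = (\<Sum>g\<in>R. spinor_action k *v G x g)"
  proof (intro sum.cong refl)
    fix g assume "g \<in> R"
    then have g: "g \<in> \<Gamma>" by (rule R_subset)
    obtain B b C c where eq: "k = (B, b)" "g = (C, c)" by (cases k; cases g)
    have B: "orthogonal_matrix B" using orthogonal k eq by blast
    have "iso_inv (k \<odot> g) (iso_act k x) = iso_inv g x"
      by (simp add: iso_inv_def iso_act_def eq mult_eq matrix_transpose_mul orthogonal_transpose_vector[OF B]
          matrix_vector_right_distrib flip: matrix_vector_mul_assoc)
    then show "G (iso_act k x) (k \<odot> g) = spinor_action k *v G x g"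
      by (simp add: G_def spinor_action_mult[OF k g] matrix_vector_mul_assoc)
  qed
  also have "\<dots> = spinor_action k *v (\<Sum>g\<in>R. G x g)"
    using matrix_vector_mult_scaled_sum[of "spinor_action k" "\<lambda>_. 1" "G x" R] by simp
  finally show ?thesis by (simp add: average_def G_def vector_scalar_commute)
qed

lemma average_fixed:
  assumes "f \<in> twisted"
  shows "average f x = f x"
proof -
  have "spinor_action g *v f (iso_inv g x) = f x" if "g \<in> R" for g
    using assms iso_act_iso_inv[OF R_subset[OF that]] R_subset[OF that] by (metis twisted_spinors_iff)
  then have "average f x = (1 / of_nat (card R)) *s (\<Sum>g\<in>R. f x)" by (simp add: average_def)
  also have "(\<Sum>g\<in>R. f x) = of_nat (card R) *s f x"
    by (simp only: vec_eq_iff sum_component vector_smult_component) simp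
  finally show ?thesis using card_R_pos by simp
qed

lemma average_scaled_sum:
  "average (\<lambda>x. \<Sum>j\<in>J. c j *s F j x) x = (\<Sum>j\<in>J. c j *s average (F j) x)"
proof -
  have "average (\<lambda>x. \<Sum>j\<in>J. c j *s F j x) x
      = (\<Sum>g\<in>R. \<Sum>j\<in>J. (1 / of_nat (card R)) *s (c j *s (spinor_action g *v F j (iso_inv g x))))"
    by (simp add: average_def matrix_vector_mult_scaled_sum vec.scale_sum_right)
  also have "\<dots> = (\<Sum>j\<in>J. c j *s average (F j) x)"
    by (subst sum.swap) (simp add: average_def vec.scale_sum_right vec.scale_left_commute)
  finally show ?thesis .
qed

text \<open>The projection onto the eigenspace of \<open>\<i> u / \<mu>\<close> for the eigenvalue \<open>s\<close>, where \<open>s\<^sup>2 = 1\<close> and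
  \<open>|u| = \<mu>\<close>.\<close>

definition eigenprojection :: "real \<Rightarrow> real \<Rightarrow> (real, 'n) vec \<Rightarrow> complex ^ ('s \<times> 'v) ^ ('s \<times> 'v)" where
  "eigenprojection s \<mu> u = mat (1/2) + mat (of_real s * \<i> / (2 * of_real \<mu>)) ** clifford_mult u"

lemma eigenprojection_vector:
  "eigenprojection s \<mu> u *v a = (1/2) *s a + (of_real s * \<i> / (2 * of_real \<mu>)) *s (clifford_mult u *v a)"
  by (simp add: eigenprojection_def matrix_vector_mult_add_rdistrib mat_vector_mult flip: matrix_vector_mul_assoc)

text \<open>Clifford multiplication by \<open>u\<close> squares to \<open>- \<mu>\<^sup>2\<close>
  and thus interchanges the two summands of the projection up to scalars; \<open>c1\<close> and
  \<open>c2\<close> match these scalars.\<close>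

lemma clifford_mult_eigenprojection:
  assumes s: "s * s = 1" and "norm u = \<mu>" "\<mu> > 0"
  shows "(2 * pi * \<i>) *s (clifford_mult u *v (eigenprojection s \<mu> u *v a))
    = of_real (s * (2 * pi * \<mu>)) *s (eigenprojection s \<mu> u *v a)"
proof -
  have ss: "complex_of_real s * of_real s = 1" using s by (metis of_real_1 of_real_mult)
  have c1: "(2 * pi * \<i>) * (1/2) = of_real (s * (2 * pi * \<mu>)) * (of_real s * \<i> / (2 * of_real \<mu>))"
    using assms(3) ss by (simp add: field_simps)
  have c2: "(2 * pi * \<i>) * (of_real s * \<i> / (2 * of_real \<mu>)) * (- of_real (\<mu>\<^sup>2)) = of_real (s * (2 * pi * \<mu>)) * (1/2)"
    using assms(3) by (simp add: power2_eq_square field_simps)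
  have "(2 * pi * \<i>) *s (clifford_mult u *v (eigenprojection s \<mu> u *v a))
    = ((2 * pi * \<i>) * (1/2)) *s (clifford_mult u *v a)
      + ((2 * pi * \<i>) * (of_real s * \<i> / (2 * of_real \<mu>)) * (- of_real (\<mu>\<^sup>2))) *s a"
    unfolding eigenprojection_vector matrix_vector_right_distrib vector_scalar_commute
      clifford_mult_square_vector assms(2) vec.scale_right_distrib vector_smult_assoc by simp
  also have "\<dots> = of_real (s * (2 * pi * \<mu>)) *s (eigenprojection s \<mu> u *v a)"
    unfolding c1 c2 eigenprojection_vector vec.scale_right_distrib vector_smult_assoc by (rule add.commute)
  finally show ?thesis .
qed

section \<open>A frame of the eigenspace\<close>

definition projected_wave :: "real \<Rightarrow> real \<Rightarrow> (real, 'n) vec \<times> ('s \<times> 'v) \<Rightarrow> (real, 'n) vec \<Rightarrow> complex ^ ('s \<times> 'v)" where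
  "projected_wave s \<mu> i = average (\<lambda>x. plane_wave (fst i) x *s (eigenprojection s \<mu> (fst i) *v axis (snd i) 1))"

text \<open>Averaging spreads one wave over the holonomy orbit of its frequency; the translational
  parts enter as phases.\<close>

lemma projected_wave_eq:
  "projected_wave s \<mu> (u, p) = wave_sum R (\<lambda>g. fst g *v u)
    (\<lambda>g. (plane_wave (- u) (snd g) / of_nat (card R)) *s (spinor_action g *v (eigenprojection s \<mu> u *v axis p 1)))"
proof
  fix x
  have "plane_wave u (iso_inv g x) = plane_wave (fst g *v u) x * plane_wave (- u) (snd g)" for g
    by (simp add: iso_inv_def plane_wave_rotate plane_wave_add_right diff_conv_add_uminus del: add_uminus_conv_diff)
      (simp add: plane_wave_def)
  then show "projected_wave s \<mu> (u, p) x = wave_sum R (\<lambda>g. fst g *v u)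
    (\<lambda>g. (plane_wave (- u) (snd g) / of_nat (card R)) *s (spinor_action g *v (eigenprojection s \<mu> u *v axis p 1))) x"
    by (simp add: projected_wave_def average_def wave_sum_def vector_scalar_commute vec.scale_sum_right mult_ac)
qed

text \<open>The spinor action intertwines Clifford multiplication by \<open>u\<close> and by its
  rotated image, so all waves of the orbit satisfy the same eigenvalue equation.\<close>

lemma projected_wave_eigenspace:
  assumes s: "s * s = 1" "\<nu> = s * (2 * pi * \<mu>)" and \<mu>: "\<mu> > 0" and u: "u \<in> shell \<mu>"
  shows "projected_wave s \<mu> (u, p) \<in> eigenspinors \<nu>"
proof -
  let ?a = "eigenprojection s \<mu> u *v axis p 1"
  have nu: "norm u = \<mu>" using u by (simp add: dual_shell_iff)
  have "smooth (projected_wave s \<mu> (u, p))"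
    unfolding projected_wave_eq by (rule smooth_wave_sum)
  moreover have "projected_wave s \<mu> (u, p) (iso_act g x) = spinor_action g *v projected_wave s \<mu> (u, p) x"
    if "g \<in> \<Gamma>" for g x
    unfolding projected_wave_def
  proof (rule average_equivariant[OF _ that])
    fix l y assume "l \<in> \<Lambda>"
    then have "plane_wave u (y + l) = of_real (\<delta> l) * plane_wave u y"
      using u by (simp add: dual_shell_iff plane_wave_add_right)
    then show "plane_wave (fst (u, p)) (y + l) *s (eigenprojection s \<mu> (fst (u, p)) *v axis (snd (u, p)) 1)
      = of_real (\<delta> l) *s (plane_wave (fst (u, p)) y *s (eigenprojection s \<mu> (fst (u, p)) *v axis (snd (u, p)) 1))"
      by simp
  qed
  moreover have "dirac L (projected_wave s \<mu> (u, p)) x = of_real \<nu> *s projected_wave s \<mu> (u, p) x" for x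
  proof -
    have "(2 * pi * \<i>) *s (clifford_mult (fst g *v u) *v (c *s (spinor_action g *v ?a)))
        = of_real \<nu> *s (c *s (spinor_action g *v ?a))" if "g \<in> R" for g c
    proof -
      have "clifford_mult (fst g *v u) *v (spinor_action g *v a) = spinor_action g *v (clifford_mult u *v a)" for a
        by (simp only: matrix_vector_mul_assoc clifford_mult_spinor_action[OF R_subset[OF that]])
      then have "(2 * pi * \<i>) *s (clifford_mult (fst g *v u) *v (c *s (spinor_action g *v ?a)))
        = c *s (spinor_action g *v ((2 * pi * \<i>) *s (clifford_mult u *v ?a)))"
        by (simp only: vector_scalar_commute vec.scale_left_commute)
      also have "\<dots> = of_real \<nu> *s (c *s (spinor_action g *v ?a))"
        by (simp only: clifford_mult_eigenprojection[OF s(1) nu \<mu>] s(2)[symmetric] vector_scalar_commute vec.scale_left_commute)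
      finally show ?thesis .
    qed
    then show ?thesis
      unfolding projected_wave_eq dirac_wave_sum
      by (simp add: wave_sum_def vec.scale_sum_right mult.left_commute)
  qed
  ultimately show ?thesis by (simp add: dirac_eigenspace_def twisted_spinors_iff)
qed

text \<open>An eigenspinor is already equivariant and its coefficients already lie in the
  eigenspaces of the symbol, so neither projection changes it.\<close>

lemma eigenspinor_frame:
  assumes s: "s * s = 1" "\<nu> = s * (2 * pi * \<mu>)" "\<bar>\<nu>\<bar> = 2 * pi * \<mu>" and \<mu>: "\<mu> > 0"
    and f: "f \<in> eigenspinors \<nu>"
  shows "f x = (\<Sum>(u, p)\<in>shell \<mu> \<times> UNIV. (coeff f u $ p) *s projected_wave s \<mu> (u, p) x)"
proof -
  let ?U = "shell \<mu>"
  have fixed: "eigenprojection s \<mu> u *v coeff f u = coeff f u" if u: "u \<in> ?U" for u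
  proof -
    have "u \<in> dual_lattice A" using u dual_shell_subset by blast
    from coeff_eigen[OF f this]
    have "(2 * pi * \<i>) *s (clifford_mult u *v coeff f u) = of_real (s * (2 * pi * \<mu>)) *s coeff f u" by (simp only: s(2))
    \<comment> \<open>This factor turns the eigenvalue equation into the statement that the second
      summand of the projection also acts as 1/2.\<close>
    then have "(s / (4 * pi * \<mu>)) *s ((2 * pi * \<i>) *s (clifford_mult u *v coeff f u))
       = (s / (4 * pi * \<mu>)) *s (of_real (s * (2 * pi * \<mu>)) *s coeff f u)" by simp
    moreover have "(s / (4 * pi * \<mu>)) * (2 * pi * \<i>) = of_real s * \<i> / (2 * of_real \<mu>)"
      using \<mu> by (simp add: field_simps)
    moreover have "complex_of_real (s / (4 * pi * \<mu>)) * of_real (s * (2 * pi * \<mu>)) = 1/2"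
    proof -
      have "s / (4 * pi * \<mu>) * (s * (2 * pi * \<mu>)) = 1/2" using \<mu> s(1) by (simp add: field_simps)
      then show ?thesis by (metis of_real_mult of_real_divide of_real_1 of_real_numeral)
    qed
    ultimately have h: "(of_real s * \<i> / (2 * of_real \<mu>)) *s (clifford_mult u *v coeff f u) = (1/2) *s coeff f u"
      by (simp only: vector_smult_assoc)
    show ?thesis
      unfolding eigenprojection_vector h by (simp add: vec_eq_iff)
  qed
  have ax: "eigenprojection s \<mu> u *v coeff f u = (\<Sum>p\<in>UNIV. (coeff f u $ p) *s (eigenprojection s \<mu> u *v axis p 1))" for u
    using matrix_vector_mult_scaled_sum[of "eigenprojection s \<mu> u" "\<lambda>p. coeff f u $ p" "\<lambda>p. axis p 1" UNIV]
    by (simp add: basis_expansion)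
  have "(\<Sum>(u, p)\<in>?U \<times> UNIV. (coeff f u $ p) *s projected_wave s \<mu> (u, p) x)
    = (\<Sum>i\<in>?U \<times> UNIV. (coeff f (fst i) $ snd i) *s
        average (\<lambda>x. plane_wave (fst i) x *s (eigenprojection s \<mu> (fst i) *v axis (snd i) 1)) x)"
    by (simp add: projected_wave_def case_prod_beta)
  also have "\<dots> = average (\<lambda>x. \<Sum>i\<in>?U \<times> UNIV. (coeff f (fst i) $ snd i) *s
        (plane_wave (fst i) x *s (eigenprojection s \<mu> (fst i) *v axis (snd i) 1))) x"
    by (rule average_scaled_sum[symmetric])
  also have "(\<lambda>x. \<Sum>i\<in>?U \<times> UNIV. (coeff f (fst i) $ snd i) *s
        (plane_wave (fst i) x *s (eigenprojection s \<mu> (fst i) *v axis (snd i) 1))) = f"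
  proof
    fix x
    have "(\<Sum>i\<in>?U \<times> UNIV. (coeff f (fst i) $ snd i) *s
        (plane_wave (fst i) x *s (eigenprojection s \<mu> (fst i) *v axis (snd i) 1)))
      = (\<Sum>u\<in>?U. \<Sum>p\<in>UNIV. plane_wave u x *s ((coeff f u $ p) *s (eigenprojection s \<mu> u *v axis p 1)))"
      by (simp add: sum.cartesian_product case_prod_beta mult.commute)
    also have "\<dots> = (\<Sum>u\<in>?U. plane_wave u x *s coeff f u)"
      by (intro sum.cong refl) (simp only: vec.scale_sum_right[symmetric] ax[symmetric] fixed)
    also have "\<dots> = f x" by (rule eigenspinor_expansion[OF f s(3), symmetric])
    finally show "(\<Sum>i\<in>?U \<times> UNIV. (coeff f (fst i) $ snd i) *s
        (plane_wave (fst i) x *s (eigenprojection s \<mu> (fst i) *v axis (snd i) 1))) = f x" .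
  qed
  also have "average f x = f x"
    using average_fixed eigenspinor_facts(1)[OF f] by blast
  finally show ?thesis ..
qed

lemma coeff_linear:
  assumes "finite B" "B \<subseteq> eigenspinors \<nu>"
  shows "coeff (\<Sum>b\<in>B. fun_scale (c b) b) u $ p = (\<Sum>b\<in>B. c b * (coeff b u $ p))"
proof -
  have "continuous_on UNIV (\<lambda>x. b x $ p)" if "b \<in> B" for b
    using eigenspinor_facts(5) assms(2) that by blast
  then show ?thesis
    using fourier_coeff_linear[OF assms(1), of "\<lambda>b x. b x $ p" A c u]
    by (simp add: coeff_def sum_fun_apply fun_scale_def)
qed

text \<open>The wave contributed by \<open>g\<close> has the rotated frequency and reaches the
  coefficient at \<open>u\<close> only if \<open>u\<close> is fixed; here the condition
  \<open>B u = u\<close> of the formula originates.\<close>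

lemma coeff_projected_wave:
  assumes u: "u \<in> shell \<mu>"
  shows "coeff (projected_wave s \<mu> (u, p)) u $ p = (\<Sum>g | g \<in> R \<and> fst g *v u = u.
    plane_wave (- u) (snd g) / of_nat (card R) * (spinor_action g ** eigenprojection s \<mu> u) $ p $ p)"
proof -
  let ?w = "\<lambda>g. (plane_wave (- u) (snd g) / of_nat (card R)) *s (spinor_action g *v (eigenprojection s \<mu> u *v axis p 1))"
  have rot: "fst g *v u \<in> dual_lattice A" if "g \<in> R" for g
    using dual_shell_rotate[of "fst g" "snd g" u \<mu>] R_subset[OF that] u dual_shell_subset by auto
  have ud: "u \<in> dual_lattice A" using u dual_shell_subset by blast
  have "(\<lambda>x. projected_wave s \<mu> (u, p) x $ p) = (\<lambda>x. \<Sum>g\<in>R. ?w g $ p * plane_wave (fst g *v u) x)"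
    by (simp add: projected_wave_eq wave_sum_def mult_ac)
  then have "coeff (projected_wave s \<mu> (u, p)) u $ p = (\<Sum>g\<in>R. if fst g *v u = u then ?w g $ p else 0)"
    using fourier_coeff_sum_plane_waves[OF invertible finite_R rot ud, where c = "\<lambda>g. ?w g $ p"] by (simp add: coeff_def)
  also have "\<dots> = (\<Sum>g | g \<in> R \<and> fst g *v u = u. ?w g $ p)"
    by (rule sum.inter_filter[OF finite_R, symmetric])
  also have "\<dots> = (\<Sum>g | g \<in> R \<and> fst g *v u = u.
    plane_wave (- u) (snd g) / of_nat (card R) * (spinor_action g ** eigenprojection s \<mu> u) $ p $ p)"
    by (intro sum.cong refl)
      (simp add: matrix_vector_mul_assoc matrix_vector_mult_axis_nth)
  finally show ?thesis .
qed

text \<open>The frame identity for the dimension: summing diagonal entries over the basis index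
  \<open>p\<close> gives the trace. The second claim is what convergence rests on.\<close>

lemma dirac_mult_frame:
  assumes s: "s * s = 1" "\<nu> = s * (2 * pi * \<mu>)" "\<bar>\<nu>\<bar> = 2 * pi * \<mu>" and \<mu>: "\<mu> > 0"
  shows "of_nat (eigen_mult \<nu>) = (\<Sum>g\<in>R. \<Sum>u | u \<in> shell \<mu> \<and> fst g *v u = u.
      plane_wave (- u) (snd g) / of_nat (card R) * trace (spinor_action g ** eigenprojection s \<mu> u))"
    and "eigen_mult \<nu> \<le> card (shell \<mu>) * CARD('s \<times> 'v)"
proof -
  let ?U = "shell \<mu>" and ?E = "eigenspinors \<nu>"
  let ?\<phi> = "\<lambda>(u, p) f. coeff f u $ p"
  let ?t = "\<lambda>u g p. plane_wave (- u) (snd g) / of_nat (card R) * (spinor_action g ** eigenprojection s \<mu> u) $ p $ p"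
  have fin: "finite (?U \<times> (UNIV :: ('s \<times> 'v) set))" using dual_shell_finite by simp
  have q: "projected_wave s \<mu> i \<in> ?E" if "i \<in> ?U \<times> UNIV" for i
    using that projected_wave_eigenspace[OF s(1,2) \<mu>] by auto
  have ex: "f = (\<Sum>i\<in>?U \<times> UNIV. fun_scale (?\<phi> i f) (projected_wave s \<mu> i))" if "f \<in> ?E" for f
    using eigenspinor_frame[OF s \<mu> that] by (simp add: fun_eq_iff sum_fun_apply fun_scale_def case_prod_beta)
  have lin: "?\<phi> i (\<Sum>b\<in>B. fun_scale (c b) b) = (\<Sum>b\<in>B. c b * ?\<phi> i b)"
    if "finite B" "B \<subseteq> ?E" for i B c
    using coeff_linear[OF that] by (simp add: case_prod_beta)
  note frame = vector_space.dim_eq_frame_sum[OF vector_space_fun_scale fin, of "projected_wave s \<mu>" ?E ?\<phi>, OF q ex lin]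
  show "eigen_mult \<nu> \<le> card ?U * CARD('s \<times> 'v)"
    using frame(2) by (simp add: dirac_mult_def card_cartesian_product)
  have "of_nat (eigen_mult \<nu>) = (\<Sum>(u, p)\<in>?U \<times> UNIV. coeff (projected_wave s \<mu> (u, p)) u $ p)"
    using frame(1) by (simp add: dirac_mult_def case_prod_beta)
  also have "\<dots> = (\<Sum>(u, p)\<in>?U \<times> UNIV. \<Sum>g | g \<in> R \<and> fst g *v u = u. ?t u g p)"
    by (intro sum.cong) (auto simp: coeff_projected_wave)
  also have "\<dots> = (\<Sum>u\<in>?U. \<Sum>g | g \<in> R \<and> fst g *v u = u. \<Sum>p\<in>UNIV. ?t u g p)"
    unfolding sum.cartesian_product[symmetric] by (intro sum.cong refl) (rule sum.swap)
  also have "\<dots> = (\<Sum>u\<in>?U. \<Sum>g | g \<in> R \<and> fst g *v u = u.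
      plane_wave (- u) (snd g) / of_nat (card R) * trace (spinor_action g ** eigenprojection s \<mu> u))"
    by (simp add: trace_def sum_distrib_left)
  also have "\<dots> = (\<Sum>g\<in>R. \<Sum>u | u \<in> ?U \<and> fst g *v u = u.
      plane_wave (- u) (snd g) / of_nat (card R) * trace (spinor_action g ** eigenprojection s \<mu> u))"
    by (rule sum.swap_restrict[OF dual_shell_finite finite_R])
  finally show "of_nat (eigen_mult \<nu>) = \<dots>" .
qed

lemma trace_spinor_action_eigenprojection:
  "trace (spinor_action g ** eigenprojection s \<mu> u)
    = trace (spinor_action g) / 2 + of_real s * \<i> / (2 * of_real \<mu>) * (trace (L (\<epsilon> g * cvec u)) * trace (\<rho> g))"
proof -
  have "spinor_action g ** mat (1/2) = spinor_action g ** (mat (1/2) ** mat 1)" by simp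
  moreover have "trace (spinor_action g ** clifford_mult u) = trace (L (\<epsilon> g * cvec u)) * trace (\<rho> g)"
    by (simp add: spinor_action_def clifford_mult_def kron_mult trace_kron clifford_rep_simps[OF rep])
  ultimately show ?thesis
    by (simp only: eigenprojection_def matrix_add_ldistrib trace_add trace_mult_mat_mult) simp
qed

text \<open>The half-traces of the spinor action do not involve the sign \<open>s\<close> and cancel
  between the two eigenvalues.\<close>

lemma dirac_mult_difference:
  assumes \<mu>: "\<mu> > 0"
  shows "of_nat (eigen_mult (2 * pi * \<mu>)) - of_nat (eigen_mult (- (2 * pi * \<mu>))) =
    (1 / of_nat (card R)) * (\<Sum>g\<in>R. \<Sum>u | u \<in> shell \<mu> \<and> fst g *v u = u.
      plane_wave (- u) (snd g) * (\<i> / of_real \<mu> * trace (L (\<epsilon> g * cvec u)) * trace (\<rho> g)))"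
proof -
  have "trace (spinor_action g ** eigenprojection 1 \<mu> u) - trace (spinor_action g ** eigenprojection (- 1) \<mu> u)
     = \<i> / of_real \<mu> * trace (L (\<epsilon> g * cvec u)) * trace (\<rho> g)" for g u
    unfolding trace_spinor_action_eigenprojection using \<mu> by (simp add: field_simps)
  then have e: "c / of_nat (card R) * trace (spinor_action g ** eigenprojection 1 \<mu> u)
      - c / of_nat (card R) * trace (spinor_action g ** eigenprojection (- 1) \<mu> u)
     = (1 / of_nat (card R)) * (c * (\<i> / of_real \<mu> * trace (L (\<epsilon> g * cvec u)) * trace (\<rho> g)))" for c g u
    unfolding right_diff_distrib[symmetric] by simp
  have p: "of_nat (eigen_mult (2 * pi * \<mu>)) = (\<Sum>g\<in>R. \<Sum>u | u \<in> shell \<mu> \<and> fst g *v u = u.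
      plane_wave (- u) (snd g) / of_nat (card R) * trace (spinor_action g ** eigenprojection 1 \<mu> u))"
    by (rule dirac_mult_frame(1)) (use \<mu> in auto)
  have n: "of_nat (eigen_mult (- (2 * pi * \<mu>))) = (\<Sum>g\<in>R. \<Sum>u | u \<in> shell \<mu> \<and> fst g *v u = u.
      plane_wave (- u) (snd g) / of_nat (card R) * trace (spinor_action g ** eigenprojection (- 1) \<mu> u))"
    by (rule dirac_mult_frame(1)) (use \<mu> in \<open>auto simp: abs_mult\<close>)
  show ?thesis
    unfolding p n sum_subtractf[symmetric] e sum_distrib_left ..
qed

end

section \<open>The eta series\<close>

lemma has_sum_finite_sum:
  fixes f :: "'i \<Rightarrow> 'a \<Rightarrow> 'b::topological_comm_monoid_add"
  assumes "finite I" "\<And>i. i \<in> I \<Longrightarrow> (f i has_sum S i) X"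
  shows "((\<lambda>x. \<Sum>i\<in>I. f i x) has_sum (\<Sum>i\<in>I. S i)) X"
  using assms by (induction I rule: finite_induct) (auto intro: has_sum_add)

lemma norm_powr_of_real:
  "r > 0 \<Longrightarrow> norm (complex_of_real r powr s) = r powr Re s"
  by (subst norm_powr_real_powr) auto

context spin_transversal
begin

abbreviation shell_size :: "real \<Rightarrow> nat" where
  "shell_size \<mu> \<equiv> card {u \<in> dual_lattice A. norm u = \<mu>}"

lemma dirac_mult_bound:
  assumes "\<mu> > 0" "\<bar>\<nu>\<bar> = 2 * pi * \<mu>"
  shows "eigen_mult \<nu> \<le> shell_size \<mu> * CARD('s \<times> 'v)"
proof -
  have "eigen_mult \<nu> \<le> card (shell \<mu>) * CARD('s \<times> 'v)"
  proof (rule dirac_mult_frame(2)[where s = "sgn \<nu>"])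
    have "\<nu> \<noteq> 0" using assms by auto
    then show "sgn \<nu> * sgn \<nu> = 1" by (simp add: sgn_if)
    show "\<nu> = sgn \<nu> * (2 * pi * \<mu>)" by (simp flip: assms(2) add: sgn_mult_abs)
  qed (use assms in auto)
  also have "\<dots> \<le> shell_size \<mu> * CARD('s \<times> 'v)"
    by (intro mult_right_mono dual_shell_card) auto
  finally show ?thesis .
qed

text \<open>Allows the series to be taken over all nonzero reals, so that the spectrum never has to
  be determined.\<close>

lemma eta_term_outside_spectrum:
  assumes "\<nu> \<notin> dirac_spectrum L \<Gamma> \<epsilon> \<rho>"
  shows "eta s \<nu> = 0"
proof -
  interpret vector_space "fun_scale :: complex \<Rightarrow> ((real, 'n) vec \<Rightarrow> complex ^ ('s \<times> 'v)) \<Rightarrow> _"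
    by (rule vector_space_fun_scale)
  have "eigenspinors \<nu> \<subseteq> span {}"
    using assms by (auto simp: dirac_spectrum_def zero_fun_def)
  then have "eigen_mult \<nu> \<le> card ({} :: ((real, 'n) vec \<Rightarrow> complex ^ ('s \<times> 'v)) set)"
    unfolding dirac_mult_def by (rule dim_le_card) simp
  then show ?thesis by (simp add: eta_term_def)
qed

lemma summable_shells:
  assumes "Re s > real CARD('n)"
  shows "(\<lambda>\<mu>. norm (complex_of_real \<mu> powr (- s) * of_nat (shell_size \<mu>))) summable_on {0<..}"
proof -
  have "(\<lambda>\<mu>. real (shell_size \<mu>) * \<mu> powr (- Re s)) summable_on {0<..}"
    by (rule summable_on_dual_lattice_shells[OF invertible assms])
  then show ?thesis
    by (rule summable_on_cong[THEN iffD1, rotated]) (simp add: norm_mult norm_powr_of_real)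
qed

lemma eta_term_summable:
  assumes s: "Re s > real CARD('n)" and e: "\<bar>e\<bar> = 1"
  shows "(\<lambda>\<mu>. eta s (e * (2 * pi * \<mu>))) summable_on {0<..}"
proof (rule abs_summable_summable[OF Infinite_Sum.abs_summable_on_comparison_test])
  \<comment> \<open>The rank of the spinor bundle from the bound on multiplicities, times the part
    of \<open>(2 \<pi> \<mu>) powr (- s)\<close> independent of \<open>\<mu>\<close>.\<close>
  let ?C = "of_nat CARD('s \<times> 'v) * complex_of_real (2 * pi) powr (- s)"
  show "(\<lambda>\<mu>. norm (?C * (complex_of_real \<mu> powr (- s) * of_nat (shell_size \<mu>)))) summable_on {0<..}"
    unfolding norm_mult[of ?C] by (rule summable_on_cmult_right[OF summable_shells[OF s]])
  fix \<mu> :: real assume "\<mu> \<in> {0<..}"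
  then have \<mu>: "\<mu> > 0" by simp
  have ab: "\<bar>e * (2 * pi * \<mu>)\<bar> = 2 * pi * \<mu>" using \<mu> e by (simp add: abs_mult)
  have "norm (eta s (e * (2 * pi * \<mu>)))
      \<le> real (eigen_mult (e * (2 * pi * \<mu>))) * (2 * pi * \<mu>) powr (- Re s)"
    unfolding eta_term_def ab using \<mu>
    by (simp add: norm_mult norm_powr_of_real[of "2 * pi * \<mu>" "- s", simplified] abs_sgn_eq mult_left_mono)
  also have "\<dots> \<le> real (shell_size \<mu> * CARD('s \<times> 'v)) * (2 * pi * \<mu>) powr (- Re s)"
    using dirac_mult_bound[OF \<mu> ab] by (intro mult_right_mono of_nat_mono) auto
  also have "\<dots> = norm (?C * (complex_of_real \<mu> powr (- s) * of_nat (shell_size \<mu>)))"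
    using \<mu> norm_powr_of_real[of "2 * pi" "- s"]
    by (simp add: norm_mult norm_powr_of_real powr_mult mult_ac)
  finally show "norm (eta s (e * (2 * pi * \<mu>)))
    \<le> norm (?C * (complex_of_real \<mu> powr (- s) * of_nat (shell_size \<mu>)))" .
qed

lemma norm_exp_sum_le:
  "norm (exp_sum \<Gamma> \<epsilon> h g y \<mu>) \<le> real (shell_size \<mu>)"
proof -
  have "norm (exp_sum \<Gamma> \<epsilon> h g y \<mu>) \<le> (\<Sum>u | u \<in> shell \<mu> \<and> fst g *v u = u. 1)"
    unfolding exp_sum_def by (intro order_trans[OF norm_sum] sum_mono) (simp add: norm_mult spin_sign_def)
  also have "\<dots> \<le> real (card (shell \<mu>))"
    using dual_shell_finite by (simp add: card_mono)
  also have "\<dots> \<le> real (shell_size \<mu>)" using dual_shell_card by simp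
  finally show ?thesis .
qed

lemma exp_sum_summable:
  assumes s: "Re s > real CARD('n)" and X: "X \<subseteq> {0<..}"
  shows "(\<lambda>\<mu>. exp_sum \<Gamma> \<epsilon> h g y \<mu> / complex_of_real \<bar>\<mu>\<bar> powr s) summable_on X"
proof (rule abs_summable_summable[OF Infinite_Sum.abs_summable_on_comparison_test])
  show "(\<lambda>\<mu>. norm (complex_of_real \<mu> powr (- s) * of_nat (shell_size \<mu>))) summable_on X"
    by (rule summable_on_subset_banach[OF summable_shells[OF s] X])
  fix \<mu> assume "\<mu> \<in> X"
  then have \<mu>: "\<mu> > 0" using X by auto
  then show "norm (exp_sum \<Gamma> \<epsilon> h g y \<mu> / complex_of_real \<bar>\<mu>\<bar> powr s)
    \<le> norm (complex_of_real \<mu> powr (- s) * of_nat (shell_size \<mu>))"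
    using mult_right_mono[OF norm_exp_sum_le[of h g y \<mu>], of "\<mu> powr (- Re s)"]
    by (simp add: norm_mult norm_divide norm_powr_of_real powr_minus divide_inverse mult.commute)
qed

text \<open>The length \<open>\<mu>\<close> from normalising \<open>u\<close> cancels against the
  \<open>1 / \<mu>\<close> of the eigenprojection, whose \<open>\<i>\<close> is the one absorbed in
  \<open>(2 * \<i>) ^ m\<close>.\<close>

lemma fixed_wave_trace:
  assumes module: "spin_module m L" and n: "CARD('n) = 2 * m + 1" and g: "g \<in> \<Gamma>"
    and x: "y = torus_elem m t" "k \<in> carrier Spin" "spin_mu k (\<epsilon> g) = y"
    and h: "h u \<in> carrier Spin" "spin_mu (h u) (cvec u) = cvec (norm u *\<^sub>R ebasis CARD('n))"
    and u: "u \<in> shell \<mu>" "fst g *v u = u" and \<mu>: "\<mu> > 0"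
  shows "\<i> / of_real \<mu> * trace (L (\<epsilon> g * cvec u)) =
    (2 * \<i>) ^ m * of_real (\<Prod>j = 1..m. sin (t j)) * spin_sign \<epsilon> h g y u"
proof -
  have nu: "norm u = \<mu>" using u by (simp add: dual_shell_iff)
  then have u0: "u \<noteq> 0" using \<mu> by auto
  have comm: "\<epsilon> g * cvec u = cvec u * \<epsilon> g" using eps_vec[OF g, of u] u(2) by simp
  have "trace (L (\<epsilon> g * cvec u)) = of_real \<mu> * spin_sign \<epsilon> h g y u * trace (L (y * cvec (ebasis CARD('n))))"
    using trace_fixed_vector_sign[OF rep eps_Spin[OF g] comm h x(2,3) _ u0]
      ebasis_last_commute_torus[OF n, of t] by (simp add: x(1) nu spin_sign_def)
  then have "\<i> / of_real \<mu> * trace (L (\<epsilon> g * cvec u))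
      = spin_sign \<epsilon> h g y u * (\<i> * trace (L (torus_elem m t * cvec (ebasis CARD('n)))))"
    using \<mu> by (simp add: x(1))
  then show ?thesis
    unfolding trace_spin_module_torus[OF module n] by (simp add: mult_ac)
qed

lemma dirac_mult_difference_exp_sum:
  fixes x :: "'n isom \<Rightarrow> 'n clifford"
  assumes module: "spin_module m L" and n: "CARD('n) = 2 * m + 1"
    and x: "\<And>g. g \<in> \<Gamma> \<Longrightarrow> x g = torus_elem m (t (x g))"
      "\<And>g. g \<in> \<Gamma> \<Longrightarrow> \<exists>k \<in> carrier Spin. spin_mu k (\<epsilon> g) = x g"
    and h: "\<And>u. u \<noteq> 0 \<Longrightarrow> h u \<in> carrier Spin"
      "\<And>u. u \<noteq> 0 \<Longrightarrow> spin_mu (h u) (cvec u) = cvec (norm u *\<^sub>R ebasis CARD('n))"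
    and \<mu>: "\<mu> > 0"
  shows "of_nat (eigen_mult (2 * pi * \<mu>)) - of_nat (eigen_mult (- (2 * pi * \<mu>))) =
    (2 * \<i>) ^ m / of_nat (card R) * (\<Sum>g | g \<in> R \<and> fst g \<in> holonomy1 \<Gamma>.
      trace (\<rho> g) * of_real (\<Prod>j = 1..m. sin (t (x g) j)) * exp_sum \<Gamma> \<epsilon> h g (x g) \<mu>)"
proof -
  let ?S = "\<lambda>g. \<Sum>u | u \<in> shell \<mu> \<and> fst g *v u = u.
      plane_wave (- u) (snd g) * (\<i> / of_real \<mu> * trace (L (\<epsilon> g * cvec u)) * trace (\<rho> g))"
  have zero: "?S g = 0" if g: "g \<in> R" "fst g \<notin> holonomy1 \<Gamma>" for g
  proof (intro sum.neutral ballI)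
    fix u assume u: "u \<in> {u. u \<in> shell \<mu> \<and> fst g *v u = u}"
    then have "u \<noteq> 0" using \<mu> by (auto simp: dual_shell_iff)
    have "fixed_dim (fst g) \<noteq> 1"
      using g R_subset[OF g(1)] by (auto simp: holonomy1_def holonomy_def)
    then have "trace (L (\<epsilon> g * cvec u)) = 0"
      using u by (intro trace_fixed_dim_ne_1[OF rep eps_vec[OF R_subset[OF g(1)]] \<open>u \<noteq> 0\<close>]) auto
    then show "plane_wave (- u) (snd g) * (\<i> / of_real \<mu> * trace (L (\<epsilon> g * cvec u)) * trace (\<rho> g)) = 0" by simp
  qed
  have one: "?S g = (2 * \<i>) ^ m * (trace (\<rho> g) * of_real (\<Prod>j = 1..m. sin (t (x g) j)) * exp_sum \<Gamma> \<epsilon> h g (x g) \<mu>)"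
    if g: "g \<in> R" for g
  proof -
    note gG = R_subset[OF g]
    obtain k where k: "k \<in> carrier Spin" "spin_mu k (\<epsilon> g) = x g" using x(2)[OF gG] by blast
    have "?S g = (\<Sum>u | u \<in> shell \<mu> \<and> fst g *v u = u.
      (2 * \<i>) ^ m * (trace (\<rho> g) * of_real (\<Prod>j = 1..m. sin (t (x g) j)))
        * (spin_sign \<epsilon> h g (x g) u * exp (- 2 * pi * \<i> * of_real (u \<bullet> snd g))))"
    proof (intro sum.cong refl)
      fix u assume u: "u \<in> {u. u \<in> shell \<mu> \<and> fst g *v u = u}"
      then have u0: "u \<noteq> 0" using \<mu> by (auto simp: dual_shell_iff)
      have f: "\<i> / of_real \<mu> * trace (L (\<epsilon> g * cvec u)) =
        (2 * \<i>) ^ m * of_real (\<Prod>j = 1..m. sin (t (x g) j)) * spin_sign \<epsilon> h g (x g) u"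
        using u by (intro fixed_wave_trace[where h = h and u = u, OF module n gG x(1)[OF gG] k h(1)[OF u0] h(2)[OF u0] _ _ \<mu>]) auto
      have "plane_wave (- u) (snd g) = exp (- 2 * pi * \<i> * of_real (u \<bullet> snd g))"
        by (simp add: plane_wave_def)
      then show "plane_wave (- u) (snd g) * (\<i> / of_real \<mu> * trace (L (\<epsilon> g * cvec u)) * trace (\<rho> g))
        = (2 * \<i>) ^ m * (trace (\<rho> g) * of_real (\<Prod>j = 1..m. sin (t (x g) j)))
        * (spin_sign \<epsilon> h g (x g) u * exp (- 2 * pi * \<i> * of_real (u \<bullet> snd g)))"
        unfolding f by (simp only: mult_ac)
    qed
    then show ?thesis by (simp only: exp_sum_def sum_distrib_left mult.assoc)
  qed
  have "(\<Sum>g\<in>R. ?S g) = (\<Sum>g | g \<in> R \<and> fst g \<in> holonomy1 \<Gamma>. ?S g)"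
    using finite_R zero by (intro sum.mono_neutral_right) auto
  also have "\<dots> = (\<Sum>g | g \<in> R \<and> fst g \<in> holonomy1 \<Gamma>. (2 * \<i>) ^ m *
      (trace (\<rho> g) * of_real (\<Prod>j = 1..m. sin (t (x g) j)) * exp_sum \<Gamma> \<epsilon> h g (x g) \<mu>))"
    by (intro sum.cong refl one) simp
  finally show ?thesis
    unfolding dirac_mult_difference[OF \<mu>] by (simp add: sum_distrib_left)
qed

end

theorem proposition2p9:
  fixes \<Gamma> R :: "'n::{finite,linorder} isom set"
    and \<epsilon> :: "'n isom \<Rightarrow> 'n clifford"
    and L :: "'n clifford \<Rightarrow> complex ^ 's ^ 's"
    and \<rho> :: "'n isom \<Rightarrow> complex ^ 'v ^ 'v"
    and x :: "'n isom \<Rightarrow> 'n clifford"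
    and t :: "'n clifford \<Rightarrow> nat \<Rightarrow> real"
    and h :: "real ^ 'n::{finite,linorder} \<Rightarrow> 'n clifford"
    and n m r :: nat
    and s :: complex
  assumes "n = 4 * r + 3" and "m = 2 * r + 1" and "CARD('n) = n"
    and "bieberbach_group \<Gamma>"
    and "\<forall>B \<in> holonomy \<Gamma>. rotation_matrix B"
    and "spin_structure \<Gamma> \<epsilon>"
    and "spin_module m L"
    and "\<rho> \<in> hom (group_of \<Gamma>) unitary_group"
    and "\<forall>l \<in> trans_lattice \<Gamma>. \<rho> (translation l) = mat 1"
    and "transversal \<Gamma> R"
    and "\<forall>g \<in> \<Gamma>. x g \<in> spin_torus m \<and> (\<exists>k \<in> carrier Spin. spin_mu k (\<epsilon> g) = x g)"
    and "\<forall>g \<in> \<Gamma>. x g = torus_elem m (t (x g))"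
    and "\<forall>u. u \<noteq> 0 \<longrightarrow> h u \<in> carrier Spin \<and> spin_mu (h u) (cvec u) = cvec (norm u *\<^sub>R ebasis n)"
    and "Re s > real n"
  shows "eta_term L \<Gamma> \<epsilon> \<rho> s summable_on (dirac_spectrum L \<Gamma> \<epsilon> \<rho> - {0}) \<and>
    (\<forall>g \<in> R. fst g \<in> holonomy1 \<Gamma> \<longrightarrow>
       (\<lambda>\<mu>. exp_sum \<Gamma> \<epsilon> h g (x g) \<mu> / complex_of_real \<bar>\<mu>\<bar> powr s) summable_on asym_set L \<Gamma> \<epsilon> \<rho>) \<and>
    eta_series L \<Gamma> \<epsilon> \<rho> s =
      (2 * \<i>) ^ m / (of_nat (card (holonomy \<Gamma>)) * complex_of_real (2 * pi) powr s) *
      (\<Sum>g | g \<in> R \<and> fst g \<in> holonomy1 \<Gamma>.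
         trace (\<rho> g) * of_real (\<Prod>j = 1..m. sin (t (x g) j)) *
         (\<Sum>\<^sub>\<infinity>\<mu> \<in> asym_set L \<Gamma> \<epsilon> \<rho>. exp_sum \<Gamma> \<epsilon> h g (x g) \<mu> / complex_of_real \<bar>\<mu>\<bar> powr s))"
proof -
  have n: "CARD('n) = 2 * m + 1" using assms(1-3) by simp
  have rep: "clifford_rep L" using assms(7) by (simp add: spin_module_def irreducible_clifford_rep_def)
  interpret spin_data \<Gamma> \<epsilon> L \<rho>
    using assms(4,6,8,9) rep by unfold_locales auto
  obtain A :: "((real, 'n) vec, 'n) vec" where A: "invertible A" "\<And>i. column i A \<in> trans_lattice \<Gamma>"
    "\<And>i. spin_char \<epsilon> (column i A) = 1" using period_matrix by blast
  interpret spin_transversal \<Gamma> \<epsilon> L \<rho> A R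
    using A assms(10) by unfold_locales auto
  have s: "Re s > real CARD('n)" using assms(3,14) by simp
  let ?\<eta> = "eta_term L \<Gamma> \<epsilon> \<rho> s" and ?X = "asym_set L \<Gamma> \<epsilon> \<rho>" and ?Spec = "dirac_spectrum L \<Gamma> \<epsilon> \<rho>"
  let ?T = "\<lambda>g \<mu>. exp_sum \<Gamma> \<epsilon> h g (x g) \<mu> / complex_of_real \<bar>\<mu>\<bar> powr s"
  let ?G = "{g. g \<in> R \<and> fst g \<in> holonomy1 \<Gamma>}"
  let ?c = "\<lambda>g. trace (\<rho> g) * of_real (\<Prod>j = 1..m. sin (t (x g) j))"
  let ?C = "(2 * \<i>) ^ m / (of_nat (card (holonomy \<Gamma>)) * complex_of_real (2 * pi) powr s)"
  have Xpos: "?X \<subseteq> {0<..}" by (auto simp: asym_set_def)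
  have Tsum: "?T g summable_on ?X" for g by (rule exp_sum_summable[OF s Xpos])
  \<comment> \<open>The factors 1 and \<open>- 1\<close> are kept explicit so that both rays have
    the shape \<open>e * (2 * pi * \<mu>)\<close> for which summability is known.\<close>
  have bp: "bij_betw (\<lambda>\<mu>. 1 * (2 * pi * \<mu>)) {0<..} {0<..}"
    by (rule bij_betw_byWitness[where f' = "\<lambda>\<nu>. \<nu> / (2 * pi)"]) auto
  have bn: "bij_betw (\<lambda>\<mu>. - 1 * (2 * pi * \<mu>)) {0<..} {..<0}"
    by (rule bij_betw_byWitness[where f' = "\<lambda>\<nu>. - \<nu> / (2 * pi)"]) (auto simp: divide_neg_pos)
  have sp: "(\<lambda>\<mu>. ?\<eta> (1 * (2 * pi * \<mu>))) summable_on {0<..}" and sn: "(\<lambda>\<mu>. ?\<eta> (- 1 * (2 * pi * \<mu>))) summable_on {0<..}"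
    by (rule eta_term_summable[OF s]; simp)+
  have sp': "?\<eta> summable_on {0<..}" using sp by (simp only: summable_on_reindex_bij_betw[OF bp])
  have sn': "?\<eta> summable_on {..<0}" using sn by (simp only: summable_on_reindex_bij_betw[OF bn])
  have un: "{0<..} \<union> {..<0} = UNIV - {0::real}" and disj: "{0<..} \<inter> {..<0} = ({} :: real set)" by auto
  have all: "?\<eta> summable_on (UNIV - {0})"
    using summable_on_Un_disjoint[OF sp' sn' disj] by (simp only: un)
  have spec: "?\<eta> summable_on (?Spec - {0})"
    by (rule summable_on_subset_banach[OF all]) auto
  have diff: "?\<eta> (1 * (2 * pi * \<mu>)) + ?\<eta> (- 1 * (2 * pi * \<mu>)) =
     (of_nat (dirac_mult L \<Gamma> \<epsilon> \<rho> (2 * pi * \<mu>)) - of_nat (dirac_mult L \<Gamma> \<epsilon> \<rho> (- (2 * pi * \<mu>))))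
       * complex_of_real (2 * pi * \<mu>) powr (- s)" if "\<mu> > 0" for \<mu>
    using that by (simp add: eta_term_def abs_mult sgn_mult left_diff_distrib)
  \<comment> \<open>Pairing opposite eigenvalues leaves the difference of multiplicities, which is
    the exponential sum formula.\<close>
  have key: "?\<eta> (1 * (2 * pi * \<mu>)) + ?\<eta> (- 1 * (2 * pi * \<mu>)) = ?C * (\<Sum>g\<in>?G. ?c g * ?T g \<mu>)" if \<mu>: "\<mu> > 0" for \<mu>
  proof -
    have pw: "complex_of_real (2 * pi * \<mu>) powr (- s) = 1 / (complex_of_real (2 * pi) powr s * complex_of_real \<bar>\<mu>\<bar> powr s)"
      using \<mu> powr_times_real[of "complex_of_real (2 * pi)" "complex_of_real \<mu>" s]
      by (simp add: powr_minus divide_inverse)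
    have "of_nat (dirac_mult L \<Gamma> \<epsilon> \<rho> (2 * pi * \<mu>)) - of_nat (dirac_mult L \<Gamma> \<epsilon> \<rho> (- (2 * pi * \<mu>))) =
      (2 * \<i>) ^ m / of_nat (card R) * (\<Sum>g\<in>?G. ?c g * exp_sum \<Gamma> \<epsilon> h g (x g) \<mu>)"
      using assms(3,11,12,13) by (intro dirac_mult_difference_exp_sum[OF assms(7) n _ _ _ _ \<mu>]) auto
    then show ?thesis
      unfolding diff[OF \<mu>] pw card_R by (simp add: sum_distrib_left sum_distrib_right sum_divide_distrib mult_ac)
  qed
  \<comment> \<open>From the spectrum to all nonzero reals, then to two rays folded onto positive
    \<open>\<mu>\<close>.\<close>
  have "eta_series L \<Gamma> \<epsilon> \<rho> s = infsum ?\<eta> (UNIV - {0})"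
    unfolding eta_series_def by (rule infsum_cong_neutral) (auto simp: eta_term_outside_spectrum)
  also have "\<dots> = infsum ?\<eta> {0<..} + infsum ?\<eta> {..<0}"
    using infsum_Un_disjoint[OF sp' sn' disj] by (simp only: un)
  also have "\<dots> = infsum (\<lambda>\<mu>. ?\<eta> (1 * (2 * pi * \<mu>))) {0<..} + infsum (\<lambda>\<mu>. ?\<eta> (- 1 * (2 * pi * \<mu>))) {0<..}"
    by (simp only: infsum_reindex_bij_betw[OF bp] infsum_reindex_bij_betw[OF bn])
  also have "\<dots> = infsum (\<lambda>\<mu>. ?\<eta> (1 * (2 * pi * \<mu>)) + ?\<eta> (- 1 * (2 * pi * \<mu>))) {0<..}"
    by (rule infsum_add[OF sp sn, symmetric])
  \<comment> \<open>Where the two multiplicities agree the paired term vanishes, although a single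
    exponential sum need not; hence the restriction to \<open>asym_set\<close> comes before the
    finite sum over \<open>g\<close> is pulled out.\<close>
  also have "\<dots> = infsum (\<lambda>\<mu>. ?C * (\<Sum>g\<in>?G. ?c g * ?T g \<mu>)) ?X"
  proof (rule infsum_cong_neutral)
    fix \<mu> :: real assume "\<mu> \<in> {0<..} - ?X"
    then have "\<mu> > 0" "dirac_mult L \<Gamma> \<epsilon> \<rho> (2 * pi * \<mu>) = dirac_mult L \<Gamma> \<epsilon> \<rho> (- (2 * pi * \<mu>))"
      by (auto simp: asym_set_def)
    then show "?\<eta> (1 * (2 * pi * \<mu>)) + ?\<eta> (- 1 * (2 * pi * \<mu>)) = 0" by (simp only: diff) simp
  qed (use Xpos in \<open>auto simp only: key greaterThan_iff Diff_iff Int_iff\<close>)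
  also have "\<dots> = ?C * (\<Sum>g\<in>?G. ?c g * infsum (?T g) ?X)"
  proof (rule infsumI[OF has_sum_cmult_right[OF has_sum_finite_sum]])
    show "finite ?G" using finite_R by simp
    show "((\<lambda>\<mu>. ?c g * ?T g \<mu>) has_sum (?c g * infsum (?T g) ?X)) ?X" for g
      by (intro has_sum_cmult_right has_sum_infsum Tsum)
  qed
  finally have "eta_series L \<Gamma> \<epsilon> \<rho> s = ?C * (\<Sum>g\<in>?G. ?c g * infsum (?T g) ?X)" .
  with spec Tsum show ?thesis by blast
qed

end
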